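(* Let $\mathbf r(t)=\sum_{i=0}^{q+1}\mathbf r_iN^{2n+1}_{i,\rho}(t)$, $t\in[t_n,t_{p+1}]$, $q=(n+1)(p+n)$, be the regular Pythagorean-Hodograph B-spline curve with $\mathbf r'=\mathbf z^2=\mathbf p=\sum_{k=0}^q\mathbf p_kN^{2n}_{k,\nu}$ and parametric speed $\sigma=|\mathbf z|^2=\sum_{k=0}^q\sigma_kN^{2n}_{k,\nu}$ constructed in the context, with $\sigma(t)\ne0$. Let $$\tau=\{\langle t_{-1}\rangle^{2n+1},\{\langle t_k\rangle^{3n+2}\}_{k=0,\dots,p+n+1},\langle t_{p+n+2}\rangle^{2n+1}\},\qquad w=(3n+2)(p+n+2)-1.$$ For $0\le i\le q+1$, $0\le j\le q$ one can write $$N^{2n+1}_{i,\rho}(t)N^{2n}_{j,\nu}(t)=\sum_{k=0}^w\zeta^{i,j}_kN^{4n+1}_{k,\tau}(t),$$ where $\zeta^{i,j}=(\zeta^{i,j}_0,\dots,\zeta^{i,j}_w)^T$ is obtained by solving the linear system $C\zeta^{i,j}=e^{i,j}$ with $$C=(c_{k,h})_{k,h=0,\dots,w},\quad c_{k,h}=\int_{t_0}^{t_{p+n+1}}N^{4n+1}_{k,\tau}(t)N^{4n+1}_{h,\tau}(t)\,dt,\qquad e^{i,j}_h=\int_{t_0}^{t_{p+n+1}}N^{2n+1}_{i,\rho}(t)N^{2n}_{j,\nu}(t)N^{4n+1}_{h,\tau}(t)\,dt;$$ $C$ is a banded Gramian and thus nonsingular, so each of these systems has a unique solution. The offset curve $\mathbf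 r_h(t)=\mathbf r(t)+h\,\mathbf n(t)$ at signed distance $h$, with $\mathbf n(t)=-\mathrm i\,\mathbf r'(t)/\sigma(t)$, has the rational B-spline form $$\mathbf r_h(t)=\frac{\sum_{k=0}^w\mathbf q_kN^{4n+1}_{k,\tau}(t)}{\sum_{k=0}^w\gamma_kN^{4n+1}_{k,\tau}(t)},$$ where, for $k=0,\dots,w$, $$\mathbf q_k=\sum_{i=0}^{q+1}\sum_{j=0}^q(\sigma_j\mathbf r_i-\mathrm i\,h\,\mathbf p_j)\zeta^{i,j}_k,\qquad \gamma_k=\sum_{i=0}^{q+1}\sum_{j=0}^q\sigma_j\zeta^{i,j}_k.$$ In the clamped case (described in the context) one has $\tau=\{\langle t_n\rangle^{4n+2},\{\langle t_k\rangle^{3n+2}\}_{k=n+1,\dots,m},\langle t_{m+1}\rangle^{4n+2}\}$ and $w=4n+1+(m-n)(3n+2)$; in the closed case ($p=m+n$) one has $\tau=\{\langle t_{-1}\rangle^{2n+1},\{\langle t_k\rangle^{3n+2}\}_{k=0,\dots,m+2n+1},\langle t_{m+2n+2}\rangle^{2n+1}\}$ and $w=(3n+2)(m+2n+2)-1$.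
   Context: Normalized B-splines: for a nondecreasing knot sequence $\mu=\{t_i\}$, $N^0_{i,\mu}(t)=1$ if $t\in[t_i,t_{i+1})$ and $0$ otherwise, and $N^n_{i,\mu}(t)=\frac{t-t_i}{t_{i+n}-t_i}N^{n-1}_{i,\mu}(t)+\frac{t_{i+n+1}-t}{t_{i+n+1}-t_{i+1}}N^{n-1}_{i+1,\mu}(t)$ with $0/0=0$. Basis functions are indexed starting at $0$. $\langle t\rangle^k$ denotes the knot $t$ repeated $k$ times. Points of $\mathbb R^2$ are identified with complex numbers. General construction. Let $n,p\in\mathbb N$, $p\ge n$, let $\mu=\{t_i\}_{i=0,\dots,p+n+1}$, $t_i\le t_{i+1}$, be a knot partition, $\mathbf z_0,\dots,\mathbf z_p\in\mathbb C$, $\mathbf z(t)=\sum_{i=0}^p\mathbf z_iN^n_{i,\mu}(t)$. Let $\nu=\{s_i\}_{i=0,\dots,(p+n+2)(n+1)-1}=\{\langle t_i\rangle^{n+1}\}_{i=0,\dots,p+n+1}$. For $0\le i,j\le p$, $\chi^{i,j}$ is the solution of $A\chi^{i,j}=b^{i,j}$ with $a_{k,l}=\int_{t_0}^{t_{p+n+1}}N^{2n}_{k,\nu}N^{2n}_{l,\nu}\,dt$, $b^{i,j}_l=\int_{t_0}^{t_{p+n+1}}N^n_{i,\mu}N^n_{j,\mu}N^{2n}_{l,\nu}\,dt$ ($k,l=0,\dots,q$), giving $N^n_{i,\mu}N^n_{j,\mu}=\sum_{k=0}^q\chi^{i,j}_kN^{2n}_{k,\nu}$; $\mathbf p_k=\sum_{i,j=0}^p\chi^{i,j}_k\mathbf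 z_i\mathbf z_j$ and $\sigma_k=\sum_{i,j=0}^p\chi^{i,j}_k\mathbf z_i\bar{\mathbf z}_j$. Let $t_{-1}\le t_0$, $t_{p+n+2}\ge t_{p+n+1}$ and $\rho=\{t_{-1},\{\langle t_k\rangle^{n+1}\}_{k=0,\dots,p+n+1},t_{p+n+2}\}$; $\mathbf r_0$ is arbitrary and $\mathbf r_{i+1}=\mathbf r_i+\frac{s_{i+2n+1}-s_i}{2n+1}\mathbf p_i$ for $i=0,\dots,q$. Clamped case. Here $p=m$ and $\mu=\{\langle t_n\rangle^{n+1},\{t_i\}_{i=n+1,\dots,m},\langle t_{m+1}\rangle^{n+1}\}$; redundant knots and control points are removed, so that the same construction is used with $q=2n+(n+1)(m-n)$, $\nu=\{s_i\}=\{\langle t_n\rangle^{2n+1},\{\langle t_i\rangle^{n+1}\}_{i=n+1,\dots,m},\langle t_{m+1}\rangle^{2n+1}\}$ and $\rho=\{\langle t_n\rangle^{2n+2},\{\langle t_i\rangle^{n+1}\}_{i=n+1,\dots,m},\langle t_{m+1}\rangle^{2n+2}\}$.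
   Formalization: Outside the clamped case C is singular; proved there: solvability, uniqueness of coefficients of non-vanishing B-splines, formulas for every solution, nonsingular Gramian over [t_{-1},t_{p+n+2}] if end knots differ. Assumes n≥1, distinct inner knots; clamped end values are left limits. *)

theory Defs
  imports "HOL-Analysis.Henstock_Kurzweil_Integration" "Jordan_Normal_Form.Matrix"
begin

section \<open>B-splines\<close>

text \<open>Knot sequences are lists. \<open>bspl \<kappa> d i\<close> is the normalized B-spline of degree \<open>d\<close> with index \<open>i\<close>
  over \<open>\<kappa>\<close>; the convention \<open>0/0 = 0\<close> is the one of HOL.\<close>

fun bspl :: "real list \<Rightarrow> nat \<Rightarrow> nat \<Rightarrow> real \<Rightarrow> real" where
  "bspl \<kappa> 0 i s = (if \<kappa> ! i \<le> s \<and> s < \<kappa> ! (i + 1) then 1 else 0)"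
| "bspl \<kappa> (Suc d) i s =
     (s - \<kappa> ! i) / (\<kappa> ! (i + Suc d) - \<kappa> ! i) * bspl \<kappa> d i s
   + (\<kappa> ! (i + Suc d + 1) - s) / (\<kappa> ! (i + Suc d + 1) - \<kappa> ! (i + 1)) * bspl \<kappa> d (i + 1) s"

text \<open>With half-open knot intervals every B-spline over a clamped knot sequence vanishes at the last
  knot \<open>b\<close>, although \<open>b\<close> belongs to the parameter interval. There the value at \<open>b\<close> is understood
  by continuity from the left.\<close>

definition bspl_cl :: "real \<Rightarrow> real list \<Rightarrow> nat \<Rightarrow> nat \<Rightarrow> real \<Rightarrow> real" where
  "bspl_cl b \<kappa> d i s = (if s = b then Lim (at_left b) (bspl \<kappa> d i) else bspl \<kappa> d i s)"

definition mult_knots :: "nat \<Rightarrow> (int \<Rightarrow> real) \<Rightarrow> int \<Rightarrow> int \<Rightarrow> real list" where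
  "mult_knots k t l u = concat (map (\<lambda>i. replicate k (t i)) [l..u])"

definition knots :: "nat \<Rightarrow> nat \<Rightarrow> (int \<Rightarrow> real) \<Rightarrow> int \<Rightarrow> int \<Rightarrow> real list" where
  "knots e k t l u = replicate e (t (l - 1)) @ mult_knots k t l u @ replicate e (t (u + 1))"


section \<open>The data of the construction\<close>

text \<open>The control points of \<open>z\<close> have indices \<open>0..maxZ\<close>; \<open>maxP\<close> and \<open>maxT\<close> are the largest indices
  \<open>q\<close> and \<open>w\<close> of the B-splines over \<open>nuK\<close> and \<open>tauK\<close>. All integrals are taken over
  \<open>{intA..intB}\<close>, and the curves are considered on \<open>{domA..domB}\<close>.\<close>

record bs_setting =
  basis :: "real list \<Rightarrow> nat \<Rightarrow> nat \<Rightarrow> real \<Rightarrow> real"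
  deg :: nat
  maxZ :: nat
  maxP :: nat
  maxT :: nat
  muK :: "real list"
  nuK :: "real list"
  rhoK :: "real list"
  tauK :: "real list"
  intA :: real
  intB :: real
  domA :: real
  domB :: real

definition general_setting :: "nat \<Rightarrow> nat \<Rightarrow> (int \<Rightarrow> real) \<Rightarrow> bs_setting" where
  "general_setting n p t =
    \<lparr> basis = bspl, deg = n, maxZ = p,
      maxP = (n + 1) * (p + n),
      maxT = (3 * n + 2) * (p + n + 2) - 1,
      muK = knots 0 1 t 0 (int p + int n + 1),
      nuK = knots 0 (n + 1) t 0 (int p + int n + 1),
      rhoK = knots 1 (n + 1) t 0 (int p + int n + 1),
      tauK = knots (2 * n + 1) (3 * n + 2) t 0 (int p + int n + 1),
      intA = t 0, intB = t (int p + int n + 1),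
      domA = t (int n), domB = t (int p + 1) \<rparr>"

definition clamped_setting :: "nat \<Rightarrow> nat \<Rightarrow> (int \<Rightarrow> real) \<Rightarrow> bs_setting" where
  "clamped_setting n m t =
    \<lparr> basis = bspl_cl (t (int m + 1)), deg = n, maxZ = m,
      maxP = 2 * n + (n + 1) * (m - n),
      maxT = 4 * n + 1 + (m - n) * (3 * n + 2),
      muK = knots (n + 1) 1 t (int n + 1) (int m),
      nuK = knots (2 * n + 1) (n + 1) t (int n + 1) (int m),
      rhoK = knots (2 * n + 2) (n + 1) t (int n + 1) (int m),
      tauK = knots (4 * n + 2) (3 * n + 2) t (int n + 1) (int m),
      intA = t (int n), intB = t (int m + 1),
      domA = t (int n), domB = t (int m + 1) \<rparr>"


section \<open>Gramian systems\<close>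

definition gram :: "bs_setting \<Rightarrow> nat \<Rightarrow> real list \<Rightarrow> nat \<Rightarrow> real \<Rightarrow> real \<Rightarrow> real mat" where
  "gram S d \<kappa> N a b =
     mat (N + 1) (N + 1) (\<lambda>(k, l). integral {a..b} (\<lambda>s. basis S \<kappa> d k s * basis S \<kappa> d l s))"

definition moments ::
    "bs_setting \<Rightarrow> nat \<Rightarrow> real list \<Rightarrow> nat \<Rightarrow> real \<Rightarrow> real \<Rightarrow> (real \<Rightarrow> real) \<Rightarrow> real vec" where
  "moments S d \<kappa> N a b f =
     vec (N + 1) (\<lambda>l. integral {a..b} (\<lambda>s. f s * basis S \<kappa> d l s))"

definition solves :: "real mat \<Rightarrow> real vec \<Rightarrow> real vec \<Rightarrow> bool" where
  "solves M v x \<longleftrightarrow> x \<in> carrier_vec (dim_col M) \<and> M *\<^sub>v x = v"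

definition A_mat :: "bs_setting \<Rightarrow> real mat" where
  "A_mat S = gram S (2 * deg S) (nuK S) (maxP S) (intA S) (intB S)"

definition b_vec :: "bs_setting \<Rightarrow> nat \<Rightarrow> nat \<Rightarrow> real vec" where
  "b_vec S i j = moments S (2 * deg S) (nuK S) (maxP S) (intA S) (intB S)
     (\<lambda>s. basis S (muK S) (deg S) i s * basis S (muK S) (deg S) j s)"

text \<open>\<open>A_mat\<close> is nonsingular if the distinct knots are repeated no more often than
  prescribed, so that the description below is proper. Coinciding \<open>t i\<close> and \<open>t (i + 1)\<close> would give
  a knot of multiplicity \<open>2 * n + 2\<close> in \<open>nuK\<close>, a vanishing B-spline and a singular matrix.\<close>

definition chi :: "bs_setting \<Rightarrow> nat \<Rightarrow> nat \<Rightarrow> real vec" where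
  "chi S i j = (THE x. solves (A_mat S) (b_vec S i j) x)"

text \<open>In \<open>general_setting\<close> the first and the last \<open>n + 1\<close> B-splines over \<open>tauK\<close> vanish on
  \<open>{intA..intB}\<close>, because \<open>t 0\<close> is preceded by \<open>2 * n + 1\<close> knots \<open>t (-1)\<close> (symmetrically at the
  other end). There \<open>C_mat\<close> is singular; the Gramian over \<open>{t (-1)..t (p + n + 2)}\<close>, the whole span
  of \<open>tauK\<close>, is nonsingular if the two outer knots are distinct from their neighbours. The vectors
  \<open>e_vec\<close> are the same for both intervals, because the B-splines over \<open>nuK\<close> vanish outside
  \<open>{intA..intB}\<close>.\<close>

definition C_mat :: "bs_setting \<Rightarrow> real mat" where
  "C_mat S = gram S (4 * deg S + 1) (tauK S) (maxT S) (intA S) (intB S)"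

definition e_vec :: "bs_setting \<Rightarrow> nat \<Rightarrow> nat \<Rightarrow> real vec" where
  "e_vec S i j = moments S (4 * deg S + 1) (tauK S) (maxT S) (intA S) (intB S)
     (\<lambda>s. basis S (rhoK S) (2 * deg S + 1) i s * basis S (nuK S) (2 * deg S) j s)"


section \<open>The Pythagorean-hodograph curve and its offsets\<close>

definition spline ::
    "bs_setting \<Rightarrow> nat \<Rightarrow> real list \<Rightarrow> nat \<Rightarrow> (nat \<Rightarrow> complex) \<Rightarrow> real \<Rightarrow> complex" where
  "spline S d \<kappa> N c s = (\<Sum>k\<le>N. c k * of_real (basis S \<kappa> d k s))"

definition z_curve :: "bs_setting \<Rightarrow> (nat \<Rightarrow> complex) \<Rightarrow> real \<Rightarrow> complex" where
  "z_curve S z = spline S (deg S) (muK S) (maxZ S) z"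

definition p_coeff :: "bs_setting \<Rightarrow> (nat \<Rightarrow> complex) \<Rightarrow> nat \<Rightarrow> complex" where
  "p_coeff S z k = (\<Sum>i\<le>maxZ S. \<Sum>j\<le>maxZ S. of_real (chi S i j $ k) * z i * z j)"

definition sigma_coeff :: "bs_setting \<Rightarrow> (nat \<Rightarrow> complex) \<Rightarrow> nat \<Rightarrow> complex" where
  "sigma_coeff S z k = (\<Sum>i\<le>maxZ S. \<Sum>j\<le>maxZ S. of_real (chi S i j $ k) * z i * cnj (z j))"

primrec r_coeff :: "bs_setting \<Rightarrow> (nat \<Rightarrow> complex) \<Rightarrow> complex \<Rightarrow> nat \<Rightarrow> complex" where
  "r_coeff S z r0 0 = r0"
| "r_coeff S z r0 (Suc i) = r_coeff S z r0 i
     + of_real ((nuK S ! (i + 2 * deg S + 1) - nuK S ! i) / real (2 * deg S + 1)) * p_coeff S z i"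

definition r_curve :: "bs_setting \<Rightarrow> (nat \<Rightarrow> complex) \<Rightarrow> complex \<Rightarrow> real \<Rightarrow> complex" where
  "r_curve S z r0 = spline S (2 * deg S + 1) (rhoK S) (maxP S + 1) (r_coeff S z r0)"

definition speed :: "bs_setting \<Rightarrow> (nat \<Rightarrow> complex) \<Rightarrow> real \<Rightarrow> real" where
  "speed S z s = (cmod (z_curve S z s))\<^sup>2"

definition normal_vec :: "bs_setting \<Rightarrow> (nat \<Rightarrow> complex) \<Rightarrow> complex \<Rightarrow> real \<Rightarrow> complex" where
  "normal_vec S z r0 s =
     - \<i> * vector_derivative (r_curve S z r0) (at s within {domA S..domB S}) / of_real (speed S z s)"

definition offset_curve ::
    "bs_setting \<Rightarrow> (nat \<Rightarrow> complex) \<Rightarrow> complex \<Rightarrow> real \<Rightarrow> real \<Rightarrow> complex" where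
  "offset_curve S z r0 h s = r_curve S z r0 s + of_real h * normal_vec S z r0 s"

definition q_coeff ::
    "bs_setting \<Rightarrow> (nat \<Rightarrow> complex) \<Rightarrow> complex \<Rightarrow> real \<Rightarrow> (nat \<Rightarrow> nat \<Rightarrow> real vec) \<Rightarrow> nat \<Rightarrow> complex" where
  "q_coeff S z r0 h \<zeta> k = (\<Sum>i\<le>maxP S + 1. \<Sum>j\<le>maxP S.
     (sigma_coeff S z j * r_coeff S z r0 i - \<i> * of_real h * p_coeff S z j) * of_real (\<zeta> i j $ k))"

definition gamma_coeff ::
    "bs_setting \<Rightarrow> (nat \<Rightarrow> complex) \<Rightarrow> (nat \<Rightarrow> nat \<Rightarrow> real vec) \<Rightarrow> nat \<Rightarrow> complex" where
  "gamma_coeff S z \<zeta> k =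
     (\<Sum>i\<le>maxP S + 1. \<Sum>j\<le>maxP S. sigma_coeff S z j * of_real (\<zeta> i j $ k))"

end

theory Submission
  imports Defs "Jordan_Normal_Form.Determinant"
begin

text \<open>A B-spline is the sum over its knots \<open>t\<close> of jump polynomials switched on at \<open>t\<close>. The derivative
  formula for B-splines holds for the jump polynomials by pure algebra, and shows that the jump at a knot
  of multiplicity \<open>m\<close> is divisible by \<open>(x - t) ^ (d + 1 - m)\<close>. Conversely, Marsden's identity exhibits the
  truncated powers of this order as combinations of B-splines, so divisibility of the jumps characterizes
  splines. The condition is stable under products, whence the expansions over \<open>nuK\<close> and \<open>tauK\<close> exist.
  Linear independence on an interval follows by differentiating a vanishing combination and the partition
  of unity; therefore a solution of a Gramian system determines the expanded function. The offset formula
  results from multiplying numerator and denominator by \<open>1\<close>, written as the sum of the B-splines over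
  \<open>rhoK\<close>.\<close>

section \<open>B-splines over bi-infinite knot sequences\<close>

text \<open>Two obstacles shape the development. In the general setting \<open>C_mat\<close> is
  singular, so it cannot single out a coefficient vector. What survives is the function: for two
  solutions, the combination of B-splines with the differences of the coefficients has square
  integral \<open>0\<close>, and right continuity turns this into equality at every point of the
  half-open interval. The rational form is therefore proved for an arbitrary family of solutions.
  The other obstacle is coincident knots, where values, derivatives and quotients \<open>0/0\<close>
  need care; passing to jump polynomials makes the derivative formula an identity without
  exceptional points.

  The multiplicities in \<open>tauK\<close> come from orders of vanishing, degree plus one minus
  multiplicity. At an inner knot the factors have the orders
  \<open>(2 * n + 2) - (n + 1) = n + 1\<close> and \<open>(2 * n + 1) - (n + 1) = n\<close>; the
  product keeps the smaller one, and \<open>(4 * n + 2) - (3 * n + 2) = n\<close>. A separate outer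
  knot is simple in \<open>rhoK\<close>, so its order is
  \<open>2 * n + 1 = (4 * n + 2) - (2 * n + 1)\<close>.\<close>

fun bs :: "(int \<Rightarrow> real) \<Rightarrow> nat \<Rightarrow> int \<Rightarrow> real \<Rightarrow> real" where
  "bs u 0 i x = (if u i \<le> x \<and> x < u (i + 1) then 1 else 0)"
| "bs u (Suc d) i x =
     (x - u i) / (u (i + int d + 1) - u i) * bs u d i x
   + (u (i + int d + 2) - x) / (u (i + int d + 2) - u (i + 1)) * bs u d (i + 1) x"

text \<open>\<open>jp u d i t\<close> is the difference of the polynomial pieces of \<open>bs u d i\<close> to the right and to the
  left of \<open>t\<close>, obtained by applying the recursion of B-splines to polynomials.\<close>

fun jp :: "(int \<Rightarrow> real) \<Rightarrow> nat \<Rightarrow> int \<Rightarrow> real \<Rightarrow> real poly" where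
  "jp u 0 i t = (if u i = t then 1 else 0) - (if u (i + 1) = t then 1 else 0)"
| "jp u (Suc d) i t =
     smult (1 / (u (i + int d + 1) - u i)) ([:- u i, 1:] * jp u d i t)
   + smult (1 / (u (i + int d + 2) - u (i + 1))) ([:u (i + int d + 2), - 1:] * jp u d (i + 1) t)"

text \<open>Functions that are \<open>0\<close> far to the left and right continuous, coded by their
  jumps: from each \<open>t\<close> on, its polynomial is added for good. The test
  \<open>t \<le> x\<close> matches the half-open intervals of degree \<open>0\<close>.\<close>

definition ppv :: "real set \<Rightarrow> (real \<Rightarrow> real poly) \<Rightarrow> real \<Rightarrow> real" where
  "ppv T Q x = (\<Sum>t\<in>T. if t \<le> x then poly (Q t) x else 0)"

text \<open>Both recursions multiply by the same linear factors and \<open>ppv\<close> is linear in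
  the jumps, so only degree \<open>0\<close> needs an argument: monotonicity makes the indicator of
  a knot interval, even an empty one, a difference of two step functions. \<open>T\<close> may
  exceed the knots in use so that neighbouring B-splines share one set.\<close>

lemma bs_eq_ppv:
  assumes "mono u" "finite T" "u ` {i..i + int d + 1} \<subseteq> T"
  shows "bs u d i x = ppv T (jp u d i) x"
  using assms(3)
proof (induction d arbitrary: i)
  case 0
  have *: "u i \<in> T" "u (i+1) \<in> T" using 0 by auto
  have le: "u i \<le> u (i+1)" using assms(1) by (simp add: monoD)
  have "ppv T (jp u 0 i) x = (\<Sum>t\<in>T. if t = u i then (if u i \<le> x then 1 else 0) else 0)
      - (\<Sum>t\<in>T. if t = u (i+1) then (if u (i+1) \<le> x then 1 else 0) else 0)"
    unfolding ppv_def sum_subtractf[symmetric] by (intro sum.cong) auto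
  also have "\<dots> = bs u 0 i x" using * le assms(2) by (simp add: sum.delta)
  finally show ?case ..
next
  case (Suc d)
  have s: "u ` {i..i + int d + 1} \<subseteq> T" "u ` {i+1..i + 1 + int d + 1} \<subseteq> T"
    using Suc.prems by (auto simp: image_subset_iff)
  show ?case
    unfolding bs.simps Suc.IH[OF s(1)] Suc.IH[OF s(2)] ppv_def sum_distrib_left sum.distrib[symmetric]
    by (intro sum.cong) (auto simp: algebra_simps add_divide_distrib diff_divide_distrib)
qed

lemma degree_jp: "degree (jp u d i t) \<le> d"
proof (induction d arbitrary: i)
  case (Suc d)
  have "degree (smult c ([:a, b:] * jp u d i t)) \<le> Suc d" for a b c i
  proof -
    have "degree (smult c ([:a, b:] * jp u d i t)) \<le> degree ([:a, b:] * jp u d i t)"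
      by (rule degree_smult_le)
    also have "\<dots> \<le> degree [:a, b:] + degree (jp u d i t)" by (rule degree_mult_le)
    also have "\<dots> \<le> 1 + d" by (intro add_mono Suc.IH) simp
    finally show ?thesis by simp
  qed
  then show ?case unfolding jp.simps by (intro degree_add_le)
qed auto

lemma mono_le: "mono u \<Longrightarrow> i \<le> j \<Longrightarrow> u i \<le> u j" for u :: "int \<Rightarrow> real"
  by (simp add: monoD)

text \<open>The product rule reduces the claim to the induction hypothesis for the two B-splines of
  lower degree. Of the three jumps \<open>A\<close>, \<open>B\<close>, \<open>C\<close> of degree
  \<open>d\<close> involved, the terms with \<open>A\<close> and \<open>C\<close> match at once; the
  middle one needs the relations between the knot differences.\<close>

lemma pderiv_jp:
  assumes "mono u"
  shows "pderiv (jp u (Suc d) i t) = smult (real (Suc d))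
     (smult (1 / (u (i + int d + 1) - u i)) (jp u d i t)
      - smult (1 / (u (i + int d + 2) - u (i + 1))) (jp u d (i + 1) t))"
proof (induction d arbitrary: i)
  case 0
  show ?case by (simp add: pderiv_mult pderiv_smult pderiv_add pderiv_diff pderiv_pCons smult_diff_right)
next
  case (Suc d)
  define A B C where "A = jp u d i t" and "B = jp u d (i+1) t" and "C = jp u d (i+2) t"
  define a0 a1 a2 b0 b1 a3 b2 where
    "a0 = u (i + int d + 1) - u i" and "a1 = u (i + int d + 2) - u (i+1)"
    and "a2 = u (i + int d + 3) - u (i+2)" and "b0 = u (i + int d + 2) - u i"
    and "b1 = u (i + int d + 3) - u (i+1)" and "a3 = u (i + int d + 2)" and "b2 = u (i+1)"
  have J1: "jp u (Suc d) i t = smult (1/a0) ([:- u i, 1:] * A) + smult (1/a1) ([:a3, -1:] * B)"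
    by (simp add: A_def B_def a0_def a1_def a3_def)
  have J2: "jp u (Suc d) (i+1) t = smult (1/a1) ([:- b2, 1:] * B) + smult (1/a2) ([:u (i + int d + 3), -1:] * C)"
    by (simp add: C_def B_def a2_def a1_def b2_def algebra_simps)
  have D1: "pderiv (jp u (Suc d) i t) = smult (real (Suc d)) (smult (1/a0) A - smult (1/a1) B)"
    unfolding Suc.IH by (simp add: A_def B_def a0_def a1_def)
  have D2: "pderiv (jp u (Suc d) (i+1) t) = smult (real (Suc d)) (smult (1/a1) B - smult (1/a2) C)"
    unfolding Suc.IH by (simp add: C_def B_def a2_def a1_def algebra_simps)
  have J: "jp u (Suc (Suc d)) i t = smult (1/b0) ([:- u i, 1:] * jp u (Suc d) i t)
      + smult (1/b1) ([:u (i + int d + 3), -1:] * jp u (Suc d) (i+1) t)"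
    unfolding jp.simps(2)[of u "Suc d"] by (simp add: b0_def b1_def algebra_simps)
  \<comment> \<open>Under \<open>0/0 = 0\<close> the coefficients of \<open>B\<close> could only disagree if \<open>b0\<close> or \<open>b1\<close> vanished
    without \<open>a1\<close>, but \<open>a1\<close> is the length of the innermost knot interval.\<close>
  have nz: "a1 = 0 \<or> (b0 \<noteq> 0 \<and> b1 \<noteq> 0 \<and> a1 \<noteq> 0)"
    using mono_le[OF assms, of i "i+1"] mono_le[OF assms, of "i+1" "i + int d + 2"]
      mono_le[OF assms, of "i + int d + 2" "i + int d + 3"]
    by (auto simp: a1_def b0_def b1_def)
  have rel: "a3 - u i = b0" "u (i + int d + 3) - b2 = b1"
    by (auto simp: a3_def b0_def b1_def b2_def)
  have "poly (pderiv (jp u (Suc (Suc d)) i t)) x = poly (smult (real (Suc (Suc d)))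
     (smult (1 / b0) (jp u (Suc d) i t) - smult (1 / b1) (jp u (Suc d) (i + 1) t))) x" for x
  proof -
    define L where "L = u i"
    define R where "R = u (i + int d + 3)"
    have rel': "a3 = b0 + L" "b2 = R - b1" using rel by (auto simp: L_def R_def)
    define pa pb pc where "pa = poly A x / a0" and "pb = poly B x / a1" and "pc = poly C x / a2"
    have e: "poly (jp u (Suc d) i t) x = (x - L) * pa + (a3 - x) * pb"
      "poly (jp u (Suc d) (i+1) t) x = (x - b2) * pb + (R - x) * pc"
      unfolding J1 J2 by (simp_all add: pa_def pb_def pc_def L_def R_def add_divide_distrib diff_divide_distrib algebra_simps)
    have f: "poly (pderiv (jp u (Suc d) i t)) x = real (Suc d) * (pa - pb)"
      "poly (pderiv (jp u (Suc d) (i+1) t)) x = real (Suc d) * (pb - pc)"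
      unfolding D1 D2 by (simp_all add: pa_def pb_def pc_def)
    have LHS: "poly (pderiv (jp u (Suc (Suc d)) i t)) x
      = (1/b0) * (poly (jp u (Suc d) i t) x + (x - L) * poly (pderiv (jp u (Suc d) i t)) x)
      + (1/b1) * (- poly (jp u (Suc d) (i+1) t) x + (R - x) * poly (pderiv (jp u (Suc d) (i+1) t)) x)"
      unfolding J pderiv_add pderiv_smult pderiv_mult
      by (simp add: pderiv_pCons L_def R_def algebra_simps)
    have "pb = 0 \<or> (b0 \<noteq> 0 \<and> b1 \<noteq> 0)" using nz by (auto simp: pb_def)
    then have pb0: "pb * (b0 / b0) = pb" "pb * (b1 / b1) = pb" by auto
    \<comment> \<open>Only the coefficient of \<open>pb\<close> is at stake. Since
      \<open>x - L = b0 - (a3 - x)\<close> and \<open>R - x = b1 - (x - b2)\<close>, the two sides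
      differ by \<open>c * pb * (b1/b1 - b0/b0)\<close>, which is \<open>0\<close> by
      \<open>pb0\<close>.\<close>
    have key: "(1/b0) * ((x - L) * (c * (- pb))) + (1/b1) * ((R - x) * (c * pb))
       = c * ((1/b0) * ((a3 - x) * pb) - (1/b1) * ((x - b2) * pb))" for c
    proof -
      have "(1/b0) * ((x - L) * (c * (- pb))) = (1/b0) * (c * ((a3 - x) * pb)) - c * (pb * (b0/b0))"
        unfolding rel' by (simp add: algebra_simps diff_divide_distrib add_divide_distrib)
      moreover have "(1/b1) * ((R - x) * (c * pb)) = c * (pb * (b1/b1)) - (1/b1) * (c * ((x - b2) * pb))"
        unfolding rel' by (simp add: algebra_simps diff_divide_distrib add_divide_distrib)
      ultimately show ?thesis unfolding pb0 by (simp add: algebra_simps)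
    qed
    have "E0 * ((x - L) * (c * (pa - pb))) + E1 * ((R - x) * (c * (pb - pc)))
      = c * (E0 * ((x - L) * pa + (a3 - x) * pb) - E1 * ((x - b2) * pb + (R - x) * pc))"
      if "E0 * ((x - L) * (c * (- pb))) + E1 * ((R - x) * (c * pb))
       = c * (E0 * ((a3 - x) * pb) - E1 * ((x - b2) * pb))" for E0 E1 c
    proof -
      have "E0 * ((x - L) * (c * (pa - pb))) + E1 * ((R - x) * (c * (pb - pc)))
        = c * (E0 * ((x - L) * pa) - E1 * ((R - x) * pc))
          + (E0 * ((x - L) * (c * (- pb))) + E1 * ((R - x) * (c * pb)))"
        by (simp add: algebra_simps)
      then show ?thesis unfolding that by (simp add: algebra_simps)
    qed
    from this[OF key[of "real (Suc d)"]]
    have step: "(1/b0) * ((x - L) * (real (Suc d) * (pa - pb))) + (1/b1) * ((R - x) * (real (Suc d) * (pb - pc)))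
      = real (Suc d) * ((1/b0) * ((x - L) * pa + (a3 - x) * pb) - (1/b1) * ((x - b2) * pb + (R - x) * pc))" .
    have "E0 * (P + (x - L) * X) + E1 * (- Q + (R - x) * Y) = real (Suc (Suc d)) * (E0 * P - E1 * Q)"
      if "E0 * ((x - L) * X) + E1 * ((R - x) * Y) = real (Suc d) * (E0 * P - E1 * Q)" for E0 E1 P Q X Y
    proof -
      have "E0 * (P + (x - L) * X) + E1 * (- Q + (R - x) * Y)
          = E0 * P - E1 * Q + (E0 * ((x - L) * X) + E1 * ((R - x) * Y))" by (simp add: algebra_simps)
      then show ?thesis unfolding that by (simp add: algebra_simps)
    qed
    from this[OF step] show ?thesis
      unfolding LHS f unfolding poly_smult poly_diff e .
  qed
  then have "pderiv (jp u (Suc (Suc d)) i t) = smult (real (Suc (Suc d)))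
     (smult (1 / b0) (jp u (Suc d) i t) - smult (1 / b1) (jp u (Suc d) (i + 1) t))"
    by (intro poly_eq_poly_eq_iff[THEN iffD1] ext)
  then show ?case by (simp add: b0_def b1_def algebra_simps)
qed

section \<open>Order of vanishing of the jumps at multiple knots\<close>

lemma poly_jp_end:
  assumes "mono u"
  shows "u i = t \<Longrightarrow> u (i + int d) = t \<Longrightarrow> t < u (i + int d + 1) \<Longrightarrow> poly (jp u d i t) t = 1"
    and "u i < t \<Longrightarrow> u (i + 1) = t \<Longrightarrow> u (i + int d + 1) = t \<Longrightarrow> poly (jp u d i t) t = - 1"
proof (induction d arbitrary: i)
  case 0
  { case 1 then show ?case by simp }
  { case 2 then show ?case by simp }
next
  case (Suc d)
  { case 1
    have "u (i + 1) = t" using mono_le[OF assms, of i "i+1"] mono_le[OF assms, of "i+1" "i + int (Suc d)"] 1 by simp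
    with Suc.IH(1)[of "i+1"] 1 show ?case by (simp add: algebra_simps) }
  { case 2
    have "u (i + int d + 1) = t"
      using mono_le[OF assms, of "i+1" "i + int d + 1"] mono_le[OF assms, of "i + int d + 1" "i + int (Suc d) + 1"] 2
      by simp
    moreover have "(u i - t) / (t - u i) = - 1" using 2 by (simp add: field_simps)
    ultimately show ?case using Suc.IH(2)[of i] 2 by (simp add: algebra_simps) }
qed

text \<open>The excluded cases are those of \<open>d + 1\<close> coinciding knots at one end of the
  support, where \<open>poly_jp_end\<close> exhibits a jump of height \<open>1\<close>.\<close>

lemma poly_jp_eq_0:
  assumes "mono u"
  shows "\<not> (u i = t \<and> u (i + int d) = t) \<Longrightarrow> \<not> (u (i + 1) = t \<and> u (i + int d + 1) = t)
    \<Longrightarrow> poly (jp u d i t) t = 0"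
proof (induction d arbitrary: i)
  case (Suc d)
  show ?case
  proof (cases "u (i+1) = t \<and> u (i + int d + 1) = t")
    case True
    \<comment> \<open>All inner knots coincide at \<open>t\<close>: the two B-splines of degree
      \<open>d\<close> jump by \<open>-1\<close> and \<open>1\<close>, both weights of the recursion
      are \<open>1\<close> at \<open>t\<close>, and the jumps cancel.\<close>
    have lt: "u i < t" "t < u (i + int d + 2)"
      using mono_le[OF assms, of i "i+1"] mono_le[OF assms, of "i + int d + 1" "i + int d + 2"] True Suc.prems
      by (auto simp: algebra_simps)
    have "poly (jp u d i t) t = -1" using poly_jp_end(2)[OF assms, of i] lt True by simp
    moreover have "poly (jp u d (i+1) t) t = 1"
      using poly_jp_end(1)[OF assms, of "i+1" t d] lt True by (simp add: algebra_simps)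
    moreover have "poly (jp u (Suc d) i t) t = (t - u i) / (u (i + int d + 1) - u i) * poly (jp u d i t) t
        + (u (i + int d + 2) - t) / (u (i + int d + 2) - u (i + 1)) * poly (jp u d (i + 1) t) t"
      by (simp add: algebra_simps add_divide_distrib diff_divide_distrib)
    ultimately show ?thesis using lt True by (simp only:) simp
  next
    case False
    have "u i = t \<or> poly (jp u d i t) t = 0" using Suc.IH[of i] False by blast
    moreover have "u (i + int d + 2) = t \<or> poly (jp u d (i+1) t) t = 0"
      using Suc.IH[of "i+1"] False by (auto simp: algebra_simps)
    ultimately show ?thesis by auto
  qed
qed auto

text \<open>Under monotonicity, \<open>mult\<close> says that \<open>t\<close> occurs at most
  \<open>m\<close> times as a knot. Each degree adds one order: the derivative has the order of the
  previous degree by \<open>pderiv_jp\<close>, and for \<open>m \<le> Suc d\<close> the jump itself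
  vanishes at \<open>t\<close> by \<open>poly_jp_eq_0\<close>.\<close>

lemma dvd_jp:
  assumes "mono u" and mult: "\<And>k. \<not> (u k = t \<and> u (k + int m) = t)"
  shows "[:- t, 1:] ^ (d + 1 - m) dvd jp u d i t"
proof (induction d arbitrary: i)
  case 0
  show ?case using mult[of i] mult[of "i+1"] by (cases "m = 0") auto
next
  case (Suc d)
  show ?case
  proof (cases "m \<le> Suc d")
    case False then show ?thesis by simp
  next
    case True
    have no: "\<not> (u k = t \<and> u (k + int (Suc d)) = t)" for k
    proof
      assume *: "u k = t \<and> u (k + int (Suc d)) = t"
      then have "u (k + int m) = t"
        using mono_le[OF assms(1), of k "k + int m"] mono_le[OF assms(1), of "k + int m" "k + int (Suc d)"] True
        by simp
      with mult[of k] * show False by simp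
    qed
    have z: "poly (jp u (Suc d) i t) t = 0"
      using poly_jp_eq_0[OF assms(1), of i t "Suc d"] no[of i] no[of "i+1"] by (simp add: algebra_simps)
    have dv: "[:- t, 1:] ^ (d + 1 - m) dvd pderiv (jp u (Suc d) i t)"
      unfolding pderiv_jp[OF assms(1)]
      by (intro dvd_smult dvd_diff Suc.IH)
    show ?thesis
    proof (cases "jp u (Suc d) i t = 0")
      case True then show ?thesis by simp
    next
      case False
      have "pderiv (jp u (Suc d) i t) \<noteq> 0"
      proof
        assume "pderiv (jp u (Suc d) i t) = 0"
        then obtain c where "jp u (Suc d) i t = [:c:]" using pderiv_iszero by blast
        with z have "poly [:c:] t = 0" by (simp only:)
        with \<open>jp u (Suc d) i t = [:c:]\<close> False show False by (simp del: jp.simps)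
      qed
      then have "d + 1 - m \<le> order t (pderiv (jp u (Suc d) i t))" using dv by (simp add: order_divides)
      moreover have "order t (jp u (Suc d) i t) = Suc (order t (pderiv (jp u (Suc d) i t)))"
        by (rule order_pderiv[OF False])
          (use z False in \<open>simp add: order_root del: jp.simps\<close>)
      ultimately have "Suc d + 1 - m \<le> order t (jp u (Suc d) i t)" using True by simp
      then show ?thesis by (simp add: order_divides)
    qed
  qed
qed

subsection \<open>Marsden's identity\<close>

lemma bs_eq_0:
  assumes "mono u"
  shows "x < u i \<or> u (i + int d + 1) \<le> x \<Longrightarrow> bs u d i x = 0"
proof (induction d arbitrary: i)
  case (Suc d)
  show ?case
    using Suc.IH[of i] Suc.IH[of "i+1"] Suc.prems mono_le[OF assms, of i "i+1"]
      mono_le[OF assms, of "i + int d + 1" "i + int d + 2"]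
    by (auto simp: algebra_simps)
qed auto

lemma bs_local:
  assumes "mono u" "u j \<le> x" "x < u (j + 1)" "i \<notin> {j - int d..j}"
  shows "bs u d i x = 0"
proof (rule bs_eq_0[OF assms(1)])
  show "x < u i \<or> u (i + int d + 1) \<le> x"
    using mono_le[OF assms(1), of "j+1" i] mono_le[OF assms(1), of "i + int d + 1" j] assms(2-4) by auto
qed

text \<open>The dual polynomial of a B-spline, with the inner \<open>d\<close> of its
  \<open>d + 2\<close> knots as zeros. It is a polynomial in the second variable \<open>y\<close> of
  Marsden's identity, while the first variable \<open>x\<close> stays a real number.\<close>

definition psi :: "(int \<Rightarrow> real) \<Rightarrow> nat \<Rightarrow> int \<Rightarrow> real poly" where
  "psi u d i = (\<Prod>k\<in>{i+1..i + int d}. [:- u k, 1:])"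

lemma psi_Suc: "psi u (Suc d) i = psi u d i * [:- u (i + int d + 1), 1:]"
proof -
  have "{i+1..i + int (Suc d)} = insert (i + int d + 1) {i+1..i + int d}" by auto
  then show ?thesis by (simp add: psi_def)
qed

lemma psi_Suc': "psi u (Suc d) (i - 1) = [:- u i, 1:] * psi u d i"
proof -
  have "{i - 1 + 1..i - 1 + int (Suc d)} = insert i {i+1..i + int d}" by auto
  then show ?thesis by (simp add: psi_def del: mult_pCons_left)
qed

lemma sum_shift1: "(\<Sum>i\<in>{a..b}. f (i + 1)) = (\<Sum>i\<in>{a+1..b+1}. f i)" for f :: "int \<Rightarrow> 'a :: comm_monoid_add"
  by (rule sum.reindex_bij_witness[of _ "\<lambda>i. i - 1" "\<lambda>i. i + 1"]) auto

text \<open>Split the B-splines of degree \<open>Suc d\<close> by the recursion and collect by those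
  of degree \<open>d\<close>: \<open>psi u d i\<close> gets multiplied by a combination of
  \<open>y - u i\<close> and \<open>y - u (i + d + 1)\<close>, namely their linear interpolation at
  \<open>x\<close>, which is \<open>y - x\<close>.\<close>

lemma marsden:
  assumes "mono u" "u j \<le> x" "x < u (j + 1)"
  shows "(\<Sum>i\<in>{j - int d..j}. smult (bs u d i x) (psi u d i)) = [:- x, 1:] ^ d"
proof (induction d)
  case 0
  then show ?case using assms by (simp add: psi_def)
next
  case (Suc d)
  let ?R = "{j - int d..j}"
  \<comment> \<open>The two split sums run over \<open>{j - d - 1..j}\<close> and, after the shift,
    over \<open>{j - d..j + 1}\<close>; the B-splines sticking out are not active on this knot
    interval.\<close>
  have z: "bs u d (j - int d - 1) x = 0" "bs u d (j + 1) x = 0"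
    by (auto intro!: bs_local[OF assms])
  have R: "{j - int (Suc d)..j} = insert (j - int d - 1) ?R"
    "{j - int (Suc d) + 1..j+1} = insert (j+1) ?R" by auto
  have idx: "i + 1 + int d + 1 = i + int d + 2" for i by simp
  have "(\<Sum>i\<in>{j - int (Suc d)..j}. smult (bs u (Suc d) i x) (psi u (Suc d) i))
     = (\<Sum>i\<in>{j - int (Suc d)..j}. smult ((x - u i) / (u (i + int d + 1) - u i) * bs u d i x) (psi u (Suc d) i))
     + (\<Sum>i\<in>{j - int (Suc d)..j}. smult ((u (i + 1 + int d + 1) - x) / (u (i + 1 + int d + 1) - u (i + 1)) * bs u d (i + 1) x) (psi u (Suc d) (i + 1 - 1)))"
    unfolding sum.distrib[symmetric]
    by (intro sum.cong refl) (simp only: bs.simps smult_add_left add_diff_cancel_right' idx)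
  also have "\<dots> = (\<Sum>i\<in>?R. smult ((x - u i) / (u (i + int d + 1) - u i) * bs u d i x) (psi u (Suc d) i))
     + (\<Sum>i\<in>?R. smult ((u (i + int d + 1) - x) / (u (i + int d + 1) - u i) * bs u d i x) (psi u (Suc d) (i - 1)))"
    apply (subst sum_shift1[of "\<lambda>i. smult ((u (i + int d + 1) - x) / (u (i + int d + 1) - u i) * bs u d i x) (psi u (Suc d) (i - 1))"])
    unfolding R by (simp add: z)
  also have "\<dots> = (\<Sum>i\<in>?R. [:- x, 1:] * smult (bs u d i x) (psi u d i))"
    unfolding sum.distrib[symmetric]
  proof (intro sum.cong refl)
    fix i assume i: "i \<in> ?R"
    define D where "D = u (i + int d + 1) - u i"
    have D: "D \<noteq> 0"
      using mono_le[OF assms(1), of i j] mono_le[OF assms(1), of "j+1" "i + int d + 1"] i assms by (auto simp: D_def)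
    have "smult ((x - u i) / D) [:- u (i + int d + 1), 1:] + smult ((u (i + int d + 1) - x) / D) [:- u i, 1:] = [:-x, 1:]"
      using D by (simp add: field_simps) (simp add: D_def algebra_simps)
    then have "smult (bs u d i x) (psi u d i) * (smult ((x - u i) / D) [:- u (i + int d + 1), 1:] + smult ((u (i + int d + 1) - x) / D) [:- u i, 1:])
       = smult (bs u d i x) (psi u d i) * [:-x, 1:]" by simp
    moreover have "smult (\<alpha> * \<beta>) (P * A) + smult (\<gamma> * \<beta>) (B * P) = smult \<beta> P * (smult \<alpha> A + smult \<gamma> B)"
      for \<alpha> \<beta> \<gamma> and P A B :: "real poly"
      by (simp add: distrib_left mult.commute)
    ultimately have "smult ((x - u i) / D * bs u d i x) (psi u d i * [:- u (i + int d + 1), 1:])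
        + smult ((u (i + int d + 1) - x) / D * bs u d i x) ([:- u i, 1:] * psi u d i)
        = smult (bs u d i x) (psi u d i) * [:- x, 1:]"
      by (simp only:)
    then show "smult ((x - u i) / (u (i + int d + 1) - u i) * bs u d i x) (psi u (Suc d) i)
     + smult ((u (i + int d + 1) - x) / (u (i + int d + 1) - u i) * bs u d i x) (psi u (Suc d) (i - 1))
     = [:- x, 1:] * smult (bs u d i x) (psi u d i)"
      unfolding psi_Suc[of u d i] psi_Suc' D_def[symmetric] by (simp only: mult.commute)
  qed
  also have "\<dots> = [:- x, 1:] ^ Suc d" unfolding sum_distrib_left[symmetric] Suc.IH by simp
  finally show ?case .
qed

text \<open>Compare the coefficients of \<open>y ^ d\<close> in Marsden's identity: every
  \<open>psi u d i\<close> is monic of degree \<open>d\<close>.\<close>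

lemma partition_of_unity:
  assumes "mono u" "u j \<le> x" "x < u (j + 1)"
  shows "(\<Sum>i\<in>{j - int d..j}. bs u d i x) = 1"
proof -
  have lc: "lead_coeff (psi u d i) = 1" "degree (psi u d i) = d" for i
    unfolding psi_def by (simp add: lead_coeff_prod) (subst degree_prod_eq_sum_degree, auto)
  have "coeff (\<Sum>i\<in>{j - int d..j}. smult (bs u d i x) (psi u d i)) d = coeff ([:- x, 1:] ^ d) d"
    by (simp add: marsden[OF assms])
  moreover have "coeff ([:- x, 1:] ^ d) d = 1"
    using lead_coeff_power[of "[:-x,1:]" d] degree_linear_power[of "-x" d] by simp
  ultimately show ?thesis using lc by (simp add: coeff_sum)
qed

section \<open>Piecewise polynomial functions\<close>

lemma tendsto_ppv_left:
  assumes "finite T"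
  shows "(ppv T Q \<longlongrightarrow> (\<Sum>t\<in>T. if t < b then poly (Q t) b else 0)) (at_left b)"
  unfolding ppv_def
proof (intro tendsto_sum)
  fix t
  show "((\<lambda>x. if t \<le> x then poly (Q t) x else 0) \<longlongrightarrow> (if t < b then poly (Q t) b else 0)) (at_left b)"
  proof (cases "t < b")
    case True
    have "eventually (\<lambda>x. t < x) (at_left b)" using True by (rule eventually_at_left_real[THEN eventually_mono]) auto
    moreover have "(poly (Q t) \<longlongrightarrow> poly (Q t) b) (at_left b)"
      by (intro tendsto_intros)
    ultimately show ?thesis using True by (auto elim!: Lim_transform_eventually eventually_mono)
  next
    case False
    have "eventually (\<lambda>x. x < b) (at_left b)" by (simp add: eventually_at_filter)
    with False show ?thesis
      by (auto intro!: tendsto_eventually elim!: eventually_mono)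
  qed
qed

lemma tendsto_ppv_right:
  assumes "finite T"
  shows "(ppv T Q \<longlongrightarrow> ppv T Q b) (at_right b)"
  unfolding ppv_def
proof (intro tendsto_sum)
  fix t
  show "((\<lambda>x. if t \<le> x then poly (Q t) x else 0) \<longlongrightarrow> (if t \<le> b then poly (Q t) b else 0)) (at_right b)"
  proof (cases "t \<le> b")
    case True
    have "eventually (\<lambda>x. t \<le> x) (at_right b)" using True by (auto simp: eventually_at_filter)
    moreover have "(poly (Q t) \<longlongrightarrow> poly (Q t) b) (at_right b)"
      by (intro tendsto_intros)
    ultimately show ?thesis using True by (auto elim!: Lim_transform_eventually eventually_mono)
  next
    case False
    have "eventually (\<lambda>x. x < t) (at_right b)" using False eventually_at_right_real[of b t]
      by (auto elim!: eventually_mono)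
    with False show ?thesis
      by (auto intro!: tendsto_eventually elim!: eventually_mono)
  qed
qed

lemma ppv_has_derivative:
  assumes "finite T" "x \<notin> T"
  shows "(ppv T Q has_real_derivative ppv T (\<lambda>t. pderiv (Q t)) x) (at x)"
  unfolding ppv_def
proof (intro DERIV_sum)
  fix t assume "t \<in> T"
  show "((\<lambda>x. if t \<le> x then poly (Q t) x else 0) has_real_derivative (if t \<le> x then poly (pderiv (Q t)) x else 0)) (at x)"
  proof (cases "t < x")
    case True
    have "(poly (Q t) has_real_derivative poly (pderiv (Q t)) x) (at x)" by (rule poly_DERIV)
    then have "((\<lambda>x. if t \<le> x then poly (Q t) x else 0) has_real_derivative poly (pderiv (Q t)) x) (at x)"
      by (rule has_field_derivative_transform_within_open[of _ _ _ "{t<..}"]) (use True in auto)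
    with True show ?thesis by simp
  next
    case False
    then have "x < t" using \<open>t \<in> T\<close> assms(2) by (metis linorder_cases)
    have "((\<lambda>x. 0::real) has_real_derivative 0) (at x)" by simp
    then have "((\<lambda>x. if t \<le> x then poly (Q t) x else 0) has_real_derivative 0) (at x)"
      by (rule has_field_derivative_transform_within_open[of _ _ _ "{..<t}"]) (use \<open>x < t\<close> in auto)
    with \<open>x < t\<close> show ?thesis by simp
  qed
qed

lemma ppv_integrable:
  assumes "finite T"
  shows "ppv T Q integrable_on {a..b}"
  unfolding ppv_def
proof (intro integrable_sum assms)
  fix t
  have "poly (Q t) integrable_on {t..} \<inter> {a..b}"
  proof -
    have "{t..} \<inter> {a..b} = {max t a..b}" by auto
    then show ?thesis by (auto intro!: integrable_continuous_real continuous_intros)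
  qed
  then have "(\<lambda>x. if x \<in> {t..} then poly (Q t) x else 0) integrable_on {a..b}"
    by (simp only: integrable_restrict_Int)
  then show "(\<lambda>x. if t \<le> x then poly (Q t) x else 0) integrable_on {a..b}" by simp
qed

lemma continuous_on_ppv:
  assumes "finite T" "\<And>t. t \<in> T \<Longrightarrow> a < t \<Longrightarrow> t \<le> b \<Longrightarrow> poly (Q t) t = 0"
  shows "continuous_on {a..b} (ppv T Q)"
  unfolding ppv_def
proof (intro continuous_on_sum)
  fix t assume t: "t \<in> T"
  consider "t \<le> a" | "b < t" | "a < t" "t \<le> b" by linarith
  then show "continuous_on {a..b} (\<lambda>x. if t \<le> x then poly (Q t) x else 0)"
  proof cases
    case 1
    have "continuous_on {a..b} (poly (Q t))" by (intro continuous_intros)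
    then show ?thesis using 1 by (subst continuous_on_cong[OF refl, of _ _ "poly (Q t)"]) auto
  next
    case 2
    have "continuous_on {a..b} (\<lambda>x::real. 0::real)" by (intro continuous_intros)
    then show ?thesis using 2 by (subst continuous_on_cong[OF refl, of _ _ "\<lambda>x. 0"]) auto
  next
    case 3
    have "continuous_on ({a..b} \<inter> {t..} \<union> {a..b} \<inter> {..t}) (\<lambda>x. if t \<le> x then poly (Q t) x else 0)"
      by (intro continuous_on_If closed_Int) (use 3 assms(2)[OF t] in \<open>auto intro!: continuous_intros\<close>)
    moreover have "{a..b} \<inter> {t..} \<union> {a..b} \<inter> {..t} = {a..b}" by auto
    ultimately show ?thesis by simp
  qed
qed

text \<open>Sorts the pairs of indices by the larger one; this is what produces the jumps of a
  product.\<close>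

lemma sum_mult_sum_linorder:
  fixes f g :: "'a :: linorder \<Rightarrow> 'b :: comm_semiring_0"
  assumes "finite S"
  shows "sum f S * sum g S
    = (\<Sum>v\<in>S. f v * g v + f v * sum g {w\<in>S. w < v} + g v * sum f {w\<in>S. w < v})"
  using assms
proof (induction S rule: finite_linorder_max_induct)
  case (insert b A)
  have b: "b \<notin> A" "{w \<in> insert b A. w < b} = A" using insert.hyps by auto
  have v: "{w \<in> insert b A. w < v} = {w \<in> A. w < v}" if "v \<in> A" for v
    using insert.hyps that by auto
  have "(\<Sum>v\<in>A. f v * g v + f v * sum g {w\<in>insert b A. w < v} + g v * sum f {w\<in>insert b A. w < v})
    = sum f A * sum g A"
    unfolding insert.IH by (intro sum.cong refl) (simp only: v)
  then have "(\<Sum>v\<in>insert b A. f v * g v + f v * sum g {w\<in>insert b A. w < v} + g v * sum f {w\<in>insert b A. w < v})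
    = f b * g b + f b * sum g A + g b * sum f A + sum f A * sum g A"
    by (simp only: sum.insert[OF insert.hyps(1) b(1)] b(2))
  then show ?case using insert.hyps(1) b(1) by (simp add: algebra_simps)
qed simp

text \<open>If \<open>f\<close> and \<open>g\<close> are the pieces to the left of \<open>v\<close>,
  here the sums of the earlier jumps, this is \<open>(f + Q v) * (g + R v) - f * g\<close>. Each
  summand contains \<open>Q v\<close> or \<open>R v\<close>, hence an order of vanishing common to
  both survives multiplication.\<close>

definition ppmult :: "real set \<Rightarrow> (real \<Rightarrow> real poly) \<Rightarrow> (real \<Rightarrow> real poly) \<Rightarrow> real \<Rightarrow> real poly" where
  "ppmult T Q R v = Q v * R v + Q v * sum R {w\<in>T. w < v} + R v * sum Q {w\<in>T. w < v}"

lemma ppv_mult: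
  assumes "finite T"
  shows "ppv T Q x * ppv T R x = ppv T (ppmult T Q R) x"
proof -
  have e: "ppv T P x = (\<Sum>t\<in>{t\<in>T. t \<le> x}. poly (P t) x)" for P
    unfolding ppv_def by (intro sum.inter_filter[symmetric] assms)
  have f: "finite {t\<in>T. t \<le> x}" using assms by simp
  show ?thesis unfolding e sum_mult_sum_linorder[OF f]
  proof (intro sum.cong refl)
    fix v assume v: "v \<in> {t\<in>T. t \<le> x}"
    have "{w \<in> {t \<in> T. t \<le> x}. w < v} = {w\<in>T. w < v}" using v by auto
    then show "poly (Q v) x * poly (R v) x +
         poly (Q v) x * (\<Sum>t | t \<in> {t \<in> T. t \<le> x} \<and> t < v. poly (R t) x) +
         poly (R v) x * (\<Sum>t | t \<in> {t \<in> T. t \<le> x} \<and> t < v. poly (Q t) x) = poly (ppmult T Q R v) x"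
      by (simp add: ppmult_def poly_sum)
  qed
qed

lemma degree_ppmult:
  assumes "\<And>t. t \<in> T \<Longrightarrow> degree (Q t) \<le> d1" "\<And>t. t \<in> T \<Longrightarrow> degree (R t) \<le> d2" "v \<in> T" "finite T"
  shows "degree (ppmult T Q R v) \<le> d1 + d2"
proof -
  have m: "degree (p * q) \<le> d1 + d2" if "degree p \<le> d1" "degree q \<le> d2" for p q :: "real poly"
    using degree_mult_le[of p q] that by linarith
  have s: "degree (sum R {w\<in>T. w < v}) \<le> d2" "degree (sum Q {w\<in>T. w < v}) \<le> d1"
    by (auto intro!: degree_sum_le simp: assms)
  show ?thesis unfolding ppmult_def
    using m[OF assms(1,2)[OF assms(3)]] m[OF assms(1)[OF assms(3)] s(1)] m[OF s(2) assms(2)[OF assms(3)]]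
    by (intro degree_add_le) (simp_all add: mult.commute)
qed

lemma dvd_ppmult:
  assumes "p dvd Q v" "p dvd R v"
  shows "p dvd ppmult T Q R v"
  unfolding ppmult_def using assms by (intro dvd_add dvd_mult2) auto

lemma ppv_superset:
  assumes "finite T'" "T \<subseteq> T'"
  shows "ppv T Q x = ppv T' (\<lambda>t. if t \<in> T then Q t else 0) x"
  unfolding ppv_def using assms by (intro sum.mono_neutral_cong_left) auto

section \<open>Linear independence\<close>

lemma bs_has_derivative:
  assumes "mono u" "x \<notin> u ` {i..i + int d + 2}"
  shows "(bs u (Suc d) i has_real_derivative real (Suc d) *
     (bs u d i x / (u (i + int d + 1) - u i) - bs u d (i + 1) x / (u (i + int d + 2) - u (i + 1)))) (at x)"
proof -
  let ?T = "u ` {i..i + int d + 2}"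
  have e: "bs u (Suc d) i = ppv ?T (jp u (Suc d) i)"
    "bs u d i = ppv ?T (jp u d i)" "bs u d (i+1) = ppv ?T (jp u d (i+1))"
    by (intro ext bs_eq_ppv assms(1) finite_imageI finite_atLeastAtMost_int image_mono; auto)+
  have "ppv ?T (\<lambda>t. pderiv (jp u (Suc d) i t)) x = real (Suc d) *
     (bs u d i x / (u (i + int d + 1) - u i) - bs u d (i + 1) x / (u (i + int d + 2) - u (i + 1)))"
    unfolding e(2,3) pderiv_jp[OF assms(1)] ppv_def sum_divide_distrib sum_subtractf[symmetric] sum_distrib_left
    by (intro sum.cong refl) simp
  then show ?thesis using ppv_has_derivative[OF _ assms(2), of "jp u (Suc d) i"] by (simp add: e del: bs.simps jp.simps)
qed

text \<open>Up to the factor \<open>Suc d\<close>, the derivative has as coefficients the quotients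
  of \<open>c i - c (i - 1)\<close> by the support lengths; induction makes \<open>c\<close>
  constant, and the constant is the value of the sum. The interval may be any part of a knot
  interval, so that it can later be cut off at the end of a range of integration.\<close>

lemma bs_local_independence:
  assumes "mono u" "x0 < x1" "u j \<le> x0" "x1 \<le> u (j + 1)"
    and "\<And>x. x \<in> {x0<..<x1} \<Longrightarrow> (\<Sum>i\<in>{j - int d..j}. c i * bs u d i x) = 0"
  shows "\<forall>i\<in>{j - int d..j}. c i = 0"
  using assms(5)
proof (induction d arbitrary: c)
  case 0
  have "(x0 + x1) / 2 \<in> {x0<..<x1}" using assms(2) by auto
  from 0[OF this] show ?case using assms(2-4) by (simp split: if_splits)
next
  case (Suc d)
  have loc: "u j \<le> x" "x < u (j+1)" if "x \<in> {x0<..<x1}" for x using that assms by auto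
  have notin: "x \<notin> u ` A" if "x \<in> {x0<..<x1}" for x A
  proof
    assume "x \<in> u ` A"
    then obtain k where "x = u k" by auto
    then show False using that assms(3,4) mono_le[OF assms(1), of k j] mono_le[OF assms(1), of "j+1" k]
      by (cases "k \<le> j") auto
  qed
  define g where "g i x = bs u d i x / (u (i + int d + 1) - u i)" for i x
  have d0: "(\<Sum>i\<in>{j - int d..j}. (c i - c (i - 1)) / (u (i + int d + 1) - u i) * bs u d i x) = 0"
    if x: "x \<in> {x0<..<x1}" for x
  proof -
    \<comment> \<open>Summation by parts leaves boundary terms with the indices
      \<open>j - d - 1\<close> and \<open>j + 1\<close>, which vanish on this knot interval.\<close>
    have z: "g (j - int d - 1) x = 0" "g (j + 1) x = 0"
      by (auto simp: g_def intro!: bs_local[OF assms(1) loc[OF x]])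
    have "((\<lambda>x. \<Sum>i\<in>{j - int (Suc d)..j}. c i * bs u (Suc d) i x) has_real_derivative
        (\<Sum>i\<in>{j - int (Suc d)..j}. c i * (real (Suc d) * (g i x - g (i+1) x)))) (at x)"
      unfolding g_def
      by (intro DERIV_sum DERIV_cmult)
        (use bs_has_derivative[OF assms(1) notin[OF x], of d] in \<open>simp add: algebra_simps del: bs.simps\<close>)
    moreover have "((\<lambda>x. \<Sum>i\<in>{j - int (Suc d)..j}. c i * bs u (Suc d) i x) has_real_derivative 0) (at x)"
      by (rule has_field_derivative_transform_within_open[of "\<lambda>x. 0" _ _ "{x0<..<x1}"])
        (use x Suc.prems in \<open>auto simp del: bs.simps\<close>)
    ultimately have "(\<Sum>i\<in>{j - int (Suc d)..j}. c i * (real (Suc d) * (g i x - g (i+1) x))) = 0"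
      by (rule DERIV_unique)
    moreover have "(\<Sum>i\<in>{j - int (Suc d)..j}. c i * (real (Suc d) * (g i x - g (i+1) x)))
      = real (Suc d) * (\<Sum>i\<in>{j - int (Suc d)..j}. c i * (g i x - g (i+1) x))"
      by (simp add: sum_distrib_left algebra_simps)
    ultimately have "0 = (\<Sum>i\<in>{j - int (Suc d)..j}. c i * (g i x - g (i+1) x))" by simp
    also have "\<dots> = (\<Sum>i\<in>{j - int (Suc d)..j}. c i * g i x) - (\<Sum>i\<in>{j - int (Suc d)..j}. c (i + 1 - 1) * g (i + 1) x)"
      by (simp add: sum_subtractf algebra_simps)
    also have "(\<Sum>i\<in>{j - int (Suc d)..j}. c (i + 1 - 1) * g (i + 1) x) = (\<Sum>i\<in>{j - int (Suc d)+1..j+1}. c (i - 1) * g i x)"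
      by (rule sum_shift1[of "\<lambda>i. c (i - 1) * g i x"])
    also have "{j - int (Suc d)..j} = insert (j - int d - 1) {j - int d..j}" by auto
    also have "{j - int (Suc d) + 1..j+1} = insert (j+1) {j - int d..j}" by auto
    finally have "0 = (\<Sum>i\<in>{j - int d..j}. (c i - c (i - 1)) * g i x)"
      by (simp add: sum_subtractf left_diff_distrib z)
    then show ?thesis by (simp add: g_def)
  qed
  have eq: "c i = c (i - 1)" if i: "i \<in> {j - int d..j}" for i
  proof -
    have "(c i - c (i - 1)) / (u (i + int d + 1) - u i) = 0" using Suc.IH[OF d0] i by blast
    moreover have "u i < u (i + int d + 1)"
      using mono_le[OF assms(1), of i j] mono_le[OF assms(1), of "j+1" "i + int d + 1"] i assms(2-4) by auto
    ultimately show ?thesis by simp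
  qed
  have const: "c (j - int k) = c j" if "k \<le> Suc d" for k
    using that
  proof (induction k)
    case (Suc k)
    then show ?case using eq[of "j - int k"] by (simp add: algebra_simps)
  qed simp
  have const': "c i = c j" if "i \<in> {j - int (Suc d)..j}" for i
    using const[of "nat (j - i)"] that by auto
  define x where "x = (x0 + x1) / 2"
  have x: "x \<in> {x0<..<x1}" using assms(2) by (auto simp: x_def)
  have "0 = (\<Sum>i\<in>{j - int (Suc d)..j}. c j * bs u (Suc d) i x)"
    using Suc.prems[OF x] const' by (metis (no_types, lifting) sum.cong)
  also have "\<dots> = c j" using partition_of_unity[OF assms(1) loc[OF x], of "Suc d"]
    unfolding sum_distrib_left[symmetric] by (simp del: bs.simps)
  finally show ?case using const' by metis
qed

section \<open>Truncated powers\<close>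

lemma ex_knot_interval:
  fixes u :: "int \<Rightarrow> real"
  assumes "u a \<le> x" "x < u (a + int n)"
  shows "\<exists>j\<ge>a. u j \<le> x \<and> x < u (j + 1)"
  using assms(2)
proof (induction n)
  case 0
  then show ?case using assms(1) by simp
next
  case (Suc n)
  show ?case
  proof (cases "x < u (a + int n)")
    case False
    then show ?thesis using Suc.prems by (intro exI[of _ "a + int n"]) (auto simp: algebra_simps)
  qed (use Suc.IH in blast)
qed

lemma pcompose_power: "(p ^ n) \<circ>\<^sub>p q = (p \<circ>\<^sub>p q) ^ n" for p q :: "'a :: comm_semiring_1 poly"
  by (induction n) (simp_all add: pcompose_mult pcompose_1)

lemma poly_altdef_le: "degree p \<le> d \<Longrightarrow> poly p x = (\<Sum>k\<le>d. coeff p k * x ^ k)" for p :: "real poly"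
  unfolding poly_altdef by (rule sum.mono_neutral_left) (auto intro: coeff_eq_0)

lemma coeff_pcompose_eq_0:
  fixes p :: "real poly"
  assumes "[:- t, 1:] ^ m dvd p" "k < m"
  shows "coeff (p \<circ>\<^sub>p [:t, 1:]) k = 0"
proof -
  obtain s where "p = [:- t, 1:] ^ m * s" using assms(1) by (elim dvdE)
  then have "p \<circ>\<^sub>p [:t, 1:] = [:0, 1:] ^ m * (s \<circ>\<^sub>p [:t, 1:])"
    by (simp add: pcompose_mult pcompose_power pcompose_pCons)
  also have "[:0, 1:] ^ m = monom (1::real) m" by (simp add: monom_altdef)
  finally show ?thesis using assms(2) by (simp add: coeff_monom_mult)
qed

text \<open>Expand Marsden's identity in powers of \<open>y - t\<close>: below the order \<open>m\<close> of the knot \<open>t\<close>, the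
  B-splines whose support contains \<open>t\<close> in its interior contribute nothing.\<close>

lemma truncated_power_in_span:
  assumes "mono u" "u (a - 1) < t" "u a = t" "u (a + int m - 1) = t" "r < m" "r \<le> d"
  shows "\<exists>c. \<forall>x. x < u L \<longrightarrow>
    (if t \<le> x then (x - t) ^ (d - r) else 0) = (\<Sum>i\<in>{a..<L}. c i * bs u d i x)"
proof -
  define q where "q i = coeff (psi u d i \<circ>\<^sub>p [:t, 1:]) r" for i
  \<comment> \<open>The coefficient of \<open>(y - t) ^ r\<close> in
    \<open>(y - x) ^ d = ((y - t) + (t - x)) ^ d\<close> is
    \<open>(d choose r) * (t - x) ^ (d - r)\<close>; \<open>K\<close> removes the binomial and turns
    \<open>t - x\<close> into \<open>x - t\<close>.\<close>
  define K :: real where "K = (- 1) ^ (d - r) / of_nat (d choose r)"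
  have "(if t \<le> x then (x - t) ^ (d - r) else 0) = (\<Sum>i\<in>{a..<L}. K * q i * bs u d i x)" if x: "x < u L" for x
  proof (cases "t \<le> x")
    case False
    have "bs u d i x = 0" if "i \<in> {a..<L}" for i
      using False that assms(3) mono_le[OF assms(1), of a i] by (intro bs_eq_0[OF assms(1)]) auto
    with False show ?thesis by simp
  next
    case True
    have aL: "a < L" using mono_le[OF assms(1), of L a] True x assms(3) by force
    obtain j where j: "j \<ge> a" "u j \<le> x" "x < u (j+1)"
      using ex_knot_interval[of u a x "nat (L - a)"] True x assms(3) aL by auto
    have jm: "a + int m - 1 \<le> j"
      using mono_le[OF assms(1), of "j+1" "a + int m - 1"] True j assms(4) by force
    have jL: "j < L" using mono_le[OF assms(1), of L j] j x by force
    have q0: "q i = 0" if i: "i \<in> {j - int d..j}" "i < a" for i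
    proof -
      have "{a..a + int m - 1} \<subseteq> {i+1..i + int d}" using i jm by auto
      then have "(\<Prod>k\<in>{a..a + int m - 1}. [:- u k, 1:]) dvd psi u d i"
        unfolding psi_def by (intro prod_dvd_prod_subset) auto
      also have "(\<Prod>k\<in>{a..a + int m - 1}. [:- u k, 1:]) = (\<Prod>k\<in>{a..a + int m - 1}. [:- t, 1:])"
      proof (intro prod.cong refl)
        fix k assume "k \<in> {a..a + int m - 1}"
        then have "u k = t" using mono_le[OF assms(1), of a k] mono_le[OF assms(1), of k "a + int m - 1"] assms(3,4) by auto
        then show "[:- u k, 1:] = [:- t, 1:]" by simp
      qed
      finally show ?thesis unfolding q_def using assms(5) by (intro coeff_pcompose_eq_0) auto
    qed
    have "(\<Sum>i\<in>{j - int d..j}. smult (bs u d i x) (psi u d i)) \<circ>\<^sub>p [:t, 1:] = [:t - x, 1:] ^ d"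
      unfolding marsden[OF assms(1) j(2,3)] by (simp add: pcompose_power pcompose_pCons)
    then have "(\<Sum>i\<in>{j - int d..j}. bs u d i x * q i) = coeff ([:t - x, 1:] ^ d) r"
      by (simp add: q_def pcompose_sum pcompose_smult coeff_sum flip: \<open>_ = [:t - x, 1:] ^ d\<close>)
    then have S: "(\<Sum>i\<in>{j - int d..j}. bs u d i x * q i) = of_nat (d choose r) * (t - x) ^ (d - r)"
      using assms(6) by (simp add: coeff_linear_poly_power)
    have "(\<Sum>i\<in>{a..<L}. K * q i * bs u d i x) = (\<Sum>i\<in>{j - int d..j} \<union> {a..<L}. K * q i * bs u d i x)"
      by (rule sum.mono_neutral_left) (use q0 jL in \<open>auto simp: not_le\<close>)
    also have "\<dots> = (\<Sum>i\<in>{j - int d..j}. K * q i * bs u d i x)"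
      by (rule sum.mono_neutral_right) (use bs_local[OF assms(1) j(2,3)] in auto)
    also have "\<dots> = K * (\<Sum>i\<in>{j - int d..j}. bs u d i x * q i)" by (simp add: sum_distrib_left algebra_simps)
    also have "\<dots> = (- 1) ^ (d - r) * (t - x) ^ (d - r)" unfolding S K_def using assms(6) by simp
    also have "\<dots> = (x - t) ^ (d - r)" by (simp flip: power_mult_distrib)
    finally show ?thesis using True by simp
  qed
  then show ?thesis by (intro exI[of _ "\<lambda>i. K * q i"] allI impI)
qed

section \<open>Finite knot sequences\<close>

text \<open>Unit steps beyond both ends. The new knots are simple and differ from all given ones, so
  multiplicities are unchanged, and every real number lies in some knot interval, where Marsden's
  identity applies.\<close>

definition ext :: "real list \<Rightarrow> int \<Rightarrow> real" where
  "ext \<kappa> k = (if k < 0 then \<kappa> ! 0 + real_of_int k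
     else if k < int (length \<kappa>) then \<kappa> ! nat k
     else last \<kappa> + real_of_int (k - int (length \<kappa>) + 1))"

lemma ext_nth: "i < length \<kappa> \<Longrightarrow> ext \<kappa> (int i) = \<kappa> ! i"
  by (simp add: ext_def)

lemma mono_ext:
  assumes "sorted \<kappa>" "\<kappa> \<noteq> []"
  shows "mono (ext \<kappa>)"
proof (rule monoI)
  fix i j :: int assume ij: "i \<le> j"
  have lo: "\<kappa> ! 0 \<le> \<kappa> ! k" if "k < length \<kappa>" for k
    using assms that by (simp add: sorted_nth_mono)
  have hi: "\<kappa> ! k \<le> last \<kappa>" if "k < length \<kappa>" for k
    using assms that by (auto simp: last_conv_nth intro!: sorted_nth_mono)
  have "\<kappa> ! 0 \<le> last \<kappa>" using hi[of 0] assms by simp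
  then show "ext \<kappa> i \<le> ext \<kappa> j"
    unfolding ext_def using ij lo[of "nat j"] hi[of "nat i"] sorted_nth_mono[OF assms(1), of "nat i" "nat j"]
    by (auto simp: nat_mono) linarith+
qed

lemma bspl_eq_bs: "i + d + 1 < length \<kappa> \<Longrightarrow> bspl \<kappa> d i x = bs (ext \<kappa>) d (int i) x"
proof (induction d arbitrary: i)
  case 0
  then show ?case using ext_nth[of i \<kappa>] ext_nth[of "i+1" \<kappa>] by (simp add: algebra_simps)
next
  case (Suc d)
  have e: "ext \<kappa> (int i) = \<kappa> ! i" "ext \<kappa> (int i + 1) = \<kappa> ! (i + 1)"
    "ext \<kappa> (int i + int d + 1) = \<kappa> ! (i + Suc d)" "ext \<kappa> (int i + int d + 2) = \<kappa> ! (i + Suc d + 1)"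
    using ext_nth[of i \<kappa>] ext_nth[of "i+1" \<kappa>] ext_nth[of "i + Suc d" \<kappa>] ext_nth[of "i + Suc d + 1" \<kappa>] Suc.prems
    by (simp_all add: algebra_simps)
  have IH: "bspl \<kappa> d i x = bs (ext \<kappa>) d (int i) x" "bspl \<kappa> d (i + 1) x = bs (ext \<kappa>) d (int i + 1) x"
    using Suc.IH[of i] Suc.IH[of "i+1"] Suc.prems by (simp_all add: algebra_simps)
  show ?case unfolding bspl.simps bs.simps e IH ..
qed

lemma ext_window:
  assumes "i + d + 1 < length \<kappa>"
  shows "ext \<kappa> ` {int i..int i + int d + 1} \<subseteq> set \<kappa>"
proof
  fix y assume "y \<in> ext \<kappa> ` {int i..int i + int d + 1}"
  then obtain k where k: "y = ext \<kappa> k" "int i \<le> k" "k \<le> int i + int d + 1" by auto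
  then have "y = \<kappa> ! nat k" "nat k < length \<kappa>" using assms by (auto simp: ext_def)
  then show "y \<in> set \<kappa>" by simp
qed

text \<open>Provides the multiplicity bound in the form used by \<open>dvd_jp\<close>:
  \<open>m + 1\<close> consecutive knots equal to \<open>t\<close> would all come from the list,
  because the knots added by \<open>ext\<close> lie strictly outside its range.\<close>

lemma ext_multiplicity:
  assumes "sorted \<kappa>" "t \<in> set \<kappa>" "count_list \<kappa> t \<le> m"
  shows "\<not> (ext \<kappa> k = t \<and> ext \<kappa> (k + int m) = t)"
proof
  assume A: "ext \<kappa> k = t \<and> ext \<kappa> (k + int m) = t"
  have ne: "\<kappa> \<noteq> []" using assms(2) by auto
  have in_range: "0 \<le> l \<and> l < int (length \<kappa>)" if "ext \<kappa> l = t" for l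
  proof -
    obtain s where s: "s < length \<kappa>" "\<kappa> ! s = t" using assms(2) by (auto simp: in_set_conv_nth)
    have "\<kappa> ! 0 \<le> t" "t \<le> last \<kappa>"
      using s assms(1) ne by (auto simp: last_conv_nth intro!: sorted_nth_mono)
    with that show ?thesis by (auto simp: ext_def split: if_splits)
  qed
  have all: "ext \<kappa> l = t" if "k \<le> l" "l \<le> k + int m" for l
    using mono_le[OF mono_ext[OF assms(1) ne], of k l] mono_le[OF mono_ext[OF assms(1) ne], of l "k + int m"] A that
    by auto
  have r: "0 \<le> k" "k + int m < int (length \<kappa>)" using in_range A by auto
  have "{nat k..nat k + m} \<subseteq> {i. i < length \<kappa> \<and> \<kappa> ! i = t}"
  proof
    fix i assume i: "i \<in> {nat k..nat k + m}"
    then have "ext \<kappa> (int i) = t" using r by (intro all) auto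
    moreover have "i < length \<kappa>" using i r by auto
    ultimately show "i \<in> {i. i < length \<kappa> \<and> \<kappa> ! i = t}" by (simp add: ext_nth)
  qed
  then have "card {nat k..nat k + m} \<le> card {i. i < length \<kappa> \<and> \<kappa> ! i = t}" by (intro card_mono) auto
  also have "\<dots> = count_list \<kappa> t"
    by (simp add: count_list_eq_length_filter length_filter_conv_card eq_commute)
  finally show False using assms(3) by simp
qed

definition jumps :: "real list \<Rightarrow> nat \<Rightarrow> nat \<Rightarrow> real \<Rightarrow> real poly" where
  "jumps \<kappa> d i = jp (ext \<kappa>) d (int i)"

lemma bspl_eq_ppv:
  assumes "sorted \<kappa>" "i + d + 1 < length \<kappa>"
  shows "bspl \<kappa> d i = ppv (set \<kappa>) (jumps \<kappa> d i)"
proof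
  fix x
  have "\<kappa> \<noteq> []" using assms(2) by auto
  then show "bspl \<kappa> d i x = ppv (set \<kappa>) (jumps \<kappa> d i) x"
    unfolding bspl_eq_bs[OF assms(2)] jumps_def
    by (intro bs_eq_ppv mono_ext assms(1) ext_window assms(2)) auto
qed

lemma degree_jumps: "degree (jumps \<kappa> d i t) \<le> d"
  unfolding jumps_def by (rule degree_jp)

lemma dvd_jumps:
  assumes "sorted \<kappa>" "t \<in> set \<kappa>"
  shows "[:- t, 1:] ^ (d + 1 - count_list \<kappa> t) dvd jumps \<kappa> d i t"
  unfolding jumps_def using assms by (intro dvd_jp mono_ext ext_multiplicity) auto

lemma poly_jumps_eq_0:
  assumes "sorted \<kappa>" "t \<in> set \<kappa>" "count_list \<kappa> t \<le> d"
  shows "poly (jumps \<kappa> d i t) t = 0"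
proof -
  have "[:- t, 1:] dvd [:- t, 1:] ^ (d + 1 - count_list \<kappa> t)" using assms(3) by (intro dvd_power) auto
  then have "[:- t, 1:] dvd jumps \<kappa> d i t" using dvd_jumps[OF assms(1,2)] dvd_trans by blast
  then show ?thesis by (simp add: poly_eq_0_iff_dvd)
qed

lemma sorted_split:
  assumes "sorted (\<kappa> :: real list)"
  shows "\<kappa> = filter (\<lambda>x. x < t) \<kappa> @ replicate (count_list \<kappa> t) t @ filter (\<lambda>x. t < x) \<kappa>"
  using assms
proof (induction \<kappa>)
  case (Cons a \<kappa>)
  have f: "filter (\<lambda>x. x < t) \<kappa> = []" if "t \<le> a" using Cons.prems that by (force simp: filter_empty_conv)
  have c: "count_list \<kappa> t = 0" "filter (\<lambda>x. t < x) \<kappa> = \<kappa>" if "t < a"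
    using Cons.prems that by (force simp: count_list_0_iff filter_id_conv)+
  consider "a < t" | "a = t" | "t < a" by linarith
  then show ?case
  proof cases
    case 1
    then show ?thesis using Cons by simp
  next
    case 2
    then show ?thesis using Cons f by simp
  next
    case 3
    then show ?thesis using f c by simp
  qed
qed simp

lemma knot_block:
  assumes "sorted \<kappa>" "t \<in> set \<kappa>"
  obtains a where "ext \<kappa> (int a - 1) < t" "ext \<kappa> (int a) = t"
    "ext \<kappa> (int a + int (count_list \<kappa> t) - 1) = t" "a < length \<kappa>"
proof
  define F G where "F = filter (\<lambda>x. x < t) \<kappa>" and "G = filter (\<lambda>x. t < x) \<kappa>"
  define m where "m = count_list \<kappa> t"
  define a where "a = length F"
  have k: "\<kappa> = F @ replicate m t @ G" using sorted_split[OF assms(1), of t] by (simp add: F_def G_def m_def)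
  have m: "m > 0" using assms(2) by (simp add: m_def count_list_eq_length_filter) (metis filter_empty_conv)
  have len: "a + m \<le> length \<kappa>" using arg_cong[OF k, of length] by (simp add: a_def)
  have n: "\<kappa> ! (a + i) = t" if "i < m" for i
    using that by (subst k) (simp add: a_def nth_append)
  show "ext \<kappa> (int (length F)) = t" "length F < length \<kappa>"
    using n[of 0] len m by (auto simp: a_def[symmetric] ext_nth)
  have "int a + int m - 1 = int (a + (m - 1))" using m by simp
  then show "ext \<kappa> (int (length F) + int (count_list \<kappa> t) - 1) = t"
    using n[of "m - 1"] len m unfolding a_def[symmetric] m_def[symmetric] by (simp only: ext_nth)
  show "ext \<kappa> (int (length F) - 1) < t"
  proof (cases "a = 0")
    case True
    then show ?thesis using n[of 0] m by (simp add: a_def[symmetric] ext_def)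
  next
    case False
    have "\<kappa> ! (a - 1) = F ! (a - 1)" using False by (subst k) (simp add: a_def nth_append)
    also have "\<dots> \<in> set F" using False by (auto simp: a_def)
    finally have "\<kappa> ! (a - 1) < t" by (simp add: F_def)
    moreover have "int a - 1 = int (a - 1)" using False by simp
    ultimately show ?thesis using False len unfolding a_def[symmetric] by (simp only: ext_nth)
  qed
qed

section \<open>The theorem of Curry and Schoenberg\<close>

lemma sum_nat_int_atLeastLessThan: "(\<Sum>i<n. f (int i)) = (\<Sum>i\<in>{0..<int n}. f i)"
  for f :: "int \<Rightarrow> 'a :: comm_monoid_add"
  by (rule sum.reindex_bij_witness[of _ nat int]) auto

text \<open>Expand \<open>Q t\<close> in powers of \<open>x - t\<close>; divisibility leaves only
  powers that \<open>truncated_power_in_span\<close> provides. Truncated powers do not vanish on the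
  right, so their expansions may involve the last \<open>d + 1\<close> B-splines over
  \<open>ext \<kappa>\<close>, whose supports leave the list; \<open>vanish\<close> forces those
  coefficients to be \<open>0\<close>.\<close>

theorem curry_schoenberg:
  assumes "sorted \<kappa>" "\<kappa> \<noteq> []"
    and deg: "\<And>t. t \<in> set \<kappa> \<Longrightarrow> degree (Q t) \<le> d"
    and dvd: "\<And>t. t \<in> set \<kappa> \<Longrightarrow> [:- t, 1:] ^ (d + 1 - count_list \<kappa> t) dvd Q t"
    and vanish: "\<And>x. last \<kappa> \<le> x \<Longrightarrow> ppv (set \<kappa>) Q x = 0"
  shows "\<exists>c. \<forall>x. ppv (set \<kappa>) Q x = (\<Sum>i<length \<kappa> - (d + 1). c i * bspl \<kappa> d i x)"
proof -
  define u where "u = ext \<kappa>"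
  define L where "L = int (length \<kappa>)"
  have mu: "mono u" unfolding u_def by (rule mono_ext[OF assms(1,2)])
  have uL: "u L = last \<kappa> + 1" "u (L - 1) = last \<kappa>"
    using assms(2) ext_nth[of "length \<kappa> - 1" \<kappa>] by (simp_all add: u_def L_def ext_def last_conv_nth of_nat_diff Suc_leI)
  \<comment> \<open>The bound keeps the index set finite: below \<open>u L\<close> no B-spline with
    index \<open>L\<close> or more is active.\<close>
  define sp where "sp f \<longleftrightarrow> (\<exists>c. \<forall>x. x < u L \<longrightarrow> f x = (\<Sum>i\<in>{0..<L}. c i * bs u d i x))" for f
  have sp_cmul: "sp (\<lambda>x. k * f x)" if "sp f" for k f
    using that unfolding sp_def
  proof (elim exE, intro exI allI impI)
    fix c x assume "\<forall>x. x < u L \<longrightarrow> f x = (\<Sum>i\<in>{0..<L}. c i * bs u d i x)" "x < u L"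
    then show "k * f x = (\<Sum>i\<in>{0..<L}. (k * c i) * bs u d i x)" by (simp add: sum_distrib_left algebra_simps)
  qed
  have sp_sum: "sp (\<lambda>x. \<Sum>k\<in>A. f k x)" if "finite A" "\<And>k. k \<in> A \<Longrightarrow> sp (f k)" for A :: "'b set" and f
  proof -
    have "\<forall>k\<in>A. \<exists>c. \<forall>x. x < u L \<longrightarrow> f k x = (\<Sum>i\<in>{0..<L}. c i * bs u d i x)"
      using that(2) unfolding sp_def by blast
    then obtain c where "\<forall>k\<in>A. \<forall>x. x < u L \<longrightarrow> f k x = (\<Sum>i\<in>{0..<L}. c k i * bs u d i x)"
      by (rule bchoice[THEN exE])
    then have "(\<Sum>k\<in>A. f k x) = (\<Sum>i\<in>{0..<L}. (\<Sum>k\<in>A. c k i) * bs u d i x)" if "x < u L" for x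
      using that by (simp add: sum_distrib_right sum.swap[of _ _ A])
    then show ?thesis unfolding sp_def by (intro exI[of _ "\<lambda>i. \<Sum>k\<in>A. c k i"] allI impI)
  qed
  have trunc: "sp (\<lambda>x. if t \<le> x then (x - t) ^ k else 0)"
    if t: "t \<in> set \<kappa>" and k: "d + 1 - count_list \<kappa> t \<le> k" "k \<le> d" for t k
  proof -
    obtain a where a: "u (int a - 1) < t" "u (int a) = t"
      "u (int a + int (count_list \<kappa> t) - 1) = t" "a < length \<kappa>"
      using knot_block[OF assms(1) t] unfolding u_def by blast
    have "count_list \<kappa> t > 0" using t by (simp add: count_list_eq_length_filter) (metis filter_empty_conv)
    \<comment> \<open>With \<open>r = d - k\<close>, the lower bound on the exponent
      \<open>k\<close> is the condition \<open>r < m\<close> on the block of \<open>m\<close> equal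
      knots.\<close>
    then have "d - k < count_list \<kappa> t" "d - k \<le> d" "d - (d - k) = k" using k by auto
    then have "\<exists>c. \<forall>x. x < u L \<longrightarrow> (if t \<le> x then (x - t) ^ k else 0) = (\<Sum>i\<in>{int a..<L}. c i * bs u d i x)"
      using truncated_power_in_span[OF mu a(1-3), of "d - k" d L] by (simp only:)
    then obtain c where
      c: "\<And>x. x < u L \<Longrightarrow> (if t \<le> x then (x - t) ^ k else 0) = (\<Sum>i\<in>{int a..<L}. c i * bs u d i x)"
      by blast
    have "(\<Sum>i\<in>{int a..<L}. c i * bs u d i x) = (\<Sum>i\<in>{0..<L}. (if int a \<le> i then c i else 0) * bs u d i x)" for x
      by (rule sum.mono_neutral_cong_left) auto
    with c show ?thesis unfolding sp_def by (intro exI[of _ "\<lambda>i. if int a \<le> i then c i else 0"]) simp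
  qed
  have "sp (ppv (set \<kappa>) Q)"
    unfolding ppv_def
  proof (intro sp_sum finite_set)
    fix t assume t: "t \<in> set \<kappa>"
    define q where "q = Q t \<circ>\<^sub>p [:t, 1:]"
    have dq: "degree q \<le> d" using deg[OF t] degree_pcompose_le[of "Q t" "[:t, 1:]"] by (simp add: q_def)
    have "poly (Q t) x = poly q (x - t)" for x by (simp add: q_def poly_pcompose)
    then have "poly (Q t) x = (\<Sum>k\<le>d. coeff q k * (x - t) ^ k)" for x
      using poly_altdef_le[OF dq] by simp
    then have "(if t \<le> x then poly (Q t) x else 0) = (\<Sum>k\<le>d. coeff q k * (if t \<le> x then (x - t) ^ k else 0))" for x
      by simp
    moreover have "sp (\<lambda>x. \<Sum>k\<le>d. coeff q k * (if t \<le> x then (x - t) ^ k else 0))"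
    proof (intro sp_sum finite_atMost)
      fix k assume "k \<in> {..d}"
      show "sp (\<lambda>x. coeff q k * (if t \<le> x then (x - t) ^ k else 0))"
      proof (cases "k < d + 1 - count_list \<kappa> t")
        case True
        then have "coeff q k = 0" unfolding q_def using dvd[OF t] by (intro coeff_pcompose_eq_0)
        then show ?thesis unfolding sp_def by (intro exI[of _ "\<lambda>_. 0"]) simp
      qed (use \<open>k \<in> {..d}\<close> in \<open>intro sp_cmul trunc t; simp\<close>)
    qed
    ultimately show "sp (\<lambda>x. if t \<le> x then poly (Q t) x else 0)" by simp
  qed
  then obtain c where c: "\<And>x. x < u L \<Longrightarrow> ppv (set \<kappa>) Q x = (\<Sum>i\<in>{0..<L}. c i * bs u d i x)"
    unfolding sp_def by blast
  \<comment> \<open>A list with fewer than \<open>d + 1\<close> knots makes the range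
    \<open>{L - 1 - int d..L - 1}\<close> reach negative indices; \<open>c'\<close> is
    \<open>0\<close> there.\<close>
  define c' where "c' i = (if 0 \<le> i then c i else 0)" for i
  have "\<forall>i\<in>{L - 1 - int d..L - 1}. c' i = 0"
  proof (rule bs_local_independence[OF mu])
    show "last \<kappa> < last \<kappa> + 1" "u (L - 1) \<le> last \<kappa>" "last \<kappa> + 1 \<le> u (L - 1 + 1)" using uL by auto
    fix x assume x: "x \<in> {last \<kappa><..<last \<kappa> + 1}"
    have x': "u (L - 1) \<le> x" "x < u (L - 1 + 1)" using x uL by auto
    have "(\<Sum>i\<in>{L - 1 - int d..L - 1}. c' i * bs u d i x) = (\<Sum>i\<in>{L - 1 - int d..L - 1} \<union> {0..<L}. c' i * bs u d i x)"
      using bs_local[OF mu x'] by (intro sum.mono_neutral_left) auto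
    also have "\<dots> = (\<Sum>i\<in>{0..<L}. c i * bs u d i x)"
      by (rule sum.mono_neutral_cong_right) (auto simp: c'_def)
    also have "\<dots> = 0" using c[of x] vanish[of x] x uL by simp
    finally show "(\<Sum>i\<in>{L - 1 - int d..L - 1}. c' i * bs u d i x) = 0" .
  qed
  then have c0: "c i = 0" if "0 \<le> i" "L - 1 - int d \<le> i" "i < L" for i using that by (force simp: c'_def)
  define N where "N = length \<kappa> - (d + 1)"
  have bb: "bspl \<kappa> d i x = bs u d (int i) x" if "i < N" for i x
    using that unfolding u_def N_def by (intro bspl_eq_bs) auto
  have "ppv (set \<kappa>) Q x = (\<Sum>i<N. c (int i) * bspl \<kappa> d i x)" for x
  proof (cases "x < u L")
    case True
    have "ppv (set \<kappa>) Q x = (\<Sum>i\<in>{0..<int N}. c i * bs u d i x)"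
      unfolding c[OF True] by (rule sum.mono_neutral_right) (auto simp: N_def L_def intro!: c0)
    then show ?thesis using sum_nat_int_atLeastLessThan[of "\<lambda>i. c i * bs u d i x" N] by (simp add: bb)
  next
    case False
    have "bs u d (int i) x = 0" if "i < N" for i
    proof (rule bs_eq_0[OF mu])
      have "int i + int d + 1 \<le> L" using that by (simp add: N_def L_def)
      then      show "x < u (int i) \<or> u (int i + int d + 1) \<le> x"
        using mono_le[OF mu, of "int i + int d + 1" L] False by simp
    qed
    then have "(\<Sum>i<N. c (int i) * bspl \<kappa> d i x) = 0" using bb by simp
    moreover have "ppv (set \<kappa>) Q x = 0" using False uL by (intro vanish) simp
    ultimately show ?thesis by simp
  qed
  then show ?thesis unfolding N_def by (intro exI[of _ "\<lambda>i. c (int i)"] allI)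
qed

lemma bspl_independent_interval:
  assumes "sorted \<kappa>" "\<kappa> \<noteq> []" "x0 < x1" "ext \<kappa> j \<le> x0" "x1 \<le> ext \<kappa> (j + 1)" "N + d + 1 \<le> length \<kappa>"
    and "\<And>x. x \<in> {x0<..<x1} \<Longrightarrow> (\<Sum>k<N. c k * bspl \<kappa> d k x) = 0"
    and "i < N" "int i \<le> j" "j \<le> int i + int d"
  shows "c i = 0"
proof -
  define c' where "c' k = (if 0 \<le> k \<and> k < int N then c (nat k) else 0)" for k
  have mu: "mono (ext \<kappa>)" by (rule mono_ext[OF assms(1,2)])
  have "\<forall>k\<in>{j - int d..j}. c' k = 0"
  proof (rule bs_local_independence[OF mu assms(3-5)])
    fix x assume x: "x \<in> {x0<..<x1}"
    have x': "ext \<kappa> j \<le> x" "x < ext \<kappa> (j + 1)" using x assms by auto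
    have "(\<Sum>k\<in>{j - int d..j}. c' k * bs (ext \<kappa>) d k x) = (\<Sum>k\<in>{j - int d..j} \<union> {0..<int N}. c' k * bs (ext \<kappa>) d k x)"
      using bs_local[OF mu x'] by (intro sum.mono_neutral_left) auto
    also have "\<dots> = (\<Sum>k\<in>{0..<int N}. c' k * bs (ext \<kappa>) d k x)"
      by (rule sum.mono_neutral_right) (auto simp: c'_def)
    also have "\<dots> = (\<Sum>k<N. c' (int k) * bs (ext \<kappa>) d (int k) x)"
      by (rule sum_nat_int_atLeastLessThan[symmetric])
    also have "\<dots> = (\<Sum>k<N. c k * bspl \<kappa> d k x)"
      using assms(6) by (intro sum.cong refl) (auto simp: c'_def bspl_eq_bs)
    finally show "(\<Sum>k\<in>{j - int d..j}. c' k * bs (ext \<kappa>) d k x) = 0" using assms(7)[OF x] by simp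
  qed
  then have "c' (int i) = 0" using assms(9,10) by auto
  then show ?thesis using assms(8) by (simp add: c'_def)
qed

section \<open>Supports of B-splines over lists and independence on an interval\<close>

lemma bspl_support:
  assumes "sorted \<kappa>" "i + d + 1 < length \<kappa>" "x < \<kappa> ! i \<or> \<kappa> ! (i + d + 1) \<le> x"
  shows "bspl \<kappa> d i x = 0"
proof -
  have "\<kappa> \<noteq> []" using assms(2) by auto
  moreover have "ext \<kappa> (int i) = \<kappa> ! i" "ext \<kappa> (int i + int d + 1) = \<kappa> ! (i + d + 1)"
    using ext_nth[of i \<kappa>] ext_nth[of "i + d + 1" \<kappa>] assms(2) by (simp_all add: algebra_simps)
  ultimately show ?thesis using assms bs_eq_0[OF mono_ext[OF assms(1)], of x "int i" d] by (simp add: bspl_eq_bs)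
qed

lemma ex_ext_interval:
  assumes "\<kappa> \<noteq> []"
  shows "\<exists>j. ext \<kappa> j \<le> x \<and> x < ext \<kappa> (j + 1)"
proof -
  define a where "a = - (\<lceil>\<bar>x - \<kappa> ! 0\<bar>\<rceil> + 1)"
  define b where "b = int (length \<kappa>) + \<lceil>\<bar>x - last \<kappa>\<bar>\<rceil> + 1"
  have ca: "\<bar>x - \<kappa> ! 0\<bar> \<le> of_int \<lceil>\<bar>x - \<kappa> ! 0\<bar>\<rceil>" and cb: "\<bar>x - last \<kappa>\<bar> \<le> of_int \<lceil>\<bar>x - last \<kappa>\<bar>\<rceil>" by (rule le_of_int_ceiling)+
  have c0: "0 \<le> \<lceil>\<bar>x - \<kappa> ! 0\<bar>\<rceil>" "0 \<le> \<lceil>\<bar>x - last \<kappa>\<bar>\<rceil>" by simp_all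
  have "ext \<kappa> a \<le> x" using ca c0 by (simp add: ext_def a_def) linarith
  moreover have "x < ext \<kappa> b" using cb c0 by (simp add: ext_def b_def) linarith
  moreover have "a + int (nat (b - a)) = b" using c0 by (simp add: a_def b_def)
  ultimately show ?thesis using ex_knot_interval[of "ext \<kappa>" a x "nat (b - a)"] by auto
qed

text \<open>A B-spline that is nonzero at \<open>s\<close> is active on the half-open knot interval
  around \<open>s\<close>. The part of that interval to the right of \<open>s\<close> and to the
  left of \<open>b\<close> is nonempty and suffices for the local statement.\<close>

lemma bspl_independent:
  assumes "sorted \<kappa>" "N + d + 1 \<le> length \<kappa>"
    and "\<And>x. x \<in> {a<..<b} \<Longrightarrow> (\<Sum>k<N. c k * bspl \<kappa> d k x) = 0"
    and "i < N" "s \<in> {a<..<b}" "bspl \<kappa> d i s \<noteq> 0"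
  shows "c i = 0"
proof -
  have ne: "\<kappa> \<noteq> []" using assms(2) by auto
  obtain j where j: "ext \<kappa> j \<le> s" "s < ext \<kappa> (j + 1)" using ex_ext_interval[OF ne] by blast
  have "int i \<in> {j - int d..j}"
    using bs_local[OF mono_ext[OF assms(1) ne] j, of "int i" d] assms(2,4,6) by (auto simp: bspl_eq_bs)
  then show ?thesis
    using bspl_independent_interval[OF assms(1) ne _ _ _ assms(2), of s "min (ext \<kappa> (j+1)) b" j c i] j assms by auto
qed

text \<open>If the B-spline vanished on the first nonempty knot interval of its support, the
  combination with the single coefficient \<open>1\<close> would contradict local
  independence.\<close>

lemma bspl_nonzero:
  assumes "sorted \<kappa>" "i + d + 1 < length \<kappa>" "\<kappa> ! i < \<kappa> ! (i + d + 1)"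
  shows "\<exists>s. \<kappa> ! i < s \<and> s < \<kappa> ! (i + d + 1) \<and> bspl \<kappa> d i s \<noteq> 0"
proof (rule ccontr)
  assume *: "\<not> ?thesis"
  have ne: "\<kappa> \<noteq> []" using assms(2) by auto
  have e: "ext \<kappa> (int i) = \<kappa> ! i" "ext \<kappa> (int i + int (d + 1)) = \<kappa> ! (i + d + 1)"
    using ext_nth[of i \<kappa>] ext_nth[of "i + d + 1" \<kappa>] assms(2) by (simp_all add: algebra_simps)
  define x where "x = \<kappa> ! i"
  obtain j where j: "int i \<le> j" "ext \<kappa> j \<le> x" "x < ext \<kappa> (j + 1)"
    using ex_knot_interval[of "ext \<kappa>" "int i" x "d + 1"] assms(3) e by (auto simp: x_def)
  have mu: "mono (ext \<kappa>)" by (rule mono_ext[OF assms(1) ne])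
  have jd: "j \<le> int i + int d"
    using mono_le[OF mu, of "int i + int (d+1)" j] j e assms(3) by (force simp: x_def)
  have le: "ext \<kappa> (j + 1) \<le> \<kappa> ! (i + d + 1)" using mono_le[OF mu, of "j+1" "int i + int (d+1)"] jd e by simp
  have "(\<Sum>k<i+1. (if k = i then 1 else 0) * bspl \<kappa> d k y) = bspl \<kappa> d i y" for y
    by (simp add: if_distrib[of "\<lambda>c. c * _"] cong: if_cong)
  then have "(if i = i then 1 else 0 :: real) = 0"
    using * le j jd assms(2)
    by (intro bspl_independent_interval[OF assms(1) ne, of x "ext \<kappa> (j+1)" j "i+1" d "\<lambda>k. if k = i then 1 else 0" i])
      (auto simp: x_def simp del: sum.lessThan_Suc)
  then show False by simp
qed

section \<open>Splines\<close>

text \<open>Forgets the knots and the jumps. The class is closed under sums and products, and its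
  members are integrable and right continuous, which is what the Gramian systems ask of the
  basis.\<close>

definition ppfun :: "(real \<Rightarrow> real) \<Rightarrow> bool" where
  "ppfun f \<longleftrightarrow> (\<exists>T Q. finite T \<and> f = ppv T Q)"

lemma ppfunI: "finite T \<Longrightarrow> f = ppv T Q \<Longrightarrow> ppfun f"
  unfolding ppfun_def by blast

lemma ppfun_cmult: "ppfun f \<Longrightarrow> ppfun (\<lambda>x. c * f x)"
proof -
  assume "ppfun f"
  then obtain T Q where T: "finite T" "f = ppv T Q" unfolding ppfun_def by blast
  show ?thesis
    by (rule ppfunI[OF T(1), of _ "\<lambda>t. smult c (Q t)"])
      (auto simp: T(2) ppv_def fun_eq_iff sum_distrib_left intro!: sum.cong)
qed

lemma ppfun_common:
  assumes "ppfun f" "ppfun g"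
  obtains T Q R where "finite T" "f = ppv T Q" "g = ppv T R"
proof -
  from assms obtain T1 Q1 T2 Q2 where *: "finite T1" "f = ppv T1 Q1" "finite T2" "g = ppv T2 Q2"
    unfolding ppfun_def by blast
  show thesis
  proof
    show "finite (T1 \<union> T2)" using * by simp
    show "f = ppv (T1 \<union> T2) (\<lambda>t. if t \<in> T1 then Q1 t else 0)"
      "g = ppv (T1 \<union> T2) (\<lambda>t. if t \<in> T2 then Q2 t else 0)"
      unfolding *(2,4) by (intro ext ppv_superset; use * in simp)+
  qed
qed

lemma ppfun_add:
  assumes "ppfun f" "ppfun g"
  shows "ppfun (\<lambda>x. f x + g x)"
proof -
  obtain T Q R where T: "finite T" "f = ppv T Q" "g = ppv T R" using ppfun_common[OF assms] .
  show ?thesis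
    by (rule ppfunI[OF T(1), of _ "\<lambda>t. Q t + R t"])
      (auto simp: T(2,3) ppv_def fun_eq_iff sum.distrib[symmetric] intro!: sum.cong)
qed

lemma ppfun_mult:
  assumes "ppfun f" "ppfun g"
  shows "ppfun (\<lambda>x. f x * g x)"
proof -
  obtain T Q R where T: "finite T" "f = ppv T Q" "g = ppv T R" using ppfun_common[OF assms] .
  show ?thesis
    by (rule ppfunI[OF T(1), of _ "ppmult T Q R"]) (simp add: T ppv_mult fun_eq_iff)
qed

lemma ppfun_sum: "finite A \<Longrightarrow> (\<And>k. k \<in> A \<Longrightarrow> ppfun (f k)) \<Longrightarrow> ppfun (\<lambda>x. \<Sum>k\<in>A. f k x)"
proof (induction A rule: finite_induct)
  case empty
  show ?case by (rule ppfunI[of "{}"]) (auto simp: ppv_def)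
qed (simp add: ppfun_add)

lemma ppfun_integrable: "ppfun f \<Longrightarrow> f integrable_on {a..b}"
  unfolding ppfun_def using ppv_integrable by blast

lemma ppfun_right: "ppfun f \<Longrightarrow> (f \<longlongrightarrow> f x) (at_right x)"
  unfolding ppfun_def using tendsto_ppv_right by blast

lemma ppfun_left: "ppfun f \<Longrightarrow> \<exists>l. (f \<longlongrightarrow> l) (at_left x)"
  unfolding ppfun_def using tendsto_ppv_left by blast

lemma ppfun_bspl: "sorted \<kappa> \<Longrightarrow> i + d + 1 < length \<kappa> \<Longrightarrow> ppfun (bspl \<kappa> d i)"
  by (rule ppfunI[of "set \<kappa>"]) (simp_all add: bspl_eq_ppv)

text \<open>By right continuity, a nonzero value at \<open>s\<close> keeps \<open>g x * g x\<close>
  above a positive constant on an interval to the right of \<open>s\<close>. Hence \<open>g\<close>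
  vanishes at every point of \<open>{a..<b}\<close>, not merely almost everywhere.\<close>

lemma ppfun_square_integral_0:
  assumes g: "ppfun g" and int: "integral {a..b} (\<lambda>x. g x * g x) = 0" and s: "a \<le> s" "s < b"
  shows "g s = 0"
proof (rule ccontr)
  assume nz: "g s \<noteq> 0"
  define f where "f x = g x * g x" for x
  have f: "ppfun f" unfolding f_def by (rule ppfun_mult[OF g g])
  have f0: "f x \<ge> 0" for x by (simp add: f_def)
  have "f s > 0" using nz by (auto simp: f_def zero_less_mult_iff)
  have "eventually (\<lambda>x. f s / 2 < f x) (at_right s)"
    using order_tendstoD(1)[OF ppfun_right[OF f, of s], of "f s / 2"] \<open>f s > 0\<close> by simp
  then obtain e where e: "e > s" "\<And>x. s < x \<Longrightarrow> x < e \<Longrightarrow> f s / 2 < f x"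
    unfolding eventually_at_right_field by blast
  \<comment> \<open>The midpoint keeps the closed interval \<open>{s..c}\<close> strictly below
    \<open>e\<close>, the minimum keeps it inside \<open>{a..b}\<close>.\<close>
  define c where "c = min ((s + e) / 2) b"
  have c: "s < c" "c \<le> b" "c < e" using e s by (auto simp: c_def min_def)
  have "f s / 2 * (c - s) = integral {s..c} (\<lambda>x. f s / 2)" using c by simp
  also have "\<dots> \<le> integral {s..c} f"
  proof (rule integral_le)
    show "f integrable_on {s..c}" by (rule ppfun_integrable[OF f])
    show "f s / 2 \<le> f x" if "x \<in> {s..c}" for x
      using e(2)[of x] that c \<open>f s > 0\<close> by (cases "x = s") auto
  qed auto
  also have "\<dots> \<le> integral {a..b} f"
    by (rule integral_subset_le) (use s c f0 in \<open>auto intro: ppfun_integrable[OF f]\<close>)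
  also have "\<dots> = 0" using int by (simp add: f_def[abs_def])
  finally show False using \<open>f s > 0\<close> c by (simp add: mult_le_0_iff)
qed

text \<open>The jump of the product at \<open>t\<close> has at least the smaller of the orders of
  the factors, and \<open>m1\<close>, \<open>m2\<close> say that the multiplicity of
  \<open>t\<close> in \<open>\<kappa>\<close> demands no more. A factor without the knot
  \<open>t\<close> has jump \<open>0\<close> there, which is divisible by everything.\<close>

lemma bspl_product_in_span:
  assumes s: "sorted \<kappa>1" "sorted \<kappa>2" "sorted \<kappa>"
    and ij: "i + d1 + 1 < length \<kappa>1" "j + d2 + 1 < length \<kappa>2"
    and sub: "set \<kappa>1 \<subseteq> set \<kappa>" "set \<kappa>2 \<subseteq> set \<kappa>"
    and m1: "\<And>t. t \<in> set \<kappa>1 \<Longrightarrow> d1 + d2 + 1 - count_list \<kappa> t \<le> d1 + 1 - count_list \<kappa>1 t"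
    and m2: "\<And>t. t \<in> set \<kappa>2 \<Longrightarrow> d1 + d2 + 1 - count_list \<kappa> t \<le> d2 + 1 - count_list \<kappa>2 t"
  shows "\<exists>c. \<forall>x. bspl \<kappa>1 d1 i x * bspl \<kappa>2 d2 j x
    = (\<Sum>k<length \<kappa> - (d1 + d2 + 1). c k * bspl \<kappa> (d1 + d2) k x)"
proof -
  have ne: "\<kappa> \<noteq> []" using ij(1) sub(1) by auto
  define Q R where "Q t = (if t \<in> set \<kappa>1 then jumps \<kappa>1 d1 i t else 0)"
    and "R t = (if t \<in> set \<kappa>2 then jumps \<kappa>2 d2 j t else 0)" for t
  have e: "bspl \<kappa>1 d1 i x * bspl \<kappa>2 d2 j x = ppv (set \<kappa>) (ppmult (set \<kappa>) Q R) x" for x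
    unfolding bspl_eq_ppv[OF s(1) ij(1)] bspl_eq_ppv[OF s(2) ij(2)]
      ppv_superset[OF finite_set sub(1)] ppv_superset[OF finite_set sub(2)]
    unfolding Q_def[symmetric] R_def[symmetric] by (rule ppv_mult) simp
  have "\<exists>c. \<forall>x. ppv (set \<kappa>) (ppmult (set \<kappa>) Q R) x
    = (\<Sum>k<length \<kappa> - (d1 + d2 + 1). c k * bspl \<kappa> (d1 + d2) k x)"
  proof (rule curry_schoenberg[OF s(3) ne])
    show "degree (ppmult (set \<kappa>) Q R t) \<le> d1 + d2" if "t \<in> set \<kappa>" for t
      by (rule degree_ppmult) (use that in \<open>auto simp: Q_def R_def intro: degree_jumps\<close>)
  next
    fix t assume "t \<in> set \<kappa>"
    have "[:- t, 1:] ^ (d1 + d2 + 1 - count_list \<kappa> t) dvd Q t"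
      using dvd_trans[OF le_imp_power_dvd[OF m1] dvd_jumps[OF s(1)]] by (simp add: Q_def)
    moreover have "[:- t, 1:] ^ (d1 + d2 + 1 - count_list \<kappa> t) dvd R t"
      using dvd_trans[OF le_imp_power_dvd[OF m2] dvd_jumps[OF s(2)]] by (simp add: R_def)
    ultimately show "[:- t, 1:] ^ (d1 + d2 + 1 - count_list \<kappa> t) dvd ppmult (set \<kappa>) Q R t"
      by (rule dvd_ppmult)
  next
    fix x assume x: "last \<kappa> \<le> x"
    have "\<kappa>1 ! (i + d1 + 1) \<in> set \<kappa>" using ij(1) sub(1) by (auto intro: nth_mem)
    then obtain m where m: "m < length \<kappa>" "\<kappa> ! m = \<kappa>1 ! (i + d1 + 1)" by (metis in_set_conv_nth)
    have "\<kappa>1 ! (i + d1 + 1) \<le> last \<kappa>"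
      using sorted_nth_mono[OF s(3), of m "length \<kappa> - 1"] m ne by (simp add: last_conv_nth)
    then have "bspl \<kappa>1 d1 i x = 0" using x by (intro bspl_support[OF s(1) ij(1)]) simp
    then show "ppv (set \<kappa>) (ppmult (set \<kappa>) Q R) x = 0" using e[of x] by simp
  qed
  then show ?thesis unfolding e .
qed

section \<open>Limits, continuity, sums and derivatives of B-splines over lists\<close>

lemma bspl_left_continuous:
  assumes "sorted \<kappa>" "i + d + 1 < length \<kappa>" "count_list \<kappa> b \<le> d"
  shows "(bspl \<kappa> d i \<longlongrightarrow> bspl \<kappa> d i b) (at_left b)"
proof -
  have "(\<Sum>t\<in>set \<kappa>. if t < b then poly (jumps \<kappa> d i t) b else 0) = ppv (set \<kappa>) (jumps \<kappa> d i) b"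
    unfolding ppv_def using poly_jumps_eq_0[OF assms(1) _ assms(3)] by (intro sum.cong) auto
  then show ?thesis
    using tendsto_ppv_left[of "set \<kappa>" "jumps \<kappa> d i" b] by (simp add: bspl_eq_ppv[OF assms(1,2)])
qed

lemma bspl_cl_eq: "x \<noteq> b \<Longrightarrow> bspl_cl b \<kappa> d i x = bspl \<kappa> d i x"
  by (simp add: bspl_cl_def)

lemma bspl_cl_left_limit:
  assumes "sorted \<kappa>" "i + d + 1 < length \<kappa>"
  shows "(bspl \<kappa> d i \<longlongrightarrow> bspl_cl b \<kappa> d i b) (at_left b)"
proof -
  obtain l where l: "(bspl \<kappa> d i \<longlongrightarrow> l) (at_left b)" using ppfun_left[OF ppfun_bspl[OF assms]] by blast
  then show ?thesis using tendsto_Lim[OF _ l] by (simp add: bspl_cl_def)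
qed

text \<open>On \<open>{a..b}\<close>, a B-spline continued to \<open>b\<close> from the left is the piecewise polynomial function
  without the jump at \<open>b\<close>.\<close>

lemma bspl_continuous_on:
  assumes "sorted \<kappa>" "i + d + 1 < length \<kappa>"
    and "\<And>t. t \<in> set \<kappa> \<Longrightarrow> a < t \<Longrightarrow> t < b \<Longrightarrow> count_list \<kappa> t \<le> d"
    and f: "\<And>x. a \<le> x \<Longrightarrow> x < b \<Longrightarrow> f x = bspl \<kappa> d i x" "(bspl \<kappa> d i \<longlongrightarrow> f b) (at_left b)"
  shows "continuous_on {a..b} f"
proof -
  let ?T = "{t\<in>set \<kappa>. t < b}" and ?Q = "jumps \<kappa> d i"
  have "continuous_on {a..b} (ppv ?T ?Q)"
    using poly_jumps_eq_0[OF assms(1) _ assms(3)] by (intro continuous_on_ppv) auto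
  moreover have "f x = ppv ?T ?Q x" if "x \<in> {a..b}" for x
  proof (cases "x = b")
    case True
    have "f b = (\<Sum>t\<in>set \<kappa>. if t < b then poly (?Q t) b else 0)"
      using tendsto_unique[OF _ f(2)] tendsto_ppv_left[of "set \<kappa>" ?Q b]
      by (simp add: bspl_eq_ppv[OF assms(1,2)])
    also have "\<dots> = ppv ?T ?Q b" unfolding ppv_def by (intro sum.mono_neutral_cong_right) auto
    finally show ?thesis using True by simp
  next
    case False
    have "f x = ppv (set \<kappa>) ?Q x" using f(1) that False by (simp add: bspl_eq_ppv[OF assms(1,2)])
    also have "\<dots> = ppv ?T ?Q x" unfolding ppv_def using that False by (intro sum.mono_neutral_cong_right) auto
    finally show ?thesis .
  qed
  ultimately show ?thesis by (subst continuous_on_cong[OF refl, of _ _ "ppv ?T ?Q"]) auto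
qed

text \<open>Between the knots \<open>d\<close> and \<open>M\<close> all \<open>d + 1\<close> active
  B-splines have their knots inside the list; closer to the ends some of them belong only to
  \<open>ext \<kappa>\<close>.\<close>

lemma bspl_partition_of_unity:
  assumes "sorted \<kappa>" "length \<kappa> = M + d + 1" "\<kappa> ! d \<le> x" "x < \<kappa> ! M"
  shows "(\<Sum>i<M. bspl \<kappa> d i x) = 1"
proof -
  have ne: "\<kappa> \<noteq> []" using assms(2) by auto
  have mu: "mono (ext \<kappa>)" by (rule mono_ext[OF assms(1) ne])
  have e: "ext \<kappa> (int d) = \<kappa> ! d" "ext \<kappa> (int M) = \<kappa> ! M" using assms(2) by (auto intro!: ext_nth)
  obtain j where j: "ext \<kappa> j \<le> x" "x < ext \<kappa> (j + 1)" using ex_ext_interval[OF ne] by blast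
  have "int d \<le> j" using mono_le[OF mu, of "j+1" "int d"] j e assms(3) by force
  moreover have "j < int M" using mono_le[OF mu, of "int M" j] j e assms(4) by force
  ultimately have "(\<Sum>i\<in>{j - int d..j}. bs (ext \<kappa>) d i x) = (\<Sum>i\<in>{0..<int M}. bs (ext \<kappa>) d i x)"
    by (intro sum.mono_neutral_left) (auto intro!: bs_local[OF mu j])
  also have "\<dots> = (\<Sum>i<M. bspl \<kappa> d i x)"
    unfolding sum_nat_int_atLeastLessThan[symmetric] using assms(2) by (intro sum.cong) (auto simp: bspl_eq_bs)
  finally show ?thesis using partition_of_unity[OF mu j, of d] by simp
qed

lemma bspl_has_derivative:
  assumes "sorted \<kappa>" "i + d + 2 < length \<kappa>" "x \<notin> set \<kappa>"
  shows "(bspl \<kappa> (Suc d) i has_real_derivative real (Suc d) *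
     (bspl \<kappa> d i x / (\<kappa> ! (i + d + 1) - \<kappa> ! i)
      - bspl \<kappa> d (i + 1) x / (\<kappa> ! (i + d + 2) - \<kappa> ! (i + 1)))) (at x)"
proof -
  have ne: "\<kappa> \<noteq> []" using assms(2) by auto
  have e: "ext \<kappa> (int i) = \<kappa> ! i" "ext \<kappa> (int i + 1) = \<kappa> ! (i + 1)"
    "ext \<kappa> (int i + int d + 1) = \<kappa> ! (i + d + 1)" "ext \<kappa> (int i + int d + 2) = \<kappa> ! (i + d + 2)"
    using ext_nth[of i \<kappa>] ext_nth[of "i+1" \<kappa>] ext_nth[of "i + d + 1" \<kappa>] ext_nth[of "i + d + 2" \<kappa>] assms(2)
    by (simp_all add: algebra_simps)
  have b: "bspl \<kappa> (Suc d) i = bs (ext \<kappa>) (Suc d) (int i)" "bspl \<kappa> d i x = bs (ext \<kappa>) d (int i) x"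
    "bspl \<kappa> d (i + 1) x = bs (ext \<kappa>) d (int i + 1) x"
    using assms(2) bspl_eq_bs[of "i+1" d \<kappa> x] by (auto simp: bspl_eq_bs algebra_simps simp del: bspl.simps bs.simps)
  have "x \<notin> ext \<kappa> ` {int i..int i + int d + 2}"
    using ext_window[of i "Suc d" \<kappa>] assms(2,3) by (auto simp: algebra_simps)
  from bs_has_derivative[OF mono_ext[OF assms(1) ne] this] show ?thesis unfolding b e .
qed

lemma bspl_Cons: "bspl (a # \<kappa>) d (Suc i) x = bspl \<kappa> d i x"
  by (induction d arbitrary: i) simp_all

lemma bspl_append: "i + d + 1 < length \<kappa> \<Longrightarrow> bspl (\<kappa> @ ys) d i x = bspl \<kappa> d i x"
  by (induction d arbitrary: i) (simp_all add: nth_append)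

text \<open>\<open>\<rho>\<close> is \<open>\<nu>\<close> with one knot added at each end, so the
  B-spline of degree \<open>d\<close> with index \<open>k + 1\<close> over \<open>\<rho>\<close> has
  index \<open>k\<close> over \<open>\<nu>\<close>. Summation by parts gives the coefficients; the
  two boundary terms are supported to the left of \<open>\<nu> ! d\<close> and to the right of
  \<open>\<nu> ! Suc q\<close>.\<close>

lemma spline_has_vector_derivative:
  fixes c :: "nat \<Rightarrow> complex"
  assumes \<rho>: "sorted \<rho>" "\<rho> = x0 # \<nu> @ [x1]" "length \<nu> = q + d + 2" "x \<notin> set \<rho>"
    and dom: "\<nu> ! d \<le> x" "x \<le> \<nu> ! Suc q"
  shows "((\<lambda>x. \<Sum>i\<le>Suc q. c i * of_real (bspl \<rho> (Suc d) i x)) has_vector_derivative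
    (\<Sum>k\<le>q. of_real (real (Suc d) / (\<nu> ! (k + d + 1) - \<nu> ! k)) * (c (Suc k) - c k) * of_real (bspl \<nu> d k x))) (at x)"
proof -
  have len: "length \<rho> = q + d + 4" using \<rho> by simp
  define g where "g i = bspl \<rho> d i x / (\<rho> ! (i + d + 1) - \<rho> ! i)" for i
  have "((\<lambda>x. \<Sum>i\<le>Suc q. c i * of_real (bspl \<rho> (Suc d) i x)) has_vector_derivative
     (\<Sum>i\<le>Suc q. c i * of_real (real (Suc d) * (g i - g (Suc i))))) (at x)"
  proof (intro has_vector_derivative_sum has_vector_derivative_mult_right has_vector_derivative_of_real)
    fix i assume "i \<in> {..Suc q}"
    then show "(bspl \<rho> (Suc d) i has_real_derivative real (Suc d) * (g i - g (Suc i))) (at x)"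
      unfolding g_def using bspl_has_derivative[OF \<rho>(1) _ \<rho>(4), of i d] len by (simp del: bspl.simps)
  qed
  moreover have "(\<Sum>i\<le>Suc q. c i * of_real (real (Suc d) * (g i - g (Suc i))))
     = (\<Sum>k\<le>q. of_real (real (Suc d) / (\<nu> ! (k + d + 1) - \<nu> ! k)) * (c (Suc k) - c k) * of_real (bspl \<nu> d k x))"
  proof -
    have "x1 \<in> set \<rho>" "x0 \<in> set \<rho>" using \<rho>(2) by auto
    have g0: "g 0 = 0"
    proof -
      have "\<rho> ! (0 + d + 1) = \<nu> ! d" using \<rho> by (simp add: nth_append)
      then have "bspl \<rho> d 0 x = 0" using dom len by (intro bspl_support[OF \<rho>(1)]) auto
      then show ?thesis by (simp add: g_def)
    qed
    have gq: "g (Suc (Suc q)) = 0"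
    proof -
      have "\<rho> ! Suc (Suc q) = \<nu> ! Suc q" using \<rho> by (simp add: nth_append)
      \<comment> \<open>Supports include their left end, so at \<open>x = \<nu> ! Suc q\<close> the
        boundary term could survive; this is excluded since \<open>x\<close> is not a knot.\<close>
      moreover have "\<nu> ! Suc q \<noteq> x" using \<rho> by (auto simp: in_set_conv_nth)
      ultimately have "bspl \<rho> d (Suc (Suc q)) x = 0" using dom len by (intro bspl_support[OF \<rho>(1)]) auto
      then show ?thesis by (simp add: g_def)
    qed
    have gk: "g (Suc k) = bspl \<nu> d k x / (\<nu> ! (k + d + 1) - \<nu> ! k)" if "k \<le> q" for k
    proof -
      have "bspl \<rho> d (Suc k) x = bspl \<nu> d k x"
        unfolding \<rho>(2) bspl_Cons using that \<rho>(3) by (intro bspl_append) simp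
      moreover have "\<rho> ! (Suc k + d + 1) = \<nu> ! (k + d + 1)" "\<rho> ! Suc k = \<nu> ! k"
        using that \<rho> by (simp_all add: nth_append)
      ultimately show ?thesis by (simp add: g_def)
    qed
    have "(\<Sum>i\<le>Suc q. c i * of_real (real (Suc d) * (g i - g (Suc i))))
      = of_real (real (Suc d)) * ((\<Sum>i\<le>Suc q. c i * of_real (g i)) - (\<Sum>i\<le>Suc q. c i * of_real (g (Suc i))))"
      by (simp add: sum_distrib_left sum_subtractf[symmetric] algebra_simps del: sum.atMost_Suc)
    also have "(\<Sum>i\<le>Suc q. c i * of_real (g i)) = (\<Sum>k\<le>q. c (Suc k) * of_real (g (Suc k)))"
      by (subst sum.atMost_Suc_shift) (simp add: g0)
    also have "(\<Sum>i\<le>Suc q. c i * of_real (g (Suc i))) = (\<Sum>k\<le>q. c k * of_real (g (Suc k)))"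
      by (simp add: gq)
    also have "of_real (real (Suc d)) * ((\<Sum>k\<le>q. c (Suc k) * of_real (g (Suc k))) - (\<Sum>k\<le>q. c k * of_real (g (Suc k))))
      = (\<Sum>k\<le>q. of_real (real (Suc d)) * (c (Suc k) - c k) * of_real (g (Suc k)))"
      by (simp only: sum_subtractf[symmetric] sum_distrib_left) (simp add: algebra_simps)
    also have "\<dots> = (\<Sum>k\<le>q. of_real (real (Suc d) / (\<nu> ! (k + d + 1) - \<nu> ! k)) * (c (Suc k) - c k) * of_real (bspl \<nu> d k x))"
      by (intro sum.cong refl) (simp add: gk)
    finally show ?thesis .
  qed
  ultimately show ?thesis by simp
qed

section \<open>Gramian systems\<close>

text \<open>\<open>G\<close> and \<open>mom\<close> are parameters tied to the integrals by
  equations, so that an interpretation can put \<open>A_mat S\<close>, \<open>C_mat S\<close> or a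
  Gramian over a larger interval in their place. \<open>G\<close> may be singular.\<close>

locale gramian =
  fixes \<phi> :: "nat \<Rightarrow> real \<Rightarrow> real" and N :: nat and a b :: real and G :: "real mat"
    and mom :: "(real \<Rightarrow> real) \<Rightarrow> real vec"
  assumes ppfun: "\<And>k. k \<le> N \<Longrightarrow> ppfun (\<phi> k)"
    and G: "G = mat (N + 1) (N + 1) (\<lambda>(k, l). integral {a..b} (\<lambda>s. \<phi> k s * \<phi> l s))"
    and mom: "\<And>f. mom f = vec (N + 1) (\<lambda>l. integral {a..b} (\<lambda>s. f s * \<phi> l s))"
begin

lemma carrier: "G \<in> carrier_mat (N + 1) (N + 1)" unfolding G by simp

lemma solves_carrier: "solves G v x \<Longrightarrow> x \<in> carrier_vec (N + 1)"
  unfolding solves_def G by simp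

lemma mult_G: "x \<in> carrier_vec (N + 1) \<Longrightarrow> l \<le> N \<Longrightarrow>
  (G *\<^sub>v x) $ l = integral {a..b} (\<lambda>s. (\<Sum>k\<le>N. x $ k * \<phi> k s) * \<phi> l s)"
proof -
  assume x: "x \<in> carrier_vec (N + 1)" and l: "l \<le> N"
  have "(G *\<^sub>v x) $ l = (\<Sum>k\<in>{0..<N+1}. integral {a..b} (\<lambda>s. \<phi> l s * \<phi> k s) * x $ k)"
    using x l unfolding G by (simp add: mult_mat_vec_def scalar_prod_def)
  also have "\<dots> = (\<Sum>k\<le>N. integral {a..b} (\<lambda>s. x $ k * (\<phi> l s * \<phi> k s)))"
    by (intro sum.cong) (auto simp: mult.commute)
  also have "\<dots> = integral {a..b} (\<lambda>s. \<Sum>k\<le>N. x $ k * (\<phi> l s * \<phi> k s))"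
    using l by (intro integral_sum[symmetric] ppfun_integrable ppfun_cmult ppfun_mult ppfun) auto
  also have "\<dots> = integral {a..b} (\<lambda>s. (\<Sum>k\<le>N. x $ k * \<phi> k s) * \<phi> l s)"
    by (simp add: sum_distrib_left sum_distrib_right algebra_simps)
  finally show ?thesis .
qed

lemma solves_spanned:
  assumes "\<And>s. s \<in> {a<..<b} \<Longrightarrow> f s = (\<Sum>k\<le>N. c k * \<phi> k s)"
  shows "solves G (mom f) (vec (N + 1) c)"
  unfolding solves_def
proof
  show "vec (N + 1) c \<in> carrier_vec (dim_col G)" unfolding G by simp
  show "G *\<^sub>v vec (N + 1) c = mom f"
  proof (rule eq_vecI)
    fix l assume "l < dim_vec (mom f)"
    then have l: "l \<le> N" by (simp add: mom)
    have "integral {a..b} (\<lambda>s. f s * \<phi> l s) = integral {a..b} (\<lambda>s. (\<Sum>k\<le>N. c k * \<phi> k s) * \<phi> l s)"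
      using assms by (intro integral_spike[of "{a, b}"]) auto
    also have "\<dots> = integral {a..b} (\<lambda>s. (\<Sum>k\<le>N. vec (N + 1) c $ k * \<phi> k s) * \<phi> l s)" by simp
    finally show "(G *\<^sub>v vec (N + 1) c) $ l = mom f $ l" using l mult_G[of "vec (N+1) c" l] by (simp add: mom)
  qed (simp add: G mom)
qed

text \<open>The vector \<open>w = x - y\<close> lies in the kernel of \<open>G\<close>, and the
  quadratic form of \<open>G\<close> at \<open>w\<close> is the integral of the square of the
  combination with coefficients \<open>w\<close>. So the functions agree even if \<open>G\<close> is
  singular and the coefficients differ.\<close>

lemma solves_unique:
  assumes "solves G v x" "solves G v y" "s \<in> {a..<b}"
  shows "(\<Sum>k\<le>N. (x $ k - y $ k) * \<phi> k s) = 0"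
proof -
  have x: "x \<in> carrier_vec (N + 1)" and y: "y \<in> carrier_vec (N + 1)"
    using assms solves_carrier by blast+
  define w where "w = x - y"
  have w: "w \<in> carrier_vec (N + 1)" and wk: "\<And>k. k \<le> N \<Longrightarrow> w $ k = x $ k - y $ k"
    using x y by (simp_all add: w_def)
  have "G *\<^sub>v w = G *\<^sub>v x - G *\<^sub>v y" unfolding w_def by (rule mult_minus_distrib_mat_vec[OF carrier x y])
  also have "\<dots> = 0\<^sub>v (N + 1)" using assms(1,2) carrier unfolding solves_def by (metis mult_mat_vec_carrier x minus_cancel_vec)
  finally have w0: "G *\<^sub>v w = 0\<^sub>v (N + 1)" .
  define g where "g s = (\<Sum>k\<le>N. w $ k * \<phi> k s)" for s
  have g: "ppfun g" unfolding g_def by (intro ppfun_sum ppfun_cmult ppfun) auto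
  have "integral {a..b} (\<lambda>s. g s * g s) = integral {a..b} (\<lambda>s. \<Sum>l\<le>N. w $ l * (g s * \<phi> l s))"
  proof -
    have "g s * g s = (\<Sum>l\<le>N. w $ l * (g s * \<phi> l s))" for s
      by (subst (2) g_def) (simp add: sum_distrib_left algebra_simps)
    then show ?thesis by simp
  qed
  also have "\<dots> = (\<Sum>l\<le>N. integral {a..b} (\<lambda>s. w $ l * (g s * \<phi> l s)))"
    by (intro integral_sum ppfun_integrable ppfun_cmult ppfun_mult ppfun g) auto
  also have "\<dots> = (\<Sum>l\<le>N. w $ l * (G *\<^sub>v w) $ l)"
    by (intro sum.cong refl) (simp add: mult_G[OF w] g_def)
  also have "\<dots> = 0" by (simp add: w0)
  finally have "g s = 0" using assms(3) by (intro ppfun_square_integral_0[OF g]) auto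
  then show ?thesis by (simp add: g_def wk)
qed

lemma solves_imp_eq:
  assumes "\<And>s. s \<in> {a<..<b} \<Longrightarrow> f s = (\<Sum>k\<le>N. c k * \<phi> k s)" "solves G (mom f) x" "s \<in> {a..<b}"
  shows "(\<Sum>k\<le>N. (x $ k - c k) * \<phi> k s) = 0"
proof -
  have "(\<Sum>k\<le>N. (x $ k - c k) * \<phi> k s) = (\<Sum>k\<le>N. (x $ k - vec (N + 1) c $ k) * \<phi> k s)" by simp
  also have "\<dots> = 0" by (rule solves_unique[OF assms(2) solves_spanned[of f c] assms(3)]) (rule assms(1))
  finally show ?thesis .
qed

lemma independent_invertible:
  assumes indep: "\<And>c k. (\<And>s. s \<in> {a..<b} \<Longrightarrow> (\<Sum>k\<le>N. c k * \<phi> k s) = 0) \<Longrightarrow> k \<le> N \<Longrightarrow> c k = 0"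
  shows "invertible_mat G"
    and "solves G v x \<Longrightarrow> solves G v y \<Longrightarrow> x = y"
proof -
  show uniq: "x = y" if "solves G v x" "solves G v y" for v x y
  proof (rule eq_vecI)
    have xy: "x \<in> carrier_vec (N + 1)" "y \<in> carrier_vec (N + 1)" using that solves_carrier by blast+
    then show "dim_vec x = dim_vec y" by simp
    fix k assume "k < dim_vec y"
    then have k: "k \<le> N" using xy by simp
    have "x $ k - y $ k = 0"
      by (rule indep[of "\<lambda>k. x $ k - y $ k", OF _ k]) (rule solves_unique[OF that])
    then show "x $ k = y $ k" by simp
  qed
  have "det G \<noteq> 0"
  proof
    assume "det G = 0"
    then obtain v where v: "v \<in> carrier_vec (N+1)" "v \<noteq> 0\<^sub>v (N+1)" "G *\<^sub>v v = 0\<^sub>v (N+1)"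
      using det_0_iff_vec_prod_zero_field[OF carrier] by blast
    have "solves G (0\<^sub>v (N+1)) v" "solves G (0\<^sub>v (N+1)) (0\<^sub>v (N+1))"
      unfolding solves_def using v carrier by auto
    from uniq[OF this] v show False by simp
  qed
  from det_non_zero_imp_unit[OF carrier this]
  obtain B where "B \<in> carrier_mat (N+1) (N+1)" "B * G = 1\<^sub>m (N+1)" "G * B = 1\<^sub>m (N+1)"
    unfolding Units_def ring_mat_def by auto
  then show "invertible_mat G" unfolding invertible_mat_def inverts_mat_def using carrier by auto
qed

end

section \<open>The Pythagorean-hodograph construction\<close>

declare bspl.simps(2) [simp del]

lemma nth_less_if_count_list_le:
  fixes \<kappa> :: "real list"
  assumes "sorted \<kappa>" "i + d + 1 < length \<kappa>" "count_list \<kappa> (\<kappa> ! i) \<le> d + 1"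
  shows "\<kappa> ! i < \<kappa> ! (i + d + 1)"
proof (rule ccontr)
  assume "\<not> ?thesis"
  then have "ext \<kappa> (int i) = \<kappa> ! i \<and> ext \<kappa> (int i + int (d + 1)) = \<kappa> ! i"
    using sorted_nth_mono[OF assms(1), of i "i + d + 1"] assms(2) ext_nth[of i \<kappa>] ext_nth[of "i + d + 1" \<kappa>]
    by (simp add: algebra_simps)
  moreover have "\<kappa> ! i \<in> set \<kappa>" using assms(2) by simp
  ultimately show False using ext_multiplicity[OF assms(1) _ assms(3)] by blast
qed

lemma bspl_gramian:
  assumes \<kappa>: "sorted \<kappa>" "length \<kappa> = N + d + 2"
  shows "gramian (bspl \<kappa> d) N a b (mat (N + 1) (N + 1) (\<lambda>(k, l). integral {a..b} (\<lambda>s. bspl \<kappa> d k s * bspl \<kappa> d l s)))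
    (\<lambda>f. vec (N + 1) (\<lambda>l. integral {a..b} (\<lambda>s. f s * bspl \<kappa> d l s)))"
  by unfold_locales (use \<kappa> in \<open>auto intro: ppfun_bspl\<close>)

lemma bspl_independent_on:
  assumes \<kappa>: "sorted \<kappa>" "length \<kappa> = N + d + 2"
    and zero: "\<And>s. s \<in> {a..<b} \<Longrightarrow> (\<Sum>k\<le>N. c k * bspl \<kappa> d k s) = 0"
    and k: "k \<le> N" "s \<in> {a<..<b}" "bspl \<kappa> d k s \<noteq> 0"
  shows "c k = 0"
  by (rule bspl_independent[OF \<kappa>(1), of "N + 1" d a b c k s])
    (use \<kappa>(2) k zero in \<open>simp_all add: lessThan_Suc_atMost\<close>)

text \<open>Multiplicities of at most \<open>d + 1\<close> give every support positive length, and
  with all knots in \<open>{a..b}\<close> every B-spline is nonzero somewhere inside.\<close>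

lemma bspl_independent_all:
  assumes \<kappa>: "sorted \<kappa>" "length \<kappa> = N + d + 2"
    and count: "\<And>t. t \<in> set \<kappa> \<Longrightarrow> count_list \<kappa> t \<le> d + 1"
    and ab: "\<And>t. t \<in> set \<kappa> \<Longrightarrow> a \<le> t \<and> t \<le> b"
    and zero: "\<And>s. s \<in> {a..<b} \<Longrightarrow> (\<Sum>k\<le>N. c k * bspl \<kappa> d k s) = 0"
    and k: "k \<le> N"
  shows "c k = 0"
proof -
  have len: "k + d + 1 < length \<kappa>" using \<kappa>(2) k by simp
  have "\<kappa> ! k < \<kappa> ! (k + d + 1)"
    using len by (intro nth_less_if_count_list_le[OF \<kappa>(1) len] count) simp
  then obtain s where "\<kappa> ! k < s" "s < \<kappa> ! (k + d + 1)" "bspl \<kappa> d k s \<noteq> 0"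
    using bspl_nonzero[OF \<kappa>(1) len] by blast
  moreover have "a \<le> \<kappa> ! k" "\<kappa> ! (k + d + 1) \<le> b" using ab len by (auto intro: nth_mem)
  ultimately show ?thesis by (intro bspl_independent_on[OF \<kappa> zero k]) auto
qed

text \<open>Collects what the two settings share. \<open>mu_nu\<close>, \<open>rho_tau\<close> and
  \<open>nu_tau\<close> compare orders of vanishing and feed the product theorem; the bounds in
  \<open>dom\<close> place the domain where the B-splines over \<open>rhoK S\<close> sum to
  \<open>1\<close>. \<open>product_end\<close> is an assumption because the value at
  \<open>intB S\<close> arises differently: by right continuity in one setting, as a left limit in
  the other.\<close>

locale ph_setting =
  fixes S :: bs_setting and n :: nat and z :: "nat \<Rightarrow> complex" and r0 :: complex and x0 x1 :: real
  assumes n: "1 \<le> n" "deg S = n"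
    and sorted: "sorted (muK S)" "sorted (nuK S)" "sorted (rhoK S)" "sorted (tauK S)"
    and length: "length (muK S) = maxZ S + n + 2" "length (nuK S) = maxP S + 2 * n + 2"
      "length (tauK S) = maxT S + 4 * n + 3"
    and basis: "\<And>\<kappa> d k x. x \<noteq> intB S \<Longrightarrow> basis S \<kappa> d k x = bspl \<kappa> d k x"
    and rho: "rhoK S = x0 # nuK S @ [x1]"
    and nu_bounds: "\<And>t. t \<in> set (nuK S) \<Longrightarrow> intA S \<le> t \<and> t \<le> intB S"
    and nu_count: "\<And>t. t \<in> set (nuK S) \<Longrightarrow> count_list (nuK S) t \<le> 2 * n + 1"
    and subset: "set (muK S) \<subseteq> set (nuK S)" "set (rhoK S) \<subseteq> set (tauK S)"
    and mu_nu: "\<And>t. t \<in> set (muK S) \<Longrightarrow> 2 * n + 1 - count_list (nuK S) t \<le> n + 1 - count_list (muK S) t"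
    and rho_tau: "\<And>t. t \<in> set (rhoK S) \<Longrightarrow>
      4 * n + 2 - count_list (tauK S) t \<le> 2 * n + 2 - count_list (rhoK S) t"
    and nu_tau: "\<And>t. t \<in> set (nuK S) \<Longrightarrow>
      4 * n + 2 - count_list (tauK S) t \<le> 2 * n + 1 - count_list (nuK S) t"
    and dom: "intA S \<le> domA S" "domA S < domB S" "domB S \<le> intB S"
      "nuK S ! (2 * n) \<le> domA S" "domB S \<le> nuK S ! Suc (maxP S)"
    and left_continuous:
      "\<And>k. k \<le> maxZ S \<Longrightarrow> (bspl (muK S) n k \<longlongrightarrow> basis S (muK S) n k (domB S)) (at_left (domB S))"
      "\<And>k. k \<le> maxP S \<Longrightarrow> (bspl (nuK S) (2 * n) k \<longlongrightarrow> basis S (nuK S) (2 * n) k (domB S)) (at_left (domB S))"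
      "\<And>k. k \<le> maxP S + 1 \<Longrightarrow>
        (bspl (rhoK S) (2 * n + 1) k \<longlongrightarrow> basis S (rhoK S) (2 * n + 1) k (domB S)) (at_left (domB S))"
    and interior: "\<And>t. domA S < t \<Longrightarrow> t < domB S \<Longrightarrow> count_list (muK S) t \<le> n"
      "\<And>t. domA S < t \<Longrightarrow> t < domB S \<Longrightarrow> count_list (rhoK S) t \<le> 2 * n + 1"
    and product_end: "\<And>i j c. i \<le> maxP S + 1 \<Longrightarrow> j \<le> maxP S \<Longrightarrow>
      (\<And>s. s \<in> {intA S..<intB S} \<Longrightarrow> bspl (rhoK S) (2 * n + 1) i s * bspl (nuK S) (2 * n) j s
        = (\<Sum>k\<le>maxT S. c k * bspl (tauK S) (4 * n + 1) k s)) \<Longrightarrow>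
      basis S (rhoK S) (2 * n + 1) i (intB S) * basis S (nuK S) (2 * n) j (intB S)
        = (\<Sum>k\<le>maxT S. c k * basis S (tauK S) (4 * n + 1) k (intB S))"
begin

lemma length_rho: "length (rhoK S) = maxP S + 2 * n + 4"
  using length(2) by (simp add: rho)

text \<open>\<open>basis S\<close> and \<open>bspl\<close> differ at most at \<open>intB S\<close>,
  a null set, so all integrals can be taken with the right continuous B-splines.\<close>

lemma gram_eq:
  "gram S d \<kappa> N a b = mat (N + 1) (N + 1) (\<lambda>(k, l). integral {a..b} (\<lambda>s. bspl \<kappa> d k s * bspl \<kappa> d l s))"
  unfolding gram_def
  by (intro cong_mat refl, unfold prod.case, intro integral_spike[of "{intB S}"]) (simp_all add: basis)

lemma moments_eq:
  assumes "\<And>s. s \<noteq> intB S \<Longrightarrow> f s = g s"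
  shows "moments S d \<kappa> N a b f = vec (N + 1) (\<lambda>l. integral {a..b} (\<lambda>s. g s * bspl \<kappa> d l s))"
  unfolding moments_def
  by (intro eq_vecI, simp, intro integral_spike[of "{intB S}"]) (simp_all add: basis assms)

sublocale A: gramian "bspl (nuK S) (2 * n)" "maxP S" "intA S" "intB S" "A_mat S"
  "\<lambda>f. vec (maxP S + 1) (\<lambda>l. integral {intA S..intB S} (\<lambda>s. f s * bspl (nuK S) (2 * n) l s))"
  unfolding A_mat_def gram_eq n(2) using sorted(2) length(2) by (rule bspl_gramian)

sublocale C: gramian "bspl (tauK S) (4 * n + 1)" "maxT S" "intA S" "intB S" "C_mat S"
  "\<lambda>f. vec (maxT S + 1) (\<lambda>l. integral {intA S..intB S} (\<lambda>s. f s * bspl (tauK S) (4 * n + 1) l s))"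
  unfolding C_mat_def gram_eq n(2) by (rule bspl_gramian) (use sorted(4) length(3) in auto)

lemma b_vec_eq: "b_vec S i j = vec (maxP S + 1) (\<lambda>l. integral {intA S..intB S}
    (\<lambda>s. bspl (muK S) n i s * bspl (muK S) n j s * bspl (nuK S) (2 * n) l s))"
  unfolding b_vec_def n(2) by (rule moments_eq) (simp add: basis)

lemma e_vec_eq: "e_vec S i j = vec (maxT S + 1) (\<lambda>l. integral {intA S..intB S}
    (\<lambda>s. bspl (rhoK S) (2 * n + 1) i s * bspl (nuK S) (2 * n) j s * bspl (tauK S) (4 * n + 1) l s))"
  unfolding e_vec_def n(2) by (rule moments_eq) (simp add: basis)

lemma A_independent:
  assumes "\<And>s. s \<in> {intA S..<intB S} \<Longrightarrow> (\<Sum>k\<le>maxP S. c k * bspl (nuK S) (2 * n) k s) = 0" "k \<le> maxP S"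
  shows "c k = 0"
  by (rule bspl_independent_all[OF sorted(2) length(2) _ nu_bounds assms]) (use nu_count in auto)

lemma A_invertible: "invertible_mat (A_mat S)"
  by (rule A.independent_invertible) (rule A_independent)

text \<open>Existence comes from the product theorem over \<open>nuK S\<close>, uniqueness from
  linear independence; hence the description in \<open>chi\<close> picks the coefficients of the
  product itself.\<close>

lemma chi_product:
  assumes "i \<le> maxZ S" "j \<le> maxZ S"
  shows "bspl (muK S) n i s * bspl (muK S) n j s = (\<Sum>k\<le>maxP S. chi S i j $ k * bspl (nuK S) (2 * n) k s)"
proof -
  have "\<exists>c. \<forall>x. bspl (muK S) n i x * bspl (muK S) n j x
    = (\<Sum>k<length (nuK S) - (n + n + 1). c k * bspl (nuK S) (n + n) k x)"
  proof (rule bspl_product_in_span[OF sorted(1,1,2) _ _ subset(1,1)])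
    show "i + n + 1 < length (muK S)" "j + n + 1 < length (muK S)" using assms length(1) by simp_all
  qed (use mu_nu[unfolded mult_2] in blast)+
  moreover have "length (nuK S) - (n + n + 1) = Suc (maxP S)" using length(2) by simp
  ultimately have "\<exists>c. \<forall>x. bspl (muK S) n i x * bspl (muK S) n j x
    = (\<Sum>k\<le>maxP S. c k * bspl (nuK S) (2 * n) k x)"
    by (simp only: mult_2[symmetric] lessThan_Suc_atMost)
  then obtain c where c: "\<And>x. bspl (muK S) n i x * bspl (muK S) n j x
    = (\<Sum>k\<le>maxP S. c k * bspl (nuK S) (2 * n) k x)"
    by blast
  have sol: "solves (A_mat S) (b_vec S i j) (vec (maxP S + 1) c)"
    unfolding b_vec_eq by (rule A.solves_spanned) (rule c)
  have "chi S i j = vec (maxP S + 1) c"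
    unfolding chi_def
    by (rule the_equality[where P = "solves (A_mat S) (b_vec S i j)", OF sol])
      (rule A.independent_invertible(2), erule (1) A_independent, assumption, rule sol)
  then show ?thesis unfolding c by simp
qed

text \<open>\<open>domB S\<close> may be the point where \<open>basis S\<close> is continued from
  the left; the identity passes to it as a limit.\<close>

lemma chi_product':
  assumes "i \<le> maxZ S" "j \<le> maxZ S" "s \<in> {domA S..domB S}"
  shows "basis S (muK S) n i s * basis S (muK S) n j s = (\<Sum>k\<le>maxP S. chi S i j $ k * basis S (nuK S) (2 * n) k s)"
proof (cases "s = domB S")
  case True
  let ?F = "at_left (domB S)"
  have "((\<lambda>x. bspl (muK S) n i x * bspl (muK S) n j x) \<longlongrightarrow> basis S (muK S) n i s * basis S (muK S) n j s) ?F"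
    unfolding True by (intro tendsto_mult left_continuous assms)
  moreover have "((\<lambda>x. \<Sum>k\<le>maxP S. chi S i j $ k * bspl (nuK S) (2 * n) k x)
      \<longlongrightarrow> (\<Sum>k\<le>maxP S. chi S i j $ k * basis S (nuK S) (2 * n) k s)) ?F"
    unfolding True by (intro tendsto_sum tendsto_mult tendsto_const left_continuous) simp
  ultimately show ?thesis
    unfolding chi_product[OF assms(1,2)] by (rule tendsto_unique[OF trivial_limit_at_left_real])
next
  case False
  then show ?thesis using chi_product[OF assms(1,2), of s] assms(3) dom(3) by (simp add: basis)
qed

lemma z_square:
  assumes "s \<in> {domA S..domB S}"
  shows "(z_curve S z s)\<^sup>2 = spline S (2 * n) (nuK S) (maxP S) (p_coeff S z) s"
    and "of_real (speed S z s) = spline S (2 * n) (nuK S) (maxP S) (sigma_coeff S z) s"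
proof -
  have *: "(\<Sum>i\<le>maxZ S. z i * of_real (basis S (muK S) n i s)) * (\<Sum>j\<le>maxZ S. y j * of_real (basis S (muK S) n j s))
    = (\<Sum>k\<le>maxP S. (\<Sum>i\<le>maxZ S. \<Sum>j\<le>maxZ S. of_real (chi S i j $ k) * z i * y j) * of_real (basis S (nuK S) (2 * n) k s))"
    for y :: "nat \<Rightarrow> complex"
  proof -
    have "(\<Sum>i\<le>maxZ S. z i * of_real (basis S (muK S) n i s)) * (\<Sum>j\<le>maxZ S. y j * of_real (basis S (muK S) n j s))
      = (\<Sum>i\<le>maxZ S. \<Sum>j\<le>maxZ S. z i * y j * of_real (basis S (muK S) n i s * basis S (muK S) n j s))"
      unfolding sum_product by (intro sum.cong refl) (simp add: algebra_simps)
    also have "\<dots> = (\<Sum>i\<le>maxZ S. \<Sum>j\<le>maxZ S. \<Sum>k\<le>maxP S.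
        of_real (chi S i j $ k) * z i * y j * of_real (basis S (nuK S) (2 * n) k s))"
      by (intro sum.cong refl) (simp add: chi_product'[OF _ _ assms] sum_distrib_left algebra_simps)
    also have "\<dots> = (\<Sum>i\<le>maxZ S. \<Sum>k\<le>maxP S. \<Sum>j\<le>maxZ S.
        of_real (chi S i j $ k) * z i * y j * of_real (basis S (nuK S) (2 * n) k s))"
      by (intro sum.cong refl sum.swap)
    also have "\<dots> = (\<Sum>k\<le>maxP S. \<Sum>i\<le>maxZ S. \<Sum>j\<le>maxZ S.
        of_real (chi S i j $ k) * z i * y j * of_real (basis S (nuK S) (2 * n) k s))"
      by (rule sum.swap)
    finally show ?thesis by (simp add: sum_distrib_right)
  qed
  show "(z_curve S z s)\<^sup>2 = spline S (2 * n) (nuK S) (maxP S) (p_coeff S z) s"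
    unfolding z_curve_def spline_def p_coeff_def n(2) power2_eq_square by (rule *)
  have "of_real (speed S z s) = z_curve S z s * cnj (z_curve S z s)"
    unfolding speed_def using complex_norm_square[of "z_curve S z s"] by simp
  also have "\<dots> = spline S (2 * n) (nuK S) (maxP S) (sigma_coeff S z) s"
    unfolding z_curve_def spline_def sigma_coeff_def n(2) by (simp only: cnj_sum complex_cnj_mult complex_cnj_complex_of_real *)
  finally show "of_real (speed S z s) = spline S (2 * n) (nuK S) (maxP S) (sigma_coeff S z) s" .
qed

section \<open>The curve and its derivative\<close>

lemma continuous_on_basis:
  "k \<le> maxZ S \<Longrightarrow> continuous_on {domA S..domB S} (basis S (muK S) n k)"
  "k \<le> maxP S + 1 \<Longrightarrow> continuous_on {domA S..domB S} (basis S (rhoK S) (2 * n + 1) k)"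
proof -
  assume k: "k \<le> maxZ S"
  show "continuous_on {domA S..domB S} (basis S (muK S) n k)"
    by (rule bspl_continuous_on[OF sorted(1) _ interior(1) basis left_continuous(1)[OF k]])
      (use k length(1) dom(3) in auto)
next
  assume k: "k \<le> maxP S + 1"
  show "continuous_on {domA S..domB S} (basis S (rhoK S) (2 * n + 1) k)"
    by (rule bspl_continuous_on[OF sorted(3) _ interior(2) basis left_continuous(3)[OF k]])
      (use k length_rho dom(3) in auto)
qed

text \<open>The recursion of \<open>r_coeff\<close> inverts the derivative formula. The division is
  proper because supports over \<open>nuK S\<close> have positive length, by
  \<open>nu_count\<close>.\<close>

lemma r_coeff_diff:
  assumes "k \<le> maxP S"
  shows "of_real (real (Suc (2 * n)) / (nuK S ! (k + 2 * n + 1) - nuK S ! k)) * (r_coeff S z r0 (Suc k) - r_coeff S z r0 k)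
    = p_coeff S z k"
proof -
  have "nuK S ! k < nuK S ! (k + 2 * n + 1)"
    by (rule nth_less_if_count_list_le[OF sorted(2)]) (use length(2) assms nu_count in auto)
  then have "real (Suc (2 * n)) / (nuK S ! (k + 2 * n + 1) - nuK S ! k) * ((nuK S ! (k + 2 * n + 1) - nuK S ! k) / real (2 * n + 1)) = 1"
    by simp
  then have "complex_of_real (real (Suc (2 * n)) / (nuK S ! (k + 2 * n + 1) - nuK S ! k))
      * of_real ((nuK S ! (k + 2 * n + 1) - nuK S ! k) / real (2 * n + 1)) = 1"
    by (metis of_real_mult of_real_1)
  then show ?thesis by (simp only: r_coeff.simps n(2) add_diff_cancel_left' mult.assoc[symmetric] mult_1_left)
qed

text \<open>The derivative formula is available only off the knots. The fundamental theorem with a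
  finite exceptional set recovers the curve as the integral of the continuous square of
  \<open>z_curve S z\<close>, and that integral has the right derivative at the knots and,
  one-sidedly, at both ends.\<close>

lemma r_has_derivative:
  assumes s: "s \<in> {domA S..domB S}"
  shows "(r_curve S z r0 has_vector_derivative (z_curve S z s)\<^sup>2) (at s within {domA S..domB S})"
proof -
  let ?D = "{domA S..domB S}"
  have zc: "continuous_on ?D (\<lambda>s. (z_curve S z s)\<^sup>2)"
    unfolding z_curve_def spline_def n(2) by (intro continuous_intros continuous_on_basis) auto
  have rc: "continuous_on ?D (r_curve S z r0)"
    unfolding r_curve_def spline_def n(2) by (intro continuous_intros continuous_on_basis) auto
  have der: "(r_curve S z r0 has_vector_derivative (z_curve S z x)\<^sup>2) (at x)"
    if x: "x \<in> {domA S<..<domB S} - set (rhoK S)" for x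
  proof -
    have "((\<lambda>x. \<Sum>i\<le>Suc (maxP S). r_coeff S z r0 i * of_real (bspl (rhoK S) (Suc (2 * n)) i x)) has_vector_derivative
      (\<Sum>k\<le>maxP S. of_real (real (Suc (2 * n)) / (nuK S ! (k + 2 * n + 1) - nuK S ! k))
        * (r_coeff S z r0 (Suc k) - r_coeff S z r0 k) * of_real (bspl (nuK S) (2 * n) k x))) (at x)"
      by (rule spline_has_vector_derivative[OF sorted(3) rho length(2)]) (use x dom in auto)
    moreover have "(\<Sum>k\<le>maxP S. of_real (real (Suc (2 * n)) / (nuK S ! (k + 2 * n + 1) - nuK S ! k))
        * (r_coeff S z r0 (Suc k) - r_coeff S z r0 k) * of_real (bspl (nuK S) (2 * n) k x))
      = (\<Sum>k\<le>maxP S. p_coeff S z k * of_real (bspl (nuK S) (2 * n) k x))"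
      by (intro sum.cong refl) (simp only: r_coeff_diff atMost_iff)
    moreover have "\<dots> = (z_curve S z x)\<^sup>2"
      using x dom(3) by (subst z_square(1)) (auto simp: spline_def basis)
    ultimately have "((\<lambda>x. \<Sum>i\<le>Suc (maxP S). r_coeff S z r0 i * of_real (bspl (rhoK S) (Suc (2 * n)) i x))
        has_vector_derivative (z_curve S z x)\<^sup>2) (at x)"
      by (simp only:)
    then show ?thesis
      by (rule has_vector_derivative_transform_within_open[where S = "{domA S<..<domB S}"])
        (use x dom(3) in \<open>auto simp: r_curve_def spline_def n(2) basis simp del: bspl.simps sum.atMost_Suc\<close>)
  qed
  have ftc: "((\<lambda>s. (z_curve S z s)\<^sup>2) has_integral (r_curve S z r0 y - r_curve S z r0 (domA S))) {domA S..y}"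
    if "y \<in> ?D" for y
    by (rule fundamental_theorem_of_calculus_interior_strong[of "set (rhoK S)"])
      (use that der rc in \<open>auto intro: continuous_on_subset\<close>)
  have "((\<lambda>y. r_curve S z r0 (domA S) + integral {domA S..y} (\<lambda>s. (z_curve S z s)\<^sup>2))
      has_vector_derivative (0 + (z_curve S z s)\<^sup>2)) (at s within ?D)"
    by (intro has_vector_derivative_add has_vector_derivative_const integral_has_vector_derivative[OF zc s])
  then have "((\<lambda>y. r_curve S z r0 (domA S) + integral {domA S..y} (\<lambda>s. (z_curve S z s)\<^sup>2))
      has_vector_derivative (z_curve S z s)\<^sup>2) (at s within ?D)" by simp
  then show ?thesis
    by (rule has_vector_derivative_transform[rotated 2]) (use s integral_unique[OF ftc] in auto)
qed

section \<open>The Gramian system over \<open>tauK S\<close>\<close>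

lemma C_banded:
  assumes "k \<le> maxT S" "l \<le> maxT S" "4 * n + 1 < nat \<bar>int k - int l\<bar>"
  shows "C_mat S $$ (k, l) = 0"
proof -
  have z: "bspl (tauK S) (4 * n + 1) i s * bspl (tauK S) (4 * n + 1) j s = 0"
    if "i \<le> maxT S" "j \<le> maxT S" "i + (4 * n + 1) + 1 \<le> j" for i j s
  proof (rule ccontr)
    assume *: "\<not> ?thesis"
    have "tauK S ! (i + (4 * n + 1) + 1) \<le> tauK S ! j"
      using that length(3) by (intro sorted_nth_mono[OF sorted(4)]) auto
    moreover have "s < tauK S ! (i + (4 * n + 1) + 1)"
      using * bspl_support[OF sorted(4), of i "4 * n + 1" s] that length(3) by force
    moreover have "tauK S ! j \<le> s"
      using * bspl_support[OF sorted(4), of j "4 * n + 1" s] that length(3) by force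
    ultimately show False by linarith
  qed
  have 0: "bspl (tauK S) (4 * n + 1) k s * bspl (tauK S) (4 * n + 1) l s = 0" for s
  proof (cases "k \<le> l")
    case True
    then show ?thesis using assms by (intro z) auto
  next
    case False
    then show ?thesis using assms by (subst mult.commute, intro z) auto
  qed
  have "C_mat S $$ (k, l)
    = integral {intA S..intB S} (\<lambda>s. bspl (tauK S) (4 * n + 1) k s * bspl (tauK S) (4 * n + 1) l s)"
    using assms(1,2) unfolding C_mat_def gram_eq n(2) by simp
  also have "\<dots> = 0" unfolding 0 by simp
  finally show ?thesis .
qed

lemma product_spanned:
  assumes "i \<le> maxP S + 1" "j \<le> maxP S"
  shows "\<exists>c. \<forall>s. bspl (rhoK S) (2 * n + 1) i s * bspl (nuK S) (2 * n) j s
    = (\<Sum>k\<le>maxT S. c k * bspl (tauK S) (4 * n + 1) k s)"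
proof -
  have nu_rho: "set (nuK S) \<subseteq> set (rhoK S)" by (auto simp: rho)
  have e: "2 * n + 1 + 2 * n = 4 * n + 1" by simp
  have "\<exists>c. \<forall>x. bspl (rhoK S) (2 * n + 1) i x * bspl (nuK S) (2 * n) j x
    = (\<Sum>k<length (tauK S) - (2 * n + 1 + 2 * n + 1). c k * bspl (tauK S) (2 * n + 1 + 2 * n) k x)"
  proof (rule bspl_product_in_span[OF sorted(3,2,4) _ _ subset(2) subset_trans[OF nu_rho subset(2)]])
    show "i + (2 * n + 1) + 1 < length (rhoK S)" "j + 2 * n + 1 < length (nuK S)"
      using assms length(2) length_rho by simp_all
  next
    fix t assume "t \<in> set (rhoK S)"
    from rho_tau[OF this]
    show "2 * n + 1 + 2 * n + 1 - count_list (tauK S) t \<le> 2 * n + 1 + 1 - count_list (rhoK S) t" by simp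
  next
    fix t assume "t \<in> set (nuK S)"
    from nu_tau[OF this]
    show "2 * n + 1 + 2 * n + 1 - count_list (tauK S) t \<le> 2 * n + 1 - count_list (nuK S) t" by simp
  qed
  moreover have "length (tauK S) - (2 * n + 1 + 2 * n + 1) = Suc (maxT S)" using length(3) by simp
  ultimately show ?thesis by (simp only: e lessThan_Suc_atMost)
qed

lemma e_solvable:
  assumes "i \<le> maxP S + 1" "j \<le> maxP S"
  shows "\<exists>x. solves (C_mat S) (e_vec S i j) x"
proof -
  obtain c where c: "\<And>s. bspl (rhoK S) (2 * n + 1) i s * bspl (nuK S) (2 * n) j s
    = (\<Sum>k\<le>maxT S. c k * bspl (tauK S) (4 * n + 1) k s)"
    using product_spanned[OF assms] by blast
  have "solves (C_mat S) (e_vec S i j) (vec (maxT S + 1) c)"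
    unfolding e_vec_eq by (rule C.solves_spanned) (rule c)
  then show ?thesis ..
qed

text \<open>By \<open>C.solves_unique\<close> the difference of two solutions represents the zero
  function; this forces a coefficient as soon as its B-spline is nonzero somewhere inside the
  interval.\<close>

lemma C_unique:
  fixes x y :: "real vec"
  assumes "solves (C_mat S) v x" "solves (C_mat S) v y" "k \<le> maxT S"
    "s \<in> {intA S<..<intB S}" "basis S (tauK S) (4 * n + 1) k s \<noteq> 0"
  shows "x $ k = y $ k"
proof -
  have "x $ k - y $ k = 0"
    by (rule bspl_independent_on[OF sorted(4) _ C.solves_unique[OF assms(1,2)] assms(3,4)])
      (use assms(4,5) length(3) basis[of s] in auto)
  then show ?thesis by simp
qed

text \<open>A solution need not be the coefficient vector \<open>c\<close> of the exact expansion,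
  but both represent the same function on \<open>{intA S..<intB S}\<close>;
  \<open>product_end\<close> adds the right end.\<close>

lemma product_expansion:
  fixes x :: "real vec"
  assumes ij: "i \<le> maxP S + 1" "j \<le> maxP S" and x: "solves (C_mat S) (e_vec S i j) x"
    and s: "s \<in> {intA S..intB S}"
  shows "basis S (rhoK S) (2 * n + 1) i s * basis S (nuK S) (2 * n) j s
    = (\<Sum>k\<le>maxT S. x $ k * basis S (tauK S) (4 * n + 1) k s)"
proof -
  obtain c where c: "\<And>s. bspl (rhoK S) (2 * n + 1) i s * bspl (nuK S) (2 * n) j s
    = (\<Sum>k\<le>maxT S. c k * bspl (tauK S) (4 * n + 1) k s)"
    using product_spanned[OF ij] by blast
  have *: "bspl (rhoK S) (2 * n + 1) i s * bspl (nuK S) (2 * n) j s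
    = (\<Sum>k\<le>maxT S. x $ k * bspl (tauK S) (4 * n + 1) k s)" if "s \<in> {intA S..<intB S}" for s
    using C.solves_imp_eq[OF c x[unfolded e_vec_eq] that] c[of s] by (simp add: left_diff_distrib sum_subtractf)
  show ?thesis
  proof (cases "s = intB S")
    case True
    then show ?thesis using product_end[OF ij *] by simp
  next
    case False
    then show ?thesis using *[of s] s by (simp add: basis)
  qed
qed

section \<open>Rational form of the offset\<close>

lemma rho_partition_of_unity:
  assumes "s \<in> {domA S..domB S}"
  shows "(\<Sum>i\<le>maxP S + 1. basis S (rhoK S) (2 * n + 1) i s) = 1"
proof -
  \<comment> \<open>\<open>rhoK S\<close> starts with one knot more than \<open>nuK S\<close>, so
    the knots bounding the partition of unity are found in \<open>nuK S\<close> at indices lowered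
    by one.\<close>
  have e: "rhoK S ! (2 * n + 1) = nuK S ! (2 * n)" "rhoK S ! (maxP S + 2) = nuK S ! Suc (maxP S)"
    using length(2) by (simp_all add: rho nth_append)
  have *: "(\<Sum>i\<le>maxP S + 1. bspl (rhoK S) (2 * n + 1) i x) = 1" if "x \<in> {domA S..<domB S}" for x
    using bspl_partition_of_unity[OF sorted(3), of "maxP S + 2" "2 * n + 1" x] that dom length_rho e
    by (simp add: lessThan_Suc_atMost del: sum.lessThan_Suc sum.atMost_Suc bspl.simps)
  show ?thesis
  proof (cases "s = domB S")
    case True
    let ?F = "at_left (domB S)"
    have "((\<lambda>x. \<Sum>i\<le>maxP S + 1. bspl (rhoK S) (2 * n + 1) i x) \<longlongrightarrow> (\<Sum>i\<le>maxP S + 1. basis S (rhoK S) (2 * n + 1) i s)) ?F"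
      unfolding True by (intro tendsto_sum left_continuous) simp
    moreover have "eventually (\<lambda>x. (\<Sum>i\<le>maxP S + 1. bspl (rhoK S) (2 * n + 1) i x) = 1) ?F"
      using eventually_at_left_real[OF dom(2)] by (rule eventually_mono) (intro *, auto)
    ultimately have "((\<lambda>x. 1) \<longlongrightarrow> (\<Sum>i\<le>maxP S + 1. basis S (rhoK S) (2 * n + 1) i s)) ?F"
      by (rule Lim_transform_eventually)
    then show ?thesis using tendsto_unique[OF trivial_limit_at_left_real _ tendsto_const] by blast
  next
    case False
    then show ?thesis using *[of s] assms dom(3) by (simp add: basis del: sum.atMost_Suc bspl.simps)
  qed
qed

lemma offset:
  assumes \<zeta>: "\<And>i j. i \<le> maxP S + 1 \<Longrightarrow> j \<le> maxP S \<Longrightarrow> solves (C_mat S) (e_vec S i j) (\<zeta> i j)"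
    and s: "s \<in> {domA S..domB S}" and reg: "speed S z s \<noteq> 0"
  shows "(\<Sum>k\<le>maxT S. gamma_coeff S z \<zeta> k * of_real (basis S (tauK S) (4 * n + 1) k s)) \<noteq> 0"
    and "offset_curve S z r0 h s
      = (\<Sum>k\<le>maxT S. q_coeff S z r0 h \<zeta> k * of_real (basis S (tauK S) (4 * n + 1) k s))
        / (\<Sum>k\<le>maxT S. gamma_coeff S z \<zeta> k * of_real (basis S (tauK S) (4 * n + 1) k s))"
proof -
  define R P T where "R i = complex_of_real (basis S (rhoK S) (2 * n + 1) i s)"
    and "P j = complex_of_real (basis S (nuK S) (2 * n) j s)"
    and "T k = complex_of_real (basis S (tauK S) (4 * n + 1) k s)" for i j k
  have si: "s \<in> {intA S..intB S}" using s dom by auto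
  \<comment> \<open>Expands every product \<open>R i * P j\<close> over \<open>tauK S\<close> and
    moves the sum over \<open>k\<close> outside; two choices of \<open>a\<close> evaluate the
    numerator and the denominator.\<close>
  have swap: "(\<Sum>k\<le>maxT S. (\<Sum>i\<le>maxP S + 1. \<Sum>j\<le>maxP S. a i j * of_real (\<zeta> i j $ k)) * T k)
     = (\<Sum>i\<le>maxP S + 1. \<Sum>j\<le>maxP S. a i j * (R i * P j))" for a :: "nat \<Rightarrow> nat \<Rightarrow> complex"
  proof -
    have "(\<Sum>i\<le>maxP S + 1. \<Sum>j\<le>maxP S. a i j * (R i * P j))
      = (\<Sum>i\<le>maxP S + 1. \<Sum>j\<le>maxP S. \<Sum>k\<le>maxT S. a i j * of_real (\<zeta> i j $ k) * T k)"
    proof (intro sum.cong refl)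
      fix i j assume ij: "i \<in> {..maxP S + 1}" "j \<in> {..maxP S}"
      have "R i * P j = of_real (\<Sum>k\<le>maxT S. \<zeta> i j $ k * basis S (tauK S) (4 * n + 1) k s)"
        unfolding R_def P_def of_real_mult[symmetric]
        by (subst product_expansion[OF _ _ \<zeta> si]) (use ij in auto)
      then show "a i j * (R i * P j) = (\<Sum>k\<le>maxT S. a i j * of_real (\<zeta> i j $ k) * T k)"
        by (simp add: T_def sum_distrib_left algebra_simps)
    qed
    also have "\<dots> = (\<Sum>i\<le>maxP S + 1. \<Sum>k\<le>maxT S. \<Sum>j\<le>maxP S. a i j * of_real (\<zeta> i j $ k) * T k)"
      by (intro sum.cong refl sum.swap)
    also have "\<dots> = (\<Sum>k\<le>maxT S. \<Sum>i\<le>maxP S + 1. \<Sum>j\<le>maxP S. a i j * of_real (\<zeta> i j $ k) * T k)"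
      by (rule sum.swap)
    finally show ?thesis by (simp only: sum_distrib_right)
  qed
  define \<sigma> where "\<sigma> = complex_of_real (speed S z s)"
  have \<sigma>: "\<sigma> = (\<Sum>j\<le>maxP S. sigma_coeff S z j * P j)" "\<sigma> \<noteq> 0"
    unfolding \<sigma>_def P_def using z_square(2)[OF s] by (simp add: spline_def) (simp add: reg)
  have p: "(z_curve S z s)\<^sup>2 = (\<Sum>j\<le>maxP S. p_coeff S z j * P j)"
    unfolding P_def using z_square(1)[OF s] by (simp add: spline_def)
  have r: "r_curve S z r0 s = (\<Sum>i\<le>maxP S + 1. r_coeff S z r0 i * R i)"
    unfolding R_def r_curve_def spline_def n(2) ..
  have one: "(\<Sum>i\<le>maxP S + 1. R i) = 1"
    unfolding R_def of_real_sum[symmetric] rho_partition_of_unity[OF s] by simp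
  have g: "(\<Sum>k\<le>maxT S. gamma_coeff S z \<zeta> k * T k) = \<sigma>"
  proof -
    have "(\<Sum>k\<le>maxT S. gamma_coeff S z \<zeta> k * T k) = (\<Sum>i\<le>maxP S + 1. \<Sum>j\<le>maxP S. sigma_coeff S z j * (R i * P j))"
      unfolding gamma_coeff_def by (rule swap)
    also have "\<dots> = (\<Sum>i\<le>maxP S + 1. R i) * (\<Sum>j\<le>maxP S. sigma_coeff S z j * P j)"
      unfolding sum_product by (intro sum.cong refl) (simp only: mult_ac)
    finally show ?thesis unfolding one \<sigma>(1) by simp
  qed
  have q: "(\<Sum>k\<le>maxT S. q_coeff S z r0 h \<zeta> k * T k) = \<sigma> * r_curve S z r0 s - \<i> * of_real h * (z_curve S z s)\<^sup>2"
  proof -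
    have "(\<Sum>k\<le>maxT S. q_coeff S z r0 h \<zeta> k * T k)
      = (\<Sum>i\<le>maxP S + 1. \<Sum>j\<le>maxP S. (sigma_coeff S z j * r_coeff S z r0 i - \<i> * of_real h * p_coeff S z j) * (R i * P j))"
      unfolding q_coeff_def by (rule swap)
    also have "\<dots> = (\<Sum>i\<le>maxP S + 1. \<Sum>j\<le>maxP S. (r_coeff S z r0 i * R i) * (sigma_coeff S z j * P j))
       - (\<Sum>i\<le>maxP S + 1. \<Sum>j\<le>maxP S. R i * (\<i> * of_real h * (p_coeff S z j * P j)))"
      unfolding sum_subtractf[symmetric] by (intro sum.cong refl) (simp add: algebra_simps)
    also have "\<dots> = (\<Sum>i\<le>maxP S + 1. r_coeff S z r0 i * R i) * (\<Sum>j\<le>maxP S. sigma_coeff S z j * P j)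
       - (\<Sum>i\<le>maxP S + 1. R i) * (\<i> * of_real h * (\<Sum>j\<le>maxP S. p_coeff S z j * P j))"
      unfolding sum_distrib_left[of "\<i> * of_real h"] sum_product ..
    finally show ?thesis unfolding one \<sigma>(1) p r by (simp add: mult.commute)
  qed
  have "vector_derivative (r_curve S z r0) (at s within {domA S..domB S}) = (z_curve S z s)\<^sup>2"
    by (rule vector_derivative_within_closed_interval[OF dom(2) s r_has_derivative[OF s]])
  then have off: "offset_curve S z r0 h s = r_curve S z r0 s + of_real h * (- \<i> * (z_curve S z s)\<^sup>2 / \<sigma>)"
    unfolding offset_curve_def normal_vec_def \<sigma>_def by simp
  show "(\<Sum>k\<le>maxT S. gamma_coeff S z \<zeta> k * of_real (basis S (tauK S) (4 * n + 1) k s)) \<noteq> 0"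
    using g \<sigma>(2) unfolding T_def by simp
  show "offset_curve S z r0 h s
      = (\<Sum>k\<le>maxT S. q_coeff S z r0 h \<zeta> k * of_real (basis S (tauK S) (4 * n + 1) k s))
        / (\<Sum>k\<le>maxT S. gamma_coeff S z \<zeta> k * of_real (basis S (tauK S) (4 * n + 1) k s))"
    unfolding off T_def[symmetric] g q using \<sigma>(2) by (simp add: field_simps)
qed

text \<open>Over an interval containing all knots of \<open>tauK S\<close>, with multiplicities at
  most the degree plus one, the B-splines are independent and the Gramian is regular. The moments
  over \<open>{a..b}\<close> are those of \<open>e_vec\<close>, since the factor over
  \<open>nuK S\<close> vanishes outside \<open>{intA S..intB S}\<close>; so the unique solution is
  the coefficient vector of the exact expansion, which also solves the system of
  \<open>C_mat S\<close>.\<close>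

lemma gram_regular:
  assumes ab: "a \<le> intA S" "intB S \<le> b"
    and tau: "\<And>t. t \<in> set (tauK S) \<Longrightarrow> count_list (tauK S) t \<le> 4 * n + 2"
      "\<And>t. t \<in> set (tauK S) \<Longrightarrow> a \<le> t \<and> t \<le> b"
  shows "invertible_mat (gram S (4 * n + 1) (tauK S) (maxT S) a b)"
    and "i \<le> maxP S + 1 \<Longrightarrow> j \<le> maxP S \<Longrightarrow>
      (\<exists>!x. solves (gram S (4 * n + 1) (tauK S) (maxT S) a b) (e_vec S i j) x)
      \<and> (\<forall>x. solves (gram S (4 * n + 1) (tauK S) (maxT S) a b) (e_vec S i j) x
            \<longrightarrow> solves (C_mat S) (e_vec S i j) x)"
proof -
  let ?G = "gram S (4 * n + 1) (tauK S) (maxT S) a b"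
  have len: "length (tauK S) = maxT S + (4 * n + 1) + 2" using length(3) by simp
  interpret G: gramian "bspl (tauK S) (4 * n + 1)" "maxT S" a b ?G
    "\<lambda>f. vec (maxT S + 1) (\<lambda>l. integral {a..b} (\<lambda>s. f s * bspl (tauK S) (4 * n + 1) l s))"
    unfolding gram_eq using sorted(4) len by (rule bspl_gramian)
  have indep: "c k = 0"
    if "\<And>s. s \<in> {a..<b} \<Longrightarrow> (\<Sum>k\<le>maxT S. c k * bspl (tauK S) (4 * n + 1) k s) = 0" "k \<le> maxT S" for c k
    by (rule bspl_independent_all[OF sorted(4) len _ tau(2) that]) (use tau(1) in auto)
  show "invertible_mat ?G" by (rule G.independent_invertible(1)) (rule indep)
  assume ij: "i \<le> maxP S + 1" "j \<le> maxP S"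
  let ?f = "\<lambda>s. bspl (rhoK S) (2 * n + 1) i s * bspl (nuK S) (2 * n) j s"
  obtain c where c: "\<And>s. ?f s = (\<Sum>k\<le>maxT S. c k * bspl (tauK S) (4 * n + 1) k s)"
    using product_spanned[OF ij] by blast
  have zero: "?f s = 0" if "s \<notin> {intA S..intB S}" for s
  proof -
    have "intA S \<le> nuK S ! j" "nuK S ! (j + 2 * n + 1) \<le> intB S"
      using nu_bounds ij length(2) by (auto intro: nth_mem)
    then have "bspl (nuK S) (2 * n) j s = 0"
      using that ij length(2) by (intro bspl_support[OF sorted(2)]) auto
    then show ?thesis by simp
  qed
  have "integral {intA S..intB S} (\<lambda>s. ?f s * bspl (tauK S) (4 * n + 1) l s)
      = integral {a..b} (\<lambda>s. ?f s * bspl (tauK S) (4 * n + 1) l s)" for l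
  proof (rule integral_spike_set)
    have *: "{x \<in> {intA S..intB S} - {a..b}. ?f x * bspl (tauK S) (4 * n + 1) l x \<noteq> 0} = {}"
      "{x \<in> {a..b} - {intA S..intB S}. ?f x * bspl (tauK S) (4 * n + 1) l x \<noteq> 0} = {}"
      using zero ab by auto
    show "negligible {x \<in> {intA S..intB S} - {a..b}. ?f x * bspl (tauK S) (4 * n + 1) l x \<noteq> 0}"
      unfolding *(1) by simp
    show "negligible {x \<in> {a..b} - {intA S..intB S}. ?f x * bspl (tauK S) (4 * n + 1) l x \<noteq> 0}"
      unfolding *(2) by simp
  qed
  then have e: "e_vec S i j
      = vec (maxT S + 1) (\<lambda>l. integral {a..b} (\<lambda>s. ?f s * bspl (tauK S) (4 * n + 1) l s))"
    unfolding e_vec_eq by simp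
  have sol: "solves ?G (e_vec S i j) (vec (maxT S + 1) c)"
    unfolding e by (rule G.solves_spanned) (rule c)
  have uniq: "x = vec (maxT S + 1) c" if "solves ?G (e_vec S i j) x" for x
    using _ that sol by (rule G.independent_invertible(2)) (rule indep)
  have "solves (C_mat S) (e_vec S i j) (vec (maxT S + 1) c)"
    unfolding e_vec_eq by (rule C.solves_spanned) (rule c)
  then show "(\<exists>!x. solves ?G (e_vec S i j) x)
      \<and> (\<forall>x. solves ?G (e_vec S i j) x \<longrightarrow> solves (C_mat S) (e_vec S i j) x)"
    using sol uniq by blast
qed

end

section \<open>Knot sequences with repetitions\<close>

lemma mult_knots_Cons: "l \<le> u \<Longrightarrow> mult_knots k t l u = replicate k (t l) @ mult_knots k t (l + 1) u"
  by (simp add: mult_knots_def upto_rec1)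

lemma mult_knots_empty: "u < l \<Longrightarrow> mult_knots k t l u = []"
  by (simp add: mult_knots_def)

lemma length_mult_knots: "length (mult_knots k t l u) = k * nat (u - l + 1)"
  by (simp add: mult_knots_def length_concat comp_def sum_list_triv)

lemma set_mult_knots: "0 < k \<Longrightarrow> set (mult_knots k t l u) = t ` {l..u}"
  by (auto simp: mult_knots_def)

lemma count_list_replicate: "count_list (replicate k a) x = (if x = a then k else 0)"
  by (induction k) auto

lemma count_mult_knots:
  "inj_on t {l..u} \<Longrightarrow> count_list (mult_knots k t l u) x = (if x \<in> t ` {l..u} then k else 0)"
proof (induction "nat (u - l + 1)" arbitrary: l)
  case 0
  then show ?case by (simp add: mult_knots_empty)
next
  case (Suc m)
  have l: "l \<le> u" and s: "{l..u} = insert l {l + 1..u}" using Suc.hyps(2) by auto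
  have "count_list (mult_knots k t (l + 1) u) x = (if x \<in> t ` {l + 1..u} then k else 0)"
    using Suc.hyps Suc.prems s by (intro Suc.hyps(1)) (auto intro: inj_on_subset)
  moreover have "t l \<notin> t ` {l + 1..u}" using Suc.prems unfolding s by auto
  ultimately show ?case by (auto simp: mult_knots_Cons[OF l] count_list_replicate s)
qed

lemma nth_mult_knots:
  "0 < k \<Longrightarrow> i < k * nat (u - l + 1) \<Longrightarrow> mult_knots k t l u ! i = t (l + int (i div k))"
proof (induction "nat (u - l + 1)" arbitrary: l i)
  case 0
  then show ?case by simp
next
  case (Suc m)
  have l: "l \<le> u" using Suc.hyps(2) by auto
  show ?case
  proof (cases "i < k")
    case True
    then show ?thesis by (simp add: mult_knots_Cons[OF l] nth_append)
  next
    case False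
    have m: "m = nat (u - (l + 1) + 1)" using Suc.hyps(2) by auto
    have "i < k * Suc m" using Suc.prems(2) Suc.hyps(2) by simp
    then have "mult_knots k t (l + 1) u ! (i - k) = t (l + 1 + int ((i - k) div k))"
      using False Suc.prems(1) m by (intro Suc.hyps(1)) auto
    moreover have "i div k = Suc ((i - k) div k)" using False Suc.prems(1) by (simp add: le_div_geq)
    ultimately show ?thesis using False by (simp add: mult_knots_Cons[OF l] nth_append add.assoc)
  qed
qed

lemma sorted_mult_knots:
  assumes "\<And>i j. l \<le> i \<Longrightarrow> i \<le> j \<Longrightarrow> j \<le> u \<Longrightarrow> t i \<le> t j"
  shows "sorted (mult_knots k t l u)"
  using assms
proof (induction "nat (u - l + 1)" arbitrary: l)
  case 0
  then show ?case by (simp add: mult_knots_empty)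
next
  case (Suc m)
  have l: "l \<le> u" using Suc.hyps(2) by auto
  have "sorted (mult_knots k t (l + 1) u)"
    using Suc.hyps(2) Suc.prems by (intro Suc.hyps(1)) auto
  moreover have "t l \<le> x" if "x \<in> set (mult_knots k t (l + 1) u)" for x
    using that Suc.prems[of l] by (auto simp: mult_knots_def)
  ultimately show ?case by (auto simp: mult_knots_Cons[OF l] sorted_append)
qed

lemma sorted_knots:
  assumes "\<And>i j. l - 1 \<le> i \<Longrightarrow> i \<le> j \<Longrightarrow> j \<le> u + 1 \<Longrightarrow> t i \<le> t j" "l \<le> u + 1"
  shows "sorted (knots e k t l u)"
proof -
  have "sorted (mult_knots k t l u)" by (rule sorted_mult_knots) (use assms in auto)
  then show ?thesis
    using assms by (auto simp: knots_def sorted_append mult_knots_def)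
qed

lemma length_knots: "length (knots e k t l u) = 2 * e + k * nat (u - l + 1)"
  by (simp add: knots_def length_mult_knots)

lemma set_knots:
  "0 < k \<Longrightarrow> set (knots e k t l u) = (if e = 0 then {} else {t (l - 1), t (u + 1)}) \<union> t ` {l..u}"
  by (auto simp: knots_def set_mult_knots)

lemma count_knots:
  "inj_on t {l..u} \<Longrightarrow> count_list (knots e k t l u) x
    = (if x = t (l - 1) then e else 0) + (if x \<in> t ` {l..u} then k else 0) + (if x = t (u + 1) then e else 0)"
  by (simp add: knots_def count_mult_knots count_list_replicate)

lemma strict_mono_int_interval:
  fixes t :: "int \<Rightarrow> real"
  assumes "\<And>k. k \<in> {a..<b} \<Longrightarrow> t k < t (k + 1)" "a \<le> i" "i < j" "j \<le> b"
  shows "t i < t j"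
  using assms(3,4)
proof (induction j rule: int_gr_induct)
  case base
  then show ?case using assms by auto
next
  case (step k)
  then have "t i < t k" "t k < t (k + 1)" using assms by auto
  then show ?case by simp
qed

section \<open>The two settings\<close>

text \<open>Serves \<open>product_end\<close>: where the basis values at \<open>b\<close> are left
  limits of the B-splines, an identity on \<open>{a..<b}\<close> extends to
  \<open>b\<close>.\<close>

lemma left_limit_product:
  fixes f g :: "real \<Rightarrow> real"
  assumes "a < b" "(f \<longlongrightarrow> f0) (at_left b)" "(g \<longlongrightarrow> g0) (at_left b)"
    "\<And>k. k \<le> N \<Longrightarrow> (\<phi> k \<longlongrightarrow> \<phi>0 k) (at_left b)"
    "\<And>s. s \<in> {a..<b} \<Longrightarrow> f s * g s = (\<Sum>k\<le>N. c k * \<phi> k s)"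
  shows "f0 * g0 = (\<Sum>k\<le>N. c k * \<phi>0 k)"
proof -
  have "((\<lambda>s. f s * g s) \<longlongrightarrow> f0 * g0) (at_left b)" by (intro tendsto_mult assms)
  moreover have "eventually (\<lambda>s. f s * g s = (\<Sum>k\<le>N. c k * \<phi> k s)) (at_left b)"
    using eventually_at_left_real[OF assms(1)] by (rule eventually_mono) (intro assms(5), auto)
  ultimately have "((\<lambda>s. \<Sum>k\<le>N. c k * \<phi> k s) \<longlongrightarrow> f0 * g0) (at_left b)" by (rule Lim_transform_eventually)
  moreover have "((\<lambda>s. \<Sum>k\<le>N. c k * \<phi> k s) \<longlongrightarrow> (\<Sum>k\<le>N. c k * \<phi>0 k)) (at_left b)"
    by (intro tendsto_sum tendsto_mult tendsto_const assms) simp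
  ultimately show ?thesis by (rule tendsto_unique[OF trivial_limit_at_left_real])
qed

text \<open>At both end knots each of the four sequences has multiplicity degree plus one, so all
  orders of vanishing are \<open>0\<close> there; at the inner knots the multiplicities are those of
  the general setting.\<close>

lemma clamped_ph_setting:
  assumes n: "1 \<le> n" "n \<le> m" and t: "\<And>i. i \<in> {int n..int m} \<Longrightarrow> t i < t (i + 1)"
  shows "ph_setting (clamped_setting n m t) n (t (int n)) (t (int m + 1))"
    and "x \<in> set (tauK (clamped_setting n m t)) \<Longrightarrow> count_list (tauK (clamped_setting n m t)) x \<le> 4 * n + 2"
    and "x \<in> set (tauK (clamped_setting n m t)) \<Longrightarrow> t (int n) \<le> x \<and> x \<le> t (int m + 1)"
proof -
  let ?S = "clamped_setting n m t"
  have lt: "t i < t j" if "int n \<le> i" "i < j" "j \<le> int m + 1" for i j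
    by (rule strict_mono_int_interval[of "int n" "int m + 1"]) (use t that in auto)
  have le: "t i \<le> t j" if "int n \<le> i" "i \<le> j" "j \<le> int m + 1" for i j
    using lt[of i j] that by (cases "i = j") auto
  have inj: "inj_on t {int n + 1..int m}"
  proof (rule linorder_inj_onI')
    show "t i \<noteq> t j" if "i \<in> {int n + 1..int m}" "j \<in> {int n + 1..int m}" "i < j" for i j
      using lt[of i j] that by auto
  qed
  have ab: "t (int n) < t (int m + 1)" using lt n by simp
  have srt: "sorted (knots e k t (int n + 1) (int m))" for e k
    using n le by (intro sorted_knots) auto
  have len: "length (knots e k t (int n + 1) (int m)) = 2 * e + k * (m - n)" for e k
    using n by (simp add: length_knots nat_diff_distrib)
  have mid: "t (int n) < x \<and> x < t (int m + 1)" if "x \<in> t ` {int n + 1..int m}" for x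
    using that lt by auto
  have cnt: "count_list (knots e k t (int n + 1) (int m)) x = (if x = t (int n) then e else 0)
      + (if x \<in> t ` {int n + 1..int m} then k else 0) + (if x = t (int m + 1) then e else 0)" for e k x
    using count_knots[OF inj, of e k x] by simp
  have st: "set (knots e k t (int n + 1) (int m)) = insert (t (int n)) (insert (t (int m + 1)) (t ` {int n + 1..int m}))"
    if "0 < e" "0 < k" for e k
    using that by (simp add: set_knots)
  show "count_list (tauK ?S) x \<le> 4 * n + 2" if "x \<in> set (tauK ?S)"
    using mid[of x] ab by (auto simp: clamped_setting_def cnt)
  show "t (int n) \<le> x \<and> x \<le> t (int m + 1)" if "x \<in> set (tauK ?S)"
    using mid[of x] ab that by (auto simp: clamped_setting_def st)
  show "ph_setting ?S n (t (int n)) (t (int m + 1))"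
  proof
    show "1 \<le> n" "deg ?S = n" using n by (simp_all add: clamped_setting_def)
    show "sorted (muK ?S)" "sorted (nuK ?S)" "sorted (rhoK ?S)" "sorted (tauK ?S)"
      by (simp_all add: clamped_setting_def srt)
    show "length (muK ?S) = maxZ ?S + n + 2" "length (nuK ?S) = maxP ?S + 2 * n + 2"
      "length (tauK ?S) = maxT ?S + 4 * n + 3"
      using n by (simp_all add: clamped_setting_def len mult.commute[of "m - n"])
    show "basis ?S \<kappa> d k x = bspl \<kappa> d k x" if "x \<noteq> intB ?S" for \<kappa> d k x
      using that by (simp add: clamped_setting_def bspl_cl_eq)
    show "rhoK ?S = t (int n) # nuK ?S @ [t (int m + 1)]"
      by (simp add: clamped_setting_def knots_def replicate_append_same)
    show "intA ?S \<le> x \<and> x \<le> intB ?S" if "x \<in> set (nuK ?S)" for x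
      using mid[of x] ab that by (auto simp: clamped_setting_def st)
    show "count_list (nuK ?S) x \<le> 2 * n + 1" for x
      using mid[of x] ab by (auto simp: clamped_setting_def cnt)
    show "set (muK ?S) \<subseteq> set (nuK ?S)" "set (rhoK ?S) \<subseteq> set (tauK ?S)"
      by (simp_all add: clamped_setting_def st)
    show "2 * n + 1 - count_list (nuK ?S) x \<le> n + 1 - count_list (muK ?S) x" if "x \<in> set (muK ?S)" for x
      using mid[of x] ab that by (auto simp: clamped_setting_def cnt st)
    show "4 * n + 2 - count_list (tauK ?S) x \<le> 2 * n + 2 - count_list (rhoK ?S) x" if "x \<in> set (rhoK ?S)" for x
      using mid[of x] ab that by (auto simp: clamped_setting_def cnt st)
    show "4 * n + 2 - count_list (tauK ?S) x \<le> 2 * n + 1 - count_list (nuK ?S) x" if "x \<in> set (nuK ?S)" for x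
      using mid[of x] ab that by (auto simp: clamped_setting_def cnt st)
    show "intA ?S \<le> domA ?S" "domA ?S < domB ?S" "domB ?S \<le> intB ?S"
      using ab by (simp_all add: clamped_setting_def)
    have "(replicate (2 * n + 1) x @ ys) ! (2 * n) = x" for x :: real and ys
      by (simp add: nth_append del: replicate.simps)
    then show "nuK ?S ! (2 * n) \<le> domA ?S"
      unfolding clamped_setting_def knots_def by simp
    have "nat (int m - int n) = m - n" by simp
    then show "domB ?S \<le> nuK ?S ! Suc (maxP ?S)"
      using n by (simp add: clamped_setting_def knots_def nth_append length_mult_knots nat_diff_distrib)
    have lim: "(bspl \<kappa> d k \<longlongrightarrow> basis ?S \<kappa> d k (t (int m + 1))) (at_left (t (int m + 1)))"
      if "sorted \<kappa>" "k + d + 1 < length \<kappa>" for \<kappa> d k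
      using bspl_cl_left_limit[OF that] by (simp add: clamped_setting_def)
    show "(bspl (muK ?S) n k \<longlongrightarrow> basis ?S (muK ?S) n k (domB ?S)) (at_left (domB ?S))" if "k \<le> maxZ ?S" for k
      using lim[of "muK ?S" k n] that n by (simp add: clamped_setting_def srt len)
    show "(bspl (nuK ?S) (2 * n) k \<longlongrightarrow> basis ?S (nuK ?S) (2 * n) k (domB ?S)) (at_left (domB ?S))"
      if "k \<le> maxP ?S" for k
      using lim[of "nuK ?S" k "2 * n"] that n by (simp add: clamped_setting_def srt len)
    show "(bspl (rhoK ?S) (2 * n + 1) k \<longlongrightarrow> basis ?S (rhoK ?S) (2 * n + 1) k (domB ?S)) (at_left (domB ?S))"
      if "k \<le> maxP ?S + 1" for k
      using lim[of "rhoK ?S" k "2 * n + 1"] that n by (simp add: clamped_setting_def srt len)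
    show "count_list (muK ?S) x \<le> n" "count_list (rhoK ?S) x \<le> 2 * n + 1" if "domA ?S < x" "x < domB ?S" for x
      using that n by (simp_all add: clamped_setting_def cnt)
    show "basis ?S (rhoK ?S) (2 * n + 1) i (intB ?S) * basis ?S (nuK ?S) (2 * n) j (intB ?S)
        = (\<Sum>k\<le>maxT ?S. c k * basis ?S (tauK ?S) (4 * n + 1) k (intB ?S))"
      if ij: "i \<le> maxP ?S + 1" "j \<le> maxP ?S"
        and eq: "\<And>s. s \<in> {intA ?S..<intB ?S} \<Longrightarrow> bspl (rhoK ?S) (2 * n + 1) i s * bspl (nuK ?S) (2 * n) j s
          = (\<Sum>k\<le>maxT ?S. c k * bspl (tauK ?S) (4 * n + 1) k s)" for i j c
    proof (rule left_limit_product[OF _ _ _ _ eq])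
      show "intA ?S < intB ?S" using ab by (simp add: clamped_setting_def)
      show "(bspl (rhoK ?S) (2 * n + 1) i \<longlongrightarrow> basis ?S (rhoK ?S) (2 * n + 1) i (intB ?S)) (at_left (intB ?S))"
        using lim[of "rhoK ?S" i "2 * n + 1"] ij n by (simp add: clamped_setting_def srt len)
      show "(bspl (nuK ?S) (2 * n) j \<longlongrightarrow> basis ?S (nuK ?S) (2 * n) j (intB ?S)) (at_left (intB ?S))"
        using lim[of "nuK ?S" j "2 * n"] ij n by (simp add: clamped_setting_def srt len)
      show "(bspl (tauK ?S) (4 * n + 1) k \<longlongrightarrow> basis ?S (tauK ?S) (4 * n + 1) k (intB ?S)) (at_left (intB ?S))"
        if "k \<le> maxT ?S" for k
        using lim[of "tauK ?S" k "4 * n + 1"] that n by (simp add: clamped_setting_def srt len mult.commute[of "m - n"])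
    qed
  qed
qed

text \<open>An outer knot may coincide with \<open>t 0\<close> or
  \<open>t (int p + int n + 1)\<close>. The multiplicities then add up: the order demanded over
  \<open>tauK\<close> drops to \<open>0\<close>, but some B-splines over \<open>tauK\<close>
  degenerate, hence the strict inequalities before the multiplicity bound.\<close>

lemma general_ph_setting:
  assumes n: "1 \<le> n" "n \<le> p"
    and t: "t (- 1) \<le> t 0" "\<And>i. i \<in> {0..int p + int n} \<Longrightarrow> t i < t (i + 1)"
      "t (int p + int n + 1) \<le> t (int p + int n + 2)"
  shows "ph_setting (general_setting n p t) n (t (- 1)) (t (int p + int n + 2))"
    and "t (- 1) < t 0 \<Longrightarrow> t (int p + int n + 1) < t (int p + int n + 2) \<Longrightarrow>
      count_list (tauK (general_setting n p t)) x \<le> 4 * n + 2"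
    and "x \<in> set (tauK (general_setting n p t)) \<Longrightarrow> t (- 1) \<le> x \<and> x \<le> t (int p + int n + 2)"
proof -
  let ?S = "general_setting n p t"
  define u where "u = int p + int n + 1"
  have u: "int p + int n + 1 = u" "int p + int n + 2 = u + 1" "0 < u" "int p + 1 < u" "int n < u"
    using n by (simp_all add: u_def)
  have un: "nat (u + 1) = p + n + 2" by (simp add: u_def)
  have tt: "t (- 1) \<le> t 0" "t u \<le> t (u + 1)" using t by (simp_all add: u_def algebra_simps)
  have lt: "t i < t j" if "0 \<le> i" "i < j" "j \<le> u" for i j
    by (rule strict_mono_int_interval[of 0 u]) (use t(2) that in \<open>auto simp: u_def\<close>)
  have le: "t i \<le> t j" if "0 \<le> i" "i \<le> j" "j \<le> u" for i j
    using lt[of i j] that by (cases "i = j") auto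
  have le': "t i \<le> t j" if "0 - 1 \<le> i" "i \<le> j" "j \<le> u + 1" for i j
  proof -
    show ?thesis
    proof (cases "i = j")
      case False
      have "t i \<le> t (max 0 i)" using that tt by (cases "i = - 1") auto
      also have "\<dots> \<le> t (min j u)" using that False u(3) by (intro le) auto
      also have "\<dots> \<le> t j" using that tt by (cases "j = u + 1") auto
      finally show ?thesis .
    qed simp
  qed
  have inj: "inj_on t {0..u}"
  proof (rule linorder_inj_onI')
    show "t i \<noteq> t j" if "i \<in> {0..u}" "j \<in> {0..u}" "i < j" for i j
      using lt[of i j] that by auto
  qed
  have ab: "t 0 < t u" using lt u by simp
  have srt: "sorted (knots e k t 0 u)" for e k
    using u le' by (intro sorted_knots) auto
  have len: "length (knots e k t 0 u) = 2 * e + k * (p + n + 2)" for e k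
    by (simp add: length_knots un)
  have mid: "t 0 \<le> x \<and> x \<le> t u" if "x \<in> t ` {0..u}" for x
    using that le by auto
  have cnt: "count_list (knots e k t 0 u) x = (if x = t (- 1) then e else 0)
      + (if x \<in> t ` {0..u} then k else 0) + (if x = t (u + 1) then e else 0)" for e k x
    using count_knots[OF inj, of e k x] by simp
  have st: "set (knots e k t 0 u) = insert (t (- 1)) (insert (t (u + 1)) (t ` {0..u}))"
    if "0 < e" "0 < k" for e k
    using that by (simp add: set_knots)
  have st0: "set (knots 0 k t 0 u) = t ` {0..u}" if "0 < k" for k
    using that by (simp add: set_knots)
  note S = general_setting_def u(1,2)
  show "count_list (tauK ?S) x \<le> 4 * n + 2" if "t (- 1) < t 0" "t (int p + int n + 1) < t (int p + int n + 2)"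
    using mid[of x] ab that n unfolding S by (auto simp: cnt)
  show "t (- 1) \<le> x \<and> x \<le> t (int p + int n + 2)" if "x \<in> set (tauK ?S)"
    using mid[of x] ab that tt unfolding S by (auto simp: st)
  have inner: "count_list (knots e k t 0 u) x \<le> k" if "t 0 < x" "x < t u" for e k x
    using that tt by (auto simp: cnt)
  have dom: "t 0 < t (int n)" "t (int n) < t (int p + 1)" "t (int p + 1) < t u"
    using n u by (auto intro!: lt)
  show "ph_setting ?S n (t (- 1)) (t (int p + int n + 2))"
  proof
    show "1 \<le> n" "deg ?S = n" using n by (simp_all add: general_setting_def)
    show "sorted (muK ?S)" "sorted (nuK ?S)" "sorted (rhoK ?S)" "sorted (tauK ?S)"
      unfolding S by (simp_all add: srt)
    show "length (muK ?S) = maxZ ?S + n + 2" "length (nuK ?S) = maxP ?S + 2 * n + 2"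
      "length (tauK ?S) = maxT ?S + 4 * n + 3"
      unfolding S by (simp_all add: len algebra_simps)
    show "basis ?S \<kappa> d k x = bspl \<kappa> d k x" for \<kappa> d k x
      by (simp add: general_setting_def)
    show "rhoK ?S = t (- 1) # nuK ?S @ [t (int p + int n + 2)]"
      unfolding S by (simp add: knots_def)
    show "intA ?S \<le> x \<and> x \<le> intB ?S" if "x \<in> set (nuK ?S)" for x
      using mid[of x] that unfolding S by (auto simp: st0)
    show "count_list (nuK ?S) x \<le> 2 * n + 1" for x
      unfolding S by (auto simp: cnt)
    show "set (muK ?S) \<subseteq> set (nuK ?S)" "set (rhoK ?S) \<subseteq> set (tauK ?S)"
      unfolding S by (simp_all add: st st0)
    show "2 * n + 1 - count_list (nuK ?S) x \<le> n + 1 - count_list (muK ?S) x" if "x \<in> set (muK ?S)" for x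
      using that unfolding S by (auto simp: cnt st0)
    show "4 * n + 2 - count_list (tauK ?S) x \<le> 2 * n + 2 - count_list (rhoK ?S) x" if "x \<in> set (rhoK ?S)" for x
      using that unfolding S by (auto simp: cnt st)
    show "4 * n + 2 - count_list (tauK ?S) x \<le> 2 * n + 1 - count_list (nuK ?S) x" if "x \<in> set (nuK ?S)" for x
      using that unfolding S by (auto simp: cnt st0)
    show "intA ?S \<le> domA ?S" "domA ?S < domB ?S" "domB ?S \<le> intB ?S"
      using dom unfolding S by simp_all
    show "nuK ?S ! (2 * n) \<le> domA ?S"
    proof -
      \<comment> \<open>Knot \<open>2 * n\<close> lies in block \<open>2 * n div (n + 1)\<close>,
        thus equals \<open>t 0\<close> or \<open>t 1\<close>, and \<open>t 1 \<le> t (int n)\<close>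
        because \<open>1 \<le> n\<close>.\<close>
      have "2 * n div (n + 1) < 2" by (rule less_mult_imp_div_less) simp
      then have "t (int (2 * n div (n + 1))) \<le> t (int n)" using n u by (intro le) auto
      moreover have "nuK ?S ! (2 * n) = t (0 + int (2 * n div (n + 1)))"
        unfolding S by (simp add: knots_def, subst nth_mult_knots) (simp_all add: un)
      ultimately show ?thesis unfolding S by simp
    qed
    show "domB ?S \<le> nuK ?S ! Suc (maxP ?S)"
    proof -
      \<comment> \<open>\<open>Suc (maxP ?S)\<close> is the second index in the block of
        \<open>t (int (p + n))\<close>; blocks have length \<open>n + 1\<close>, which is at least
        \<open>2\<close>.\<close>
      have "Suc ((n + 1) * (p + n)) div (n + 1) = p + n"
        using n by (intro div_nat_eqI) (auto simp: algebra_simps)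
      moreover have "Suc ((n + 1) * (p + n)) < (n + 1) * nat (u - 0 + 1)"
      proof -
        have "nat (u - 0 + 1) = p + n + 2" using un by simp
        then show ?thesis by (simp only:) (simp add: algebra_simps)
      qed
      from nth_mult_knots[OF _ this, of t]
      have "nuK ?S ! Suc (maxP ?S) = t (0 + int (Suc ((n + 1) * (p + n)) div (n + 1)))"
        unfolding S knots_def by simp
      moreover have "t (int p + 1) \<le> t (int (p + n))" using n u by (intro le) (auto simp: u_def)
      ultimately show ?thesis unfolding S by simp
    qed
    show "(bspl (muK ?S) n k \<longlongrightarrow> basis ?S (muK ?S) n k (domB ?S)) (at_left (domB ?S))" if "k \<le> maxZ ?S" for k
      using that n dom inner[of "t (int p + 1)"] order_trans[OF inner[of "t (int p + 1)"]]
      unfolding S by (simp, intro bspl_left_continuous srt) (simp_all add: len)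
    show "(bspl (nuK ?S) (2 * n) k \<longlongrightarrow> basis ?S (nuK ?S) (2 * n) k (domB ?S)) (at_left (domB ?S))"
      if "k \<le> maxP ?S" for k
      using that n dom order_trans[OF inner[of "t (int p + 1)"]]
      unfolding S by (simp, intro bspl_left_continuous srt) (simp_all add: len algebra_simps)
    show "(bspl (rhoK ?S) (2 * n + 1) k \<longlongrightarrow> basis ?S (rhoK ?S) (2 * n + 1) k (domB ?S)) (at_left (domB ?S))"
      if "k \<le> maxP ?S + 1" for k
      using that n dom order_trans[OF inner[of "t (int p + 1)"]]
      unfolding S by (simp, intro bspl_left_continuous srt) (simp_all add: len algebra_simps)
    show "count_list (muK ?S) x \<le> n" if "domA ?S < x" "x < domB ?S" for x
      using that dom n inner[of x 0 1] unfolding S by simp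
    show "count_list (rhoK ?S) x \<le> 2 * n + 1" if "domA ?S < x" "x < domB ?S" for x
      using that dom n inner[of x 1 "n + 1"] unfolding S by simp
    show "basis ?S (rhoK ?S) (2 * n + 1) i (intB ?S) * basis ?S (nuK ?S) (2 * n) j (intB ?S)
        = (\<Sum>k\<le>maxT ?S. c k * basis ?S (tauK ?S) (4 * n + 1) k (intB ?S))"
      if ij: "i \<le> maxP ?S + 1" "j \<le> maxP ?S"
        and eq: "\<And>s. s \<in> {intA ?S..<intB ?S} \<Longrightarrow> bspl (rhoK ?S) (2 * n + 1) i s * bspl (nuK ?S) (2 * n) j s
          = (\<Sum>k\<le>maxT ?S. c k * bspl (tauK ?S) (4 * n + 1) k s)" for i j c
    \<comment> \<open>If the outer knot coincides with \<open>t u\<close>, the B-splines over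
      \<open>nuK\<close> and \<open>tauK\<close> vanish at \<open>t u\<close>, their last knot.
      Otherwise \<open>t u\<close> has the multiplicities \<open>n + 1\<close>, \<open>n + 1\<close>
      and \<open>3 * n + 2\<close> in \<open>rhoK\<close>, \<open>nuK\<close> and
      \<open>tauK\<close>, at most the degrees \<open>2 * n + 1\<close>, \<open>2 * n\<close> and
      \<open>4 * n + 1\<close> because \<open>1 \<le> n\<close>, and the values at
      \<open>t u\<close> are left limits.\<close>
    proof (cases "t u = t (u + 1)")
      case True
      have zero: "bspl \<kappa> d k (t u) = 0"
        if "sorted \<kappa>" "k + d + 1 < length \<kappa>" "\<And>x. x \<in> set \<kappa> \<Longrightarrow> x \<le> t u" for \<kappa> d k
        using that by (intro bspl_support) auto
      have "bspl (nuK ?S) (2 * n) j (t u) = 0"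
        using ij mid unfolding S by (intro zero) (auto simp: srt len st0 algebra_simps)
      moreover have "bspl (tauK ?S) (4 * n + 1) k (t u) = 0" if "k \<le> maxT ?S" for k
        using that mid True tt ab unfolding S by (intro zero) (auto simp: srt len st algebra_simps)
      ultimately show ?thesis unfolding S by simp
    next
      case False
      have c: "count_list (knots e k t 0 u) (t u) \<le> k" for e k
        using False tt ab by (simp add: cnt)
      show ?thesis
      proof (rule left_limit_product[OF _ _ _ _ eq])
        show "intA ?S < intB ?S" using ab unfolding S by simp
        show "(bspl (rhoK ?S) (2 * n + 1) i \<longlongrightarrow> basis ?S (rhoK ?S) (2 * n + 1) i (intB ?S)) (at_left (intB ?S))"
          using ij n order_trans[OF c] unfolding S by (simp, intro bspl_left_continuous srt) (simp_all add: len algebra_simps)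
        show "(bspl (nuK ?S) (2 * n) j \<longlongrightarrow> basis ?S (nuK ?S) (2 * n) j (intB ?S)) (at_left (intB ?S))"
          using ij n order_trans[OF c] unfolding S by (simp, intro bspl_left_continuous srt) (simp_all add: len algebra_simps)
        show "(bspl (tauK ?S) (4 * n + 1) k \<longlongrightarrow> basis ?S (tauK ?S) (4 * n + 1) k (intB ?S)) (at_left (intB ?S))"
          if "k \<le> maxT ?S" for k
          using that n order_trans[OF c] unfolding S by (simp, intro bspl_left_continuous srt) (simp_all add: len algebra_simps)
      qed
    qed
  qed
qed

text \<open>The hypothesis on the setting is a disjunction: under an assumption such as
  \<open>S = clamped_setting n p t\<close>, the matching knot conditions follow once the other
  disjunct is excluded. The values of \<open>maxP\<close> differ by
  \<open>2 * n * n\<close>.\<close>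

lemma general_neq_clamped: "1 \<le> n \<Longrightarrow> n \<le> p \<Longrightarrow> general_setting n p t \<noteq> clamped_setting n p t"
proof
  assume n: "1 \<le> n" "n \<le> p" and "general_setting n p t = clamped_setting n p t"
  then have "maxP (general_setting n p t) = maxP (clamped_setting n p t)" by simp
  then have "(n + 1) * (p + n) = 2 * n + (n + 1) * (p - n)" by (simp add: general_setting_def clamped_setting_def)
  moreover have "(n + 1) * (p + n) = (n + 1) * (p - n) + (n + 1) * (2 * n)"
    using n by (simp flip: add_mult_distrib2)
  ultimately show False using n by simp
qed

text \<open>The singularity of \<open>C_mat S\<close> in the general setting dictates the form:
  existence is separated from uniqueness, uniqueness is stated for the entries whose B-splines are
  nonzero inside the interval, and the expansions are claimed for every family
  \<open>\<zeta>\<close> of solutions. Full uniqueness is left to the clamped setting and to the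
  Gramian over the whole span of \<open>tauK S\<close>. The closed case is the general setting with
  \<open>p = m + n\<close>.\<close>

theorem mainTheorem6:
  fixes n p :: nat and t :: "int \<Rightarrow> real" and S :: bs_setting
    and z :: "nat \<Rightarrow> complex" and r0 :: complex and h :: real
  assumes degree: "1 \<le> n" "n \<le> p"
    and setting:
      "S = general_setting n p t \<and> t (-1) \<le> t 0
         \<and> (\<forall>i\<in>{0..int p + int n}. t i < t (i + 1))
         \<and> t (int p + int n + 1) \<le> t (int p + int n + 2)
       \<or> S = clamped_setting n p t \<and> (\<forall>i\<in>{int n..int p}. t i < t (i + 1))"
    and regular: "\<forall>s\<in>{domA S..domB S}. speed S z s \<noteq> 0"
  shows
    "invertible_mat (A_mat S)
     \<and> (\<forall>s\<in>{domA S..domB S}.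
          (r_curve S z r0 has_vector_derivative (z_curve S z s)\<^sup>2) (at s within {domA S..domB S})
          \<and> (z_curve S z s)\<^sup>2 = spline S (2 * n) (nuK S) (maxP S) (p_coeff S z) s
          \<and> of_real (speed S z s) = spline S (2 * n) (nuK S) (maxP S) (sigma_coeff S z) s)
     \<and> (\<forall>k\<le>maxT S. \<forall>l\<le>maxT S. 4 * n + 1 < nat \<bar>int k - int l\<bar> \<longrightarrow> C_mat S $$ (k, l) = 0)
     \<and> (\<forall>i\<le>maxP S + 1. \<forall>j\<le>maxP S.
          (\<exists>x. solves (C_mat S) (e_vec S i j) x)
          \<and> (\<forall>x y. solves (C_mat S) (e_vec S i j) x \<longrightarrow> solves (C_mat S) (e_vec S i j) y \<longrightarrow>
               (\<forall>k\<le>maxT S. (\<exists>s\<in>{intA S<..<intB S}. basis S (tauK S) (4 * n + 1) k s \<noteq> 0) \<longrightarrow>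
                  x $ k = y $ k)))
     \<and> (S = clamped_setting n p t \<longrightarrow>
          invertible_mat (C_mat S)
          \<and> (\<forall>i\<le>maxP S + 1. \<forall>j\<le>maxP S. \<exists>!x. solves (C_mat S) (e_vec S i j) x))
     \<and> (S = general_setting n p t \<and> t (-1) < t 0 \<and> t (int p + int n + 1) < t (int p + int n + 2) \<longrightarrow>
          (let C' = gram S (4 * n + 1) (tauK S) (maxT S) (t (-1)) (t (int p + int n + 2)) in
             invertible_mat C'
             \<and> (\<forall>i\<le>maxP S + 1. \<forall>j\<le>maxP S.
                  (\<exists>!x. solves C' (e_vec S i j) x)
                  \<and> (\<forall>x. solves C' (e_vec S i j) x \<longrightarrow> solves (C_mat S) (e_vec S i j) x))))
     \<and> (\<forall>\<zeta>. (\<forall>i\<le>maxP S + 1. \<forall>j\<le>maxP S. solves (C_mat S) (e_vec S i j) (\<zeta> i j)) \<longrightarrow>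
          (\<forall>i\<le>maxP S + 1. \<forall>j\<le>maxP S. \<forall>s\<in>{intA S..intB S}.
             basis S (rhoK S) (2 * n + 1) i s * basis S (nuK S) (2 * n) j s
             = (\<Sum>k\<le>maxT S. \<zeta> i j $ k * basis S (tauK S) (4 * n + 1) k s))
          \<and> (\<forall>s\<in>{domA S..domB S}.
               (\<Sum>k\<le>maxT S. gamma_coeff S z \<zeta> k * of_real (basis S (tauK S) (4 * n + 1) k s)) \<noteq> 0
               \<and> offset_curve S z r0 h s
                 = (\<Sum>k\<le>maxT S. q_coeff S z r0 h \<zeta> k * of_real (basis S (tauK S) (4 * n + 1) k s))
                   / (\<Sum>k\<le>maxT S. gamma_coeff S z \<zeta> k * of_real (basis S (tauK S) (4 * n + 1) k s))))
     \<and> (S = general_setting n p t \<longrightarrow> (\<forall>m. p = m + n \<longrightarrow>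
          tauK S = replicate (2 * n + 1) (t (-1))
                   @ concat (map (\<lambda>k. replicate (3 * n + 2) (t k)) [0..int m + 2 * int n + 1])
                   @ replicate (2 * n + 1) (t (int m + 2 * int n + 2))
          \<and> maxT S = (3 * n + 2) * (m + 2 * n + 2) - 1))
     \<and> (S = clamped_setting n p t \<longrightarrow>
          tauK S = replicate (4 * n + 2) (t (int n))
                   @ concat (map (\<lambda>k. replicate (3 * n + 2) (t k)) [int n + 1..int p])
                   @ replicate (4 * n + 2) (t (int p + 1))
          \<and> maxT S = 4 * n + 1 + (p - n) * (3 * n + 2))"
proof -
  obtain x0 x1 where "ph_setting S n x0 x1"
    using setting general_ph_setting(1)[OF degree, of t] clamped_ph_setting(1)[OF degree, of t] by blast
  then interpret ph_setting S n z r0 x0 x1 .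
  have neq: "general_setting n p t \<noteq> clamped_setting n p t" by (rule general_neq_clamped[OF degree])
  show ?thesis
  proof (intro conjI)
    show "invertible_mat (A_mat S)" by (rule A_invertible)
    show "\<forall>s\<in>{domA S..domB S}.
          (r_curve S z r0 has_vector_derivative (z_curve S z s)\<^sup>2) (at s within {domA S..domB S})
          \<and> (z_curve S z s)\<^sup>2 = spline S (2 * n) (nuK S) (maxP S) (p_coeff S z) s
          \<and> of_real (speed S z s) = spline S (2 * n) (nuK S) (maxP S) (sigma_coeff S z) s"
      using r_has_derivative z_square by blast
    show "\<forall>k\<le>maxT S. \<forall>l\<le>maxT S. 4 * n + 1 < nat \<bar>int k - int l\<bar> \<longrightarrow> C_mat S $$ (k, l) = 0"
      using C_banded by blast
    show "\<forall>i\<le>maxP S + 1. \<forall>j\<le>maxP S.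
          (\<exists>x. solves (C_mat S) (e_vec S i j) x)
          \<and> (\<forall>x y. solves (C_mat S) (e_vec S i j) x \<longrightarrow> solves (C_mat S) (e_vec S i j) y \<longrightarrow>
               (\<forall>k\<le>maxT S. (\<exists>s\<in>{intA S<..<intB S}. basis S (tauK S) (4 * n + 1) k s \<noteq> 0) \<longrightarrow>
                  x $ k = y $ k))"
      using e_solvable C_unique by blast
    show "S = clamped_setting n p t \<longrightarrow>
          invertible_mat (C_mat S)
          \<and> (\<forall>i\<le>maxP S + 1. \<forall>j\<le>maxP S. \<exists>!x. solves (C_mat S) (e_vec S i j) x)"
    proof
      assume S: "S = clamped_setting n p t"
      have t: "\<And>i. i \<in> {int n..int p} \<Longrightarrow> t i < t (i + 1)" using setting S neq by blast
      have C: "C_mat S = gram S (4 * n + 1) (tauK S) (maxT S) (intA S) (intB S)"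
        by (simp add: C_mat_def n(2))
      have tau: "count_list (tauK S) x \<le> 4 * n + 2" "intA S \<le> x \<and> x \<le> intB S" if "x \<in> set (tauK S)" for x
        using clamped_ph_setting(2,3)[OF degree, where t = t and x = x, OF t] that unfolding S by (simp_all add: clamped_setting_def)
      show "invertible_mat (C_mat S)
          \<and> (\<forall>i\<le>maxP S + 1. \<forall>j\<le>maxP S. \<exists>!x. solves (C_mat S) (e_vec S i j) x)"
        using gram_regular[OF order_refl order_refl tau] unfolding C by blast
    qed
    show "S = general_setting n p t \<and> t (-1) < t 0 \<and> t (int p + int n + 1) < t (int p + int n + 2) \<longrightarrow>
          (let C' = gram S (4 * n + 1) (tauK S) (maxT S) (t (-1)) (t (int p + int n + 2)) in
             invertible_mat C'
             \<and> (\<forall>i\<le>maxP S + 1. \<forall>j\<le>maxP S.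
                  (\<exists>!x. solves C' (e_vec S i j) x)
                  \<and> (\<forall>x. solves C' (e_vec S i j) x \<longrightarrow> solves (C_mat S) (e_vec S i j) x)))"
    proof (intro impI, elim conjE)
      assume S: "S = general_setting n p t"
        and strict: "t (-1) < t 0" "t (int p + int n + 1) < t (int p + int n + 2)"
      have t: "t (- 1) \<le> t 0" "\<And>i. i \<in> {0..int p + int n} \<Longrightarrow> t i < t (i + 1)"
        "t (int p + int n + 1) \<le> t (int p + int n + 2)" using setting neq unfolding S by auto
      have ab: "t (- 1) \<le> intA S" "intB S \<le> t (int p + int n + 2)"
        using strict unfolding S by (simp_all add: general_setting_def)
      have tau: "count_list (tauK S) x \<le> 4 * n + 2" "t (- 1) \<le> x \<and> x \<le> t (int p + int n + 2)"
        if "x \<in> set (tauK S)" for x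
        using general_ph_setting(2,3)[OF degree, where t = t and x = x, OF t] strict that unfolding S by blast+
      show "let C' = gram S (4 * n + 1) (tauK S) (maxT S) (t (-1)) (t (int p + int n + 2)) in
             invertible_mat C'
             \<and> (\<forall>i\<le>maxP S + 1. \<forall>j\<le>maxP S.
                  (\<exists>!x. solves C' (e_vec S i j) x)
                  \<and> (\<forall>x. solves C' (e_vec S i j) x \<longrightarrow> solves (C_mat S) (e_vec S i j) x))"
        unfolding Let_def using gram_regular[OF ab tau] by blast
    qed
    show "\<forall>\<zeta>. (\<forall>i\<le>maxP S + 1. \<forall>j\<le>maxP S. solves (C_mat S) (e_vec S i j) (\<zeta> i j)) \<longrightarrow>
          (\<forall>i\<le>maxP S + 1. \<forall>j\<le>maxP S. \<forall>s\<in>{intA S..intB S}.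
             basis S (rhoK S) (2 * n + 1) i s * basis S (nuK S) (2 * n) j s
             = (\<Sum>k\<le>maxT S. \<zeta> i j $ k * basis S (tauK S) (4 * n + 1) k s))
          \<and> (\<forall>s\<in>{domA S..domB S}.
               (\<Sum>k\<le>maxT S. gamma_coeff S z \<zeta> k * of_real (basis S (tauK S) (4 * n + 1) k s)) \<noteq> 0
               \<and> offset_curve S z r0 h s
                 = (\<Sum>k\<le>maxT S. q_coeff S z r0 h \<zeta> k * of_real (basis S (tauK S) (4 * n + 1) k s))
                   / (\<Sum>k\<le>maxT S. gamma_coeff S z \<zeta> k * of_real (basis S (tauK S) (4 * n + 1) k s)))"
      (is "\<forall>\<zeta>. ?sol \<zeta> \<longrightarrow> ?P \<zeta>")
    proof (intro allI impI)
      fix \<zeta> assume "?sol \<zeta>"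
      then have sol: "\<And>i j. i \<le> maxP S + 1 \<Longrightarrow> j \<le> maxP S \<Longrightarrow> solves (C_mat S) (e_vec S i j) (\<zeta> i j)"
        by blast
      show "?P \<zeta>"
        using product_expansion[OF _ _ sol] offset[OF sol _ bspec[OF regular]] by blast
    qed
    show "S = general_setting n p t \<longrightarrow> (\<forall>m. p = m + n \<longrightarrow>
          tauK S = replicate (2 * n + 1) (t (-1))
                   @ concat (map (\<lambda>k. replicate (3 * n + 2) (t k)) [0..int m + 2 * int n + 1])
                   @ replicate (2 * n + 1) (t (int m + 2 * int n + 2))
          \<and> maxT S = (3 * n + 2) * (m + 2 * n + 2) - 1)"
      by (auto simp: general_setting_def knots_def mult_knots_def algebra_simps)
    show "S = clamped_setting n p t \<longrightarrow>
          tauK S = replicate (4 * n + 2) (t (int n))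
                   @ concat (map (\<lambda>k. replicate (3 * n + 2) (t k)) [int n + 1..int p])
                   @ replicate (4 * n + 2) (t (int p + 1))
          \<and> maxT S = 4 * n + 1 + (p - n) * (3 * n + 2)"
      by (auto simp: clamped_setting_def knots_def mult_knots_def)
  qed
qed

end
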